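(* Let $f_1, \dots, f_m\colon [0,1] \to \mathbb{R}$ be continuous functions. For a prime $r \ge 2$ let $n = (r-1)m$. Let $C_1, \dots, C_\ell$ be a partition of $[n+1]$ with $|C_i| \le r-1$ for every $i$. Then there are points $0 = t_0 \le t_1 \le \dots \le t_{n+1} = 1$ and a partition of the index set $[n+1]$ into subsets $T_1, \dots, T_r$ with $|C_i \cap T_j| \le 1$ for every $i$ and $j$ such that $$\sum_{j\in T_1} \bigl(f_k(t_j)-f_k(t_{j-1})\bigr) = \sum_{j\in T_2} \bigl(f_k(t_j)-f_k(t_{j-1})\bigr) = \dots = \sum_{j\in T_r} \bigl(f_k(t_j)-f_k(t_{j-1})\bigr) \quad \text{for all } k = 1, \dots, m.$$
   Context: $[N]=\{1,\dots,N\}$. The parts $T_1,\dots,T_r$ of the partition of $[n+1]$ are pairwise disjoint with union $[n+1]$ and may be empty. *)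

theory Defs
  imports "HOL-Analysis.Analysis" "HOL-Computational_Algebra.Primes"
begin

(* Parts are indexed by 1, ..., p and may be empty. Disjointness is required of the indexed
   family, so two different indices share a part only if that part is empty. *)
definition partition_into :: "nat \<Rightarrow> (nat \<Rightarrow> nat set) \<Rightarrow> nat set \<Rightarrow> bool" where
  "partition_into p P A \<longleftrightarrow> disjoint_family_on P {1..p} \<and> (\<Union>i\<in>{1..p}. P i) = A"

end

theory Submission
  imports Defs "HOL-Homology.Simplices" "HOL-Library.Function_Algebras" "HOL-Number_Theory.Cong"
begin

text \<open>A cut \<open>0 = t\<^sub>0 \<le> \<dots> \<le> t\<^sub>n\<^sub>+\<^sub>1 = 1\<close> is a point \<open>x\<close> of an \<open>n\<close>-simplex, with coordinates
\<open>x\<^sub>j = t\<^sub>j - t\<^sub>j\<^sub>-\<^sub>1\<close>. A piece of length 0 contributes 0 to every sum, so only the parts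
that receive the pieces of positive length matter. A cut together with such a partial assignment is
a point of a simplicial complex: its vertices are pairs (column \<open>c\<close>, row \<open>s\<close>), read as "piece \<open>c\<close>
goes to part \<open>s\<close>", and its faces are the rainbow assignments, which use every column at most once
and every row at most once within a colour class. The cyclic group of order \<open>r\<close> rotates the rows.
The argument is the degree argument behind the optimal coloured Tverberg theorem of Blagojevic,
Matschke and Ziegler, carried out with explicit chains.

Reduction. Adding columns makes every class have exactly \<open>r - 1\<close> columns and leaves one single column
over. Split the added columns, including the single one, into groups of \<open>r - 1\<close>. For each
group one more family of functions is balanced, namely
the coordinates \<open>x\<^sub>c\<close> of the group. Some row receives no column of the group, so its sum is 0;
hence all the sums are 0 and the added columns have length 0. The number of families is then the
number \<open>L\<close> of classes (\<open>padding\<close>, \<open>balanced_rainbow_point\<close>).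

Topology. Suppose that at no point of the rainbow complex all \<open>r\<close> row sums agree for all \<open>L\<close>
families. Label a vector of row sums by a pair \<open>(k, s)\<close> such that family \<open>k\<close> has the largest spread
and row \<open>s\<close> is maximal in it. Labels of nearby points never contain a whole family
\<open>{(k, s) | s < r}\<close>. As \<open>r\<close> is prime, rotation acts freely on the sets of labels with this property
(\<open>chosen_unique\<close>), so the labels can be chosen equivariantly. Iterated barycentric subdivision now
gives an equivariant chain map \<open>h\<close> from the rainbow complex to the complex of the label sets that
contain no whole family (\<open>label_map_boundary\<close>, \<open>label_map_rot\<close>, \<open>label_map_closed\<close>). Such a label
set has at most \<open>L * (r - 1)\<close> elements. Let \<open>M\<close> be the join of suitable top-dimensional cycles
of the \<open>L\<close> chessboard complexes, with \<open>r - 1\<close> columns and \<open>r\<close> rows, that belong to the classes. The single column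
makes \<open>M\<close> the boundary of a cone, and \<open>h\<close> sends the cone to a chain of too high a dimension, that is
to 0. Therefore \<open>h M = 0\<close>.

Algebra. This contradicts an invariant of \<open>M\<close> modulo \<open>r\<close>. In a complex with a free action let \<open>N\<close> be
the sum over all rotations and \<open>D\<close> the difference of the identity and one rotation; the kernel of each
of them is the image of the other. A cycle \<open>z\<close> that is killed by one of them is the image
of some \<open>u\<close> under the other, the boundary of \<open>u\<close> is again such a cycle with \<open>N\<close> and \<open>D\<close> exchanged, and
so on down to a multiple \<open>c\<close> of the empty simplex. Modulo \<open>r\<close> the number \<open>c\<close> depends on \<open>z\<close> only
(\<open>ladder_unique\<close>), equivariant chain maps preserve it (\<open>ladder_hom\<close>), and it is multiplicative for joins
(\<open>ladder_cat_chain\<close>). For one chessboard complex, forgetting the columns maps the chosen cycle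
to \<open>(r - 1)!\<close> times a cycle with \<open>c = 1\<close> in the boundary of the simplex on the \<open>r\<close> rows
(\<open>board_ladder\<close>). So \<open>c\<close> is congruent to a power of \<open>(r - 1)!\<close> for \<open>M\<close>, which the prime \<open>r\<close> does not
divide (\<open>rainbow_ladder\<close>), whereas \<open>c\<close> is 0 modulo \<open>r\<close> for the cycle 0.\<close>

section \<open>Ladders in complexes with a cyclic group action\<close>

text \<open>The operators \<open>A\<close> and \<open>B\<close> stand for the norm \<open>N\<close> and the difference \<open>D\<close> in the group ring of a cyclic
group of order \<open>r\<close>, in either order: every induction below exchanges them at each step. Degrees are
shifted by one and the complex is augmented, so \<open>C 0\<close> consists of the multiples of the empty simplex
and \<open>val\<close> reads off the coefficient. Of the two operators one multiplies
this coefficient by \<open>r\<close> and the other one kills it, which gives the divisibility assumptions.\<close>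

locale exact_pair =
  fixes C :: "nat \<Rightarrow> 'g::ab_group_add set"
    and bd :: "'g \<Rightarrow> 'g" and val :: "'g \<Rightarrow> int" and r :: nat
    and A B :: "'g \<Rightarrow> 'g"
  assumes zero_closed: "0 \<in> C q"
    and diff_closed: "x \<in> C q \<Longrightarrow> y \<in> C q \<Longrightarrow> x - y \<in> C q"
    and bd_closed: "x \<in> C (Suc q) \<Longrightarrow> bd x \<in> C q"
    and bd_diff: "bd (x - y) = bd x - bd y"
    and bd_bd: "x \<in> C q \<Longrightarrow> bd (bd x) = 0"
    and val_diff: "val (x - y) = val x - val y"
    and A_closed: "x \<in> C q \<Longrightarrow> A x \<in> C q" and B_closed: "x \<in> C q \<Longrightarrow> B x \<in> C q"
    and A_diff: "A (x - y) = A x - A y" and B_diff: "B (x - y) = B x - B y"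
    and bd_A: "x \<in> C q \<Longrightarrow> bd (A x) = A (bd x)" and bd_B: "x \<in> C q \<Longrightarrow> bd (B x) = B (bd x)"
    and AB: "x \<in> C q \<Longrightarrow> A (B x) = 0" and BA: "x \<in> C q \<Longrightarrow> B (A x) = 0"
    and A_exact: "x \<in> C (Suc q) \<Longrightarrow> A x = 0 \<Longrightarrow> \<exists>y\<in>C (Suc q). x = B y"
    and B_exact: "x \<in> C (Suc q) \<Longrightarrow> B x = 0 \<Longrightarrow> \<exists>y\<in>C (Suc q). x = A y"
    and val_A: "x \<in> C 0 \<Longrightarrow> int r dvd val (A x)" and val_B: "x \<in> C 0 \<Longrightarrow> int r dvd val (B x)"

lemma exact_pair_swap: "exact_pair C bd val r A B \<Longrightarrow> exact_pair C bd val r B A"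
  unfolding exact_pair_def by (elim conjE, intro conjI) assumption+

text \<open>The descent from a cycle of degree \<open>q\<close> to a number, with the two operators alternating.\<close>

inductive ladder :: "(nat \<Rightarrow> 'g::ab_group_add set) \<Rightarrow> ('g \<Rightarrow> 'g) \<Rightarrow> ('g \<Rightarrow> int) \<Rightarrow>
    ('g \<Rightarrow> 'g) \<Rightarrow> ('g \<Rightarrow> 'g) \<Rightarrow> nat \<Rightarrow> 'g \<Rightarrow> int \<Rightarrow> bool"
  for C bd val where
  base: "z \<in> C 0 \<Longrightarrow> ladder C bd val A B 0 z (val z)"
| step: "u \<in> C (Suc q) \<Longrightarrow> ladder C bd val B A q (bd u) c \<Longrightarrow> ladder C bd val A B (Suc q) (A u) c"

lemma ladder_diff:
  assumes "ladder C bd val A B q z c" "ladder C bd val A B q z' c'" "exact_pair C bd val r A B"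
  shows "ladder C bd val A B q (z - z') (c - c')"
  using assms
proof (induction arbitrary: z' c' rule: ladder.induct)
  case (base z A B)
  interpret exact_pair C bd val r A B by fact
  from base(2) show ?case
  proof cases
    case base
    then show ?thesis
      using ladder.base[where C=C and bd=bd and val=val and A=A and B=B, OF diff_closed[of z 0 z']] \<open>z \<in> C 0\<close> val_diff
      by metis
  qed
next
  case (step u q B A c)
  interpret exact_pair C bd val r A B by fact
  from step(4) show ?case
  proof cases
    case (step u')
    note ih = \<open>\<And>z' c'. ladder C bd val B A q z' c' \<Longrightarrow> _ \<Longrightarrow> _\<close>
    have "ladder C bd val B A q (bd u - bd u') (c - c')"
      by (rule ih[OF step(3) exact_pair_swap[OF \<open>exact_pair C bd val r A B\<close>]])
    then have "ladder C bd val A B (Suc q) (A (u - u')) (c - c')"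
      by (intro ladder.step diff_closed) (use step \<open>u \<in> C (Suc q)\<close> bd_diff in auto)
    then show ?thesis using step A_diff by simp
  qed
qed

lemma ladder_zero:
  assumes "exact_pair C bd val r A B"
  shows "ladder C bd val A B q 0 0"
  using assms
proof (induction q arbitrary: A B)
  case 0
  interpret exact_pair C bd val r A B by fact
  have "val 0 = 0" using val_diff[of 0 0] by simp
  then show ?case using ladder.base[of 0 C, OF zero_closed] by metis
next
  case (Suc q)
  interpret exact_pair C bd val r A B by fact
  have [simp]: "bd 0 = 0" "A 0 = 0" using bd_diff[of 0 0] A_diff[of 0 0] by auto
  show ?case
    using ladder.step[of 0 C q bd val B A 0] Suc.IH[OF exact_pair_swap[OF Suc.prems]] zero_closed
    by simp
qed

lemma ladder_multiple:
  assumes "ladder C bd val A B q z c" "exact_pair C bd val r A B"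
  shows "ladder C bd val A B q (\<Sum>i<k. z) (int k * c)"
proof (induction k)
  case 0
  then show ?case using ladder_zero[OF assms(2)] by simp
next
  case (Suc k)
  have "ladder C bd val A B q (0 - z) (0 - c)"
    by (rule ladder_diff[OF ladder_zero[OF assms(2)] assms])
  from ladder_diff[OF Suc this assms(2)] show ?case by (simp add: algebra_simps)
qed

text \<open>The heart of the invariance. If \<open>A u = A (bd w)\<close>, then \<open>u - bd w\<close> is killed by \<open>A\<close>, so it is \<open>B y\<close>, and
taking boundaries gives \<open>bd u = B (bd y)\<close>: the same situation one degree lower. In degree 0 the number
is a value of \<open>A\<close> and therefore divisible by \<open>r\<close>.\<close>

lemma ladder_of_boundary:
  assumes "ladder C bd val A B q z c" "exact_pair C bd val r A B" "w \<in> C (Suc q)" "z = A (bd w)"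
  shows "int r dvd c"
  using assms
proof (induction arbitrary: w rule: ladder.induct)
  case (base z A B)
  interpret exact_pair C bd val r A B by fact
  show ?case using base val_A[OF bd_closed] by simp
next
  case (step u q B A c)
  interpret exact_pair C bd val r A B by fact
  have w: "bd w \<in> C (Suc q)" using bd_closed step by blast
  have "A (u - bd w) = 0" using step A_diff by simp
  then obtain y where y: "y \<in> C (Suc q)" "u - bd w = B y"
    using A_exact[OF diff_closed[OF _ w]] step by blast
  have "bd u = bd (u - bd w)" using bd_diff bd_bd[OF step(5)] by simp
  also have "\<dots> = B (bd y)" using y bd_B by simp
  finally show ?case using step.IH[OF exact_pair_swap[OF step(4)] y(1)] by simp
qed

lemma ladder_unique:
  assumes "ladder C bd val A B q z c" "ladder C bd val A B q z c'" "exact_pair C bd val r A B"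
  shows "int r dvd c - c'"
proof -
  interpret exact_pair C bd val r A B by fact
  have "A (bd 0) = 0" using bd_diff[of 0 0] A_diff[of 0 0] by auto
  then show ?thesis
    using ladder_of_boundary[OF ladder_diff[OF assms] assms(3) zero_closed] by simp
qed

lemma ladder_exists:
  assumes "exact_pair C bd val r A B" "z \<in> C q" "bd z = 0" "B z = 0"
  shows "\<exists>c. ladder C bd val A B q z c"
  using assms
proof (induction q arbitrary: A B z)
  case 0
  then show ?case using ladder.base by metis
next
  case (Suc q)
  interpret exact_pair C bd val r A B by fact
  obtain u where u: "u \<in> C (Suc q)" "z = A u" using B_exact Suc by blast
  have "A (bd u) = 0" using bd_A[OF u(1)] u Suc by simp
  then have "\<exists>c. ladder C bd val B A q (bd u) c"
    using Suc.IH[OF exact_pair_swap[OF Suc.prems(1)]] u bd_closed bd_bd by blast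
  then show ?case using ladder.step u by metis
qed

lemma ladder_hom:
  assumes "ladder C bd val A B q z c"
    and "\<And>q x. x \<in> C q \<Longrightarrow> h x \<in> C' q"
    and "\<And>q x. x \<in> C (Suc q) \<Longrightarrow> h (bd x) = bd' (h x)"
    and "\<And>x. x \<in> C 0 \<Longrightarrow> val' (h x) = val x"
    and "\<And>q x. x \<in> C q \<Longrightarrow> h (A x) = A' (h x)"
    and "\<And>q x. x \<in> C q \<Longrightarrow> h (B x) = B' (h x)"
  shows "ladder C' bd' val' A' B' q (h z) c"
  using assms(1,5,6)
proof (induction arbitrary: A' B' rule: ladder.induct)
  case (base z A B)
  then show ?case using ladder.base assms(2,4) by metis
next
  case (step u q B A c)
  have "ladder C' bd' val' B' A' q (h (bd u)) c" using step by blast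
  then show ?case
    using ladder.step[of "h u" C' q bd'] assms(2,3) step by metis
qed

text \<open>Where cycles bound, a ladder can be built from the bottom upwards: fill a cycle and apply the operator
whose turn it is. This produces a cycle whose number is known.\<close>

lemma ladder_ascend:
  assumes "exact_pair C bd val r A B" "e \<in> C 0" "bd e = 0" "B e = 0"
    and "\<And>q z. q < p \<Longrightarrow> z \<in> C q \<Longrightarrow> bd z = 0 \<Longrightarrow> \<exists>u\<in>C (Suc q). bd u = z"
    and "q \<le> p"
  shows "\<exists>z\<in>C q. bd z = 0 \<and> (if even q then B else A) z = 0 \<and>
    ladder C bd val (if even q then A else B) (if even q then B else A) q z (val e)"
  using assms(6)
proof (induction q)
  case 0
  show ?case using assms ladder.base[of e C] by auto
next
  case (Suc q)
  interpret exact_pair C bd val r A B by fact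
  obtain z where z: "z \<in> C q" "bd z = 0" "(if even q then B else A) z = 0"
    "ladder C bd val (if even q then A else B) (if even q then B else A) q z (val e)"
    using Suc by auto
  obtain u where u: "u \<in> C (Suc q)" "bd u = z" using assms(5) z Suc by (meson Suc_le_eq)
  show ?case
  proof (cases "even q")
    case True
    have "B u \<in> C (Suc q)" "bd (B u) = 0" "A (B u) = 0"
      using u z True bd_B[OF u(1)] AB[OF u(1)] B_closed by auto
    moreover have "ladder C bd val B A (Suc q) (B u) (val e)"
      using ladder.step[of u C q bd val A B] u z(4) True by simp
    ultimately show ?thesis using True by auto
  next
    case False
    have "A u \<in> C (Suc q)" "bd (A u) = 0" "B (A u) = 0"
      using u z False bd_A[OF u(1)] BA[OF u(1)] A_closed by auto
    moreover have "ladder C bd val A B (Suc q) (A u) (val e)"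
      using ladder.step[of u C q bd val B A] u z(4) False by simp
    ultimately show ?thesis using False by auto
  qed
qed

section \<open>The norm and the difference operator of a free action\<close>

definition norm_op :: "nat \<Rightarrow> ('g \<Rightarrow> 'g) \<Rightarrow> 'g \<Rightarrow> 'g::ab_group_add" where
  "norm_op r \<tau> x = (\<Sum>i<r. (\<tau> ^^ i) x)"

definition diff_op :: "('g \<Rightarrow> 'g) \<Rightarrow> 'g \<Rightarrow> 'g::ab_group_add" where
  "diff_op \<tau> x = x - \<tau> x"

lemma additiveI: "(\<And>x y. f (x - y) = f x - f y) \<Longrightarrow> Modules.additive f"
  by unfold_locales (metis add_diff_cancel diff_add_cancel)

lemma funpow_additive:
  fixes \<tau> :: "'g::ab_group_add \<Rightarrow> 'g"
  assumes "Modules.additive \<tau>"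
  shows "Modules.additive (\<tau> ^^ i)"
proof
  fix x y
  show "(\<tau> ^^ i) (x + y) = (\<tau> ^^ i) x + (\<tau> ^^ i) y"
  proof (induction i)
    case (Suc i)
    then show ?case by (simp add: additive.add[OF assms])
  qed simp
qed

lemma diff_norm:
  assumes "Modules.additive \<tau>" "(\<tau> ^^ r) x = x"
  shows "diff_op \<tau> (norm_op r \<tau> x) = 0"
proof -
  have "\<tau> (norm_op r \<tau> x) = (\<Sum>i<r. (\<tau> ^^ Suc i) x)"
    by (simp add: norm_op_def additive.sum[OF assms(1)])
  moreover have "(\<tau> ^^ 0) x + (\<Sum>i<r. (\<tau> ^^ Suc i) x) = norm_op r \<tau> x + (\<tau> ^^ r) x"
    unfolding norm_op_def by (rule trans[OF sum.lessThan_Suc_shift[symmetric] sum.lessThan_Suc])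
  ultimately show ?thesis using assms(2) by (simp add: diff_op_def)
qed

lemma norm_diff:
  assumes "Modules.additive \<tau>" "(\<tau> ^^ r) x = x"
  shows "norm_op r \<tau> (diff_op \<tau> x) = 0"
proof -
  have "norm_op r \<tau> (diff_op \<tau> x) = diff_op \<tau> (norm_op r \<tau> x)"
    unfolding norm_op_def diff_op_def
    by (simp add: additive.diff[OF funpow_additive[OF assms(1)]] sum_subtractf
        additive.sum[OF assms(1)] funpow_swap1)
  then show ?thesis using diff_norm[OF assms] by simp
qed

lemma fixed_is_norm:
  assumes "diff_op \<tau> x = 0" "(\<Sum>i<r. (\<tau> ^^ i) (P ((\<tau> ^^ (r - i)) x))) = x"
  shows "x = norm_op r \<tau> (P x)"
proof -
  have "\<tau> x = x" using assms(1) by (simp add: diff_op_def)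
  then have "(\<tau> ^^ k) x = x" for k by (induction k) auto
  then show ?thesis using assms(2) by (simp add: norm_op_def)
qed

text \<open>The assumption on \<open>P\<close> says that \<open>P\<close> behaves like the restriction to a fundamental domain of a free
action. Let \<open>X i = P (\<tau>\<^sup>r\<^sup>-\<^sup>i x)\<close>. Then \<open>x\<close> is the sum of the \<open>\<tau>\<^sup>i (X i)\<close>, and the sum of the
\<open>X i\<close> is \<open>P\<close> applied to the norm of \<open>x\<close>, that is 0. Hence \<open>x\<close> is the sum of the \<open>\<tau>\<^sup>i (X i) - X i\<close>,
and each of these is a telescoping sum of differences.\<close>

lemma norm_zero_is_diff:
  assumes add: "Modules.additive \<tau>" "Modules.additive P" and "0 < r"
    and N: "norm_op r \<tau> x = 0" and per: "(\<tau> ^^ r) x = x"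
    and dec: "(\<Sum>i<r. (\<tau> ^^ i) (P ((\<tau> ^^ (r - i)) x))) = x"
  shows "x = diff_op \<tau> (- (\<Sum>i<r. \<Sum>j<i. (\<tau> ^^ j) (P ((\<tau> ^^ (r - i)) x))))"
proof -
  define X where "X i = P ((\<tau> ^^ (r - i)) x)" for i
  have tel: "diff_op \<tau> (\<Sum>j<i. (\<tau> ^^ j) y) = y - (\<tau> ^^ i) y" for i y
  proof (induction i)
    case 0
    then show ?case by (simp add: diff_op_def additive.zero[OF add(1)])
  next
    case (Suc i)
    have "diff_op \<tau> (\<Sum>j<Suc i. (\<tau> ^^ j) y) =
        diff_op \<tau> (\<Sum>j<i. (\<tau> ^^ j) y) + ((\<tau> ^^ i) y - (\<tau> ^^ Suc i) y)"
      by (simp add: diff_op_def additive.add[OF add(1)])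
    then show ?case unfolding Suc by simp
  qed
  have "(\<Sum>i<r. X i) = P (\<Sum>i<r. (\<tau> ^^ (r - i)) x)"
    by (simp add: X_def additive.sum[OF add(2)])
  also have "(\<Sum>i<r. (\<tau> ^^ (r - i)) x) = (\<Sum>i<r. (\<tau> ^^ Suc i) x)"
    using sum.nat_diff_reindex[of "\<lambda>i. (\<tau> ^^ Suc i) x" r]
    by (simp add: Suc_diff_Suc)
  also have "\<dots> = \<tau> (norm_op r \<tau> x)"
    by (simp add: norm_op_def additive.sum[OF add(1)])
  finally have X0: "(\<Sum>i<r. X i) = 0"
    using N additive.zero[OF add(1)] additive.zero[OF add(2)] by simp
  have *: "diff_op \<tau> (- y) = - diff_op \<tau> y" "diff_op \<tau> (sum f I) = (\<Sum>i\<in>I. diff_op \<tau> (f i))"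
    for y f and I :: "nat set"
    by (simp_all add: diff_op_def additive.minus[OF add(1)] additive.sum[OF add(1)] sum_subtractf)
  have "diff_op \<tau> (- (\<Sum>i<r. \<Sum>j<i. (\<tau> ^^ j) (X i))) = - (\<Sum>i<r. X i - (\<tau> ^^ i) (X i))"
    by (subst *(1), subst *(2)) (simp only: tel)
  also have "\<dots> = x" using X0 dec by (simp add: sum_subtractf X_def)
  finally show ?thesis by (simp add: X_def)
qed

lemma exact_pair_free:
  assumes "0 < r"
    and zero: "\<And>q. 0 \<in> C q"
    and diff: "\<And>q x y. x \<in> C q \<Longrightarrow> y \<in> C q \<Longrightarrow> x - y \<in> C q"
    and "\<And>q x. x \<in> C (Suc q) \<Longrightarrow> bd x \<in> C q"
    and bd_diff: "\<And>x y. bd (x - y) = bd x - bd y"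
    and "\<And>q x. x \<in> C q \<Longrightarrow> bd (bd x) = 0"
    and val_diff: "\<And>x y. val (x - y) = val x - val y"
    and tau_diff: "\<And>x y. \<tau> (x - y) = \<tau> x - \<tau> y"
    and tau: "\<And>q x. x \<in> C q \<Longrightarrow> \<tau> x \<in> C q"
    and bd_tau: "\<And>q x. x \<in> C q \<Longrightarrow> bd (\<tau> x) = \<tau> (bd x)"
    and per: "\<And>q x. x \<in> C q \<Longrightarrow> (\<tau> ^^ r) x = x"
    and val: "\<And>x. x \<in> C 0 \<Longrightarrow> int r dvd val (norm_op r \<tau> x)" "\<And>x. x \<in> C 0 \<Longrightarrow> int r dvd val (diff_op \<tau> x)"
    and P_diff: "\<And>x y. P (x - y) = P x - P y"
    and P: "\<And>q x. x \<in> C q \<Longrightarrow> P x \<in> C q"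
    and dec: "\<And>q x. x \<in> C (Suc q) \<Longrightarrow> (\<Sum>i<r. (\<tau> ^^ i) (P ((\<tau> ^^ (r - i)) x))) = x"
  shows "exact_pair C bd val r (norm_op r \<tau>) (diff_op \<tau>)"
proof -
  have at: "Modules.additive \<tau>" and aP: "Modules.additive P" and ab: "Modules.additive bd"
    using tau_diff P_diff bd_diff by (auto intro: additiveI)
  have minus: "- x \<in> C q" if "x \<in> C q" for x q using diff[OF zero that] by simp
  have plus: "x + y \<in> C q" if "x \<in> C q" "y \<in> C q" for x y q using diff[OF that(1) minus[OF that(2)]] by simp
  have sumc: "sum f I \<in> C q" if "\<And>i. i \<in> I \<Longrightarrow> f i \<in> C q" for f q and I :: "nat set"
    using that by (induction I rule: infinite_finite_induct) (auto simp: zero plus)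
  have pow: "(\<tau> ^^ i) x \<in> C q" if "x \<in> C q" for i x q using that by (induction i) (auto simp: tau)
  have bdpow: "bd ((\<tau> ^^ i) x) = (\<tau> ^^ i) (bd x)" if "x \<in> C q" for i x q
  proof (induction i)
    case (Suc i)
    then show ?case using bd_tau[OF pow[OF that]] by simp
  qed simp
  have c1: "norm_op r \<tau> x \<in> C q" if "x \<in> C q" for x q
    unfolding norm_op_def by (intro sumc pow that)
  have c2: "diff_op \<tau> x \<in> C q" if "x \<in> C q" for x q
    unfolding diff_op_def by (intro diff tau that)
  have c3: "bd (norm_op r \<tau> x) = norm_op r \<tau> (bd x)" if "x \<in> C q" for x q
    unfolding norm_op_def additive.sum[OF ab] using bdpow[OF that] by simp
  have c4: "bd (diff_op \<tau> x) = diff_op \<tau> (bd x)" if "x \<in> C q" for x q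
    unfolding diff_op_def bd_diff using bd_tau[OF that] by simp
  have c5: "norm_op r \<tau> (diff_op \<tau> x) = 0" if "x \<in> C q" for x q
    using norm_diff[OF at per[OF that]] .
  have c6: "diff_op \<tau> (norm_op r \<tau> x) = 0" if "x \<in> C q" for x q
    using diff_norm[OF at per[OF that]] .
  have c7: "\<exists>y\<in>C (Suc q). x = diff_op \<tau> y" if x: "x \<in> C (Suc q)" "norm_op r \<tau> x = 0" for x q
  proof
    show "- (\<Sum>i<r. \<Sum>j<i. (\<tau> ^^ j) (P ((\<tau> ^^ (r - i)) x))) \<in> C (Suc q)"
      by (intro minus sumc pow P x)
    show "x = diff_op \<tau> (- (\<Sum>i<r. \<Sum>j<i. (\<tau> ^^ j) (P ((\<tau> ^^ (r - i)) x))))"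
      by (rule norm_zero_is_diff[OF at aP \<open>0 < r\<close> x(2) per[OF x(1)] dec[OF x(1)]])
  qed
  have c8: "\<exists>y\<in>C (Suc q). x = norm_op r \<tau> y" if x: "x \<in> C (Suc q)" "diff_op \<tau> x = 0" for x q
    using fixed_is_norm[where r=r and P=P, OF x(2)] dec[OF x(1)] P[OF x(1)] by blast
  have c9: "norm_op r \<tau> (x - y) = norm_op r \<tau> x - norm_op r \<tau> y" for x y
    by (simp only: norm_op_def additive.diff[OF funpow_additive[OF at]] sum_subtractf)
  have c10: "diff_op \<tau> (x - y) = diff_op \<tau> x - diff_op \<tau> y" for x y
    by (simp add: diff_op_def tau_diff)
  show ?thesis
    by (rule exact_pair.intro; fact)
qed

section \<open>Rotations of the rows\<close>

type_synonym vertex = "nat \<times> nat"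

text \<open>Rows \<open>s \<ge> r\<close> never occur; fixing them makes the rotation a bijection of the whole type, with inverse
\<open>tor\<close>.\<close>

definition rot :: "nat \<Rightarrow> vertex \<Rightarrow> vertex" where
  "rot r v = (fst v, if snd v < r then (snd v + 1) mod r else snd v)"

definition tor :: "nat \<Rightarrow> vertex \<Rightarrow> vertex" where
  "tor r v = (fst v, if snd v < r then (snd v + (r - 1)) mod r else snd v)"

lemma mod_pred_succ: "s < r \<Longrightarrow> ((s + (r - Suc 0)) mod r + Suc 0) mod r = (s::nat)"
  "s < r \<Longrightarrow> ((s + Suc 0) mod r + (r - Suc 0)) mod r = (s::nat)"
proof -
  assume s: "s < r"
  then have "((s + (r - Suc 0)) + Suc 0) mod r = s" by simp
  then show "((s + (r - Suc 0)) mod r + Suc 0) mod r = s" by (metis mod_add_left_eq)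
  have "((s + Suc 0) + (r - Suc 0)) mod r = s" using s by simp
  then show "((s + Suc 0) mod r + (r - Suc 0)) mod r = s" by (metis mod_add_left_eq)
qed

lemma rot_tor [simp]: "rot r (tor r v) = v" and tor_rot [simp]: "tor r (rot r v) = v"
  using mod_pred_succ[of "snd v" r] by (auto simp: rot_def tor_def prod_eq_iff)

lemma rot_simps [simp]: "fst (rot r v) = fst v" "fst (tor r v) = fst v"
  "snd (rot r v) < r \<longleftrightarrow> snd v < r" "snd (tor r v) < r \<longleftrightarrow> snd v < r"
  by (auto simp: rot_def tor_def split: if_splits)

lemma rot_eq_iff [simp]: "rot r v = rot r w \<longleftrightarrow> v = w" and tor_eq_iff [simp]: "tor r v = tor r w \<longleftrightarrow> v = w"
  by (metis tor_rot, metis rot_tor)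

lemma rot_pow: "(rot r ^^ i) v = (fst v, if snd v < r then (snd v + i) mod r else snd v)"
  by (induction i) (auto simp: rot_def mod_Suc_eq)

lemma rot_pow_r [simp]: "(rot r ^^ r) v = v"
  by (simp add: rot_pow)

lemma tor_pow_rot_pow: "(tor r ^^ i) ((rot r ^^ i) v) = v"
  by (induction i) (simp_all add: funpow_swap1[of "tor r"])

lemma rot_pow_tor_pow: "(rot r ^^ i) ((tor r ^^ i) v) = v"
  by (induction i) (simp_all add: funpow_swap1[of "rot r"])

lemma tor_pow_r [simp]: "(tor r ^^ r) v = v"
  by (metis rot_pow_r tor_pow_rot_pow)

lemma map_funpow: "map ((f :: 'v \<Rightarrow> 'v) ^^ i) = (map f ^^ i)"
proof
  fix l show "map (f ^^ i) l = (map f ^^ i) l"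
  proof (induction i)
    case (Suc i)
    have "map (f ^^ Suc i) l = map f (map (f ^^ i) l)"
      by (simp only: funpow.simps map_map)
    also have "\<dots> = (map f ^^ Suc i) l" unfolding Suc by (simp only: funpow.simps comp_apply)
    finally show ?case .
  qed (simp add: map_idI)
qed

definition labels :: "nat \<Rightarrow> nat \<Rightarrow> vertex set" where
  "labels r L = {..<L} \<times> {..<r}"

text \<open>The faces of the join of \<open>L\<close> copies of the boundary of the simplex with vertices \<open>0, \<dots>, r - 1\<close>: this
complex is a sphere of dimension \<open>L * (r - 1) - 1\<close>.\<close>

definition proper :: "nat \<Rightarrow> nat \<Rightarrow> vertex set \<Rightarrow> bool" where
  "proper r L S \<longleftrightarrow> S \<subseteq> labels r L \<and> (\<forall>k<L. \<exists>s<r. (k, s) \<notin> S)"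

lemma proper_mono: "proper r L S \<Longrightarrow> S' \<subseteq> S \<Longrightarrow> proper r L S'"
  unfolding proper_def by blast

lemma proper_empty: "0 < r \<Longrightarrow> proper r L {}"
  unfolding proper_def by blast

lemma labels_rot [simp]: "rot r v \<in> labels r L \<longleftrightarrow> v \<in> labels r L"
  "tor r v \<in> labels r L \<longleftrightarrow> v \<in> labels r L"
  by (auto simp: labels_def mem_Times_iff)

lemma finite_labels [simp]: "finite (labels r L)"
  by (simp add: labels_def)

lemma proper_tor: "proper r L (tor r ` S) \<longleftrightarrow> proper r L S"
proof -
  have 1: "proper r L (tor r ` S)" if pS: "proper r L S" for S
    unfolding proper_def
  proof (intro conjI allI impI)
    show "tor r ` S \<subseteq> labels r L" using pS by (auto simp: proper_def)
    fix k assume "k < L"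
    then obtain s where s: "s < r" "(k, s) \<notin> S" using pS by (auto simp: proper_def)
    then have "tor r (k, s) \<notin> tor r ` S" by auto
    moreover have "fst (tor r (k, s)) = k" "snd (tor r (k, s)) < r" using s by auto
    ultimately show "\<exists>s<r. (k, s) \<notin> tor r ` S" by (metis prod.collapse)
  qed
  have "S = (tor r ^^ (r - 1)) ` (tor r ` S)" if "0 < r"
  proof -
    have "(tor r ^^ (r - 1)) (tor r v) = v" for v
      using tor_pow_r[of r v] that by (metis Suc_diff_1 comp_apply funpow_Suc_right)
    then show ?thesis by (simp add: image_image)
  qed
  moreover have "proper r L ((tor r ^^ i) ` S)" if "proper r L S" for S i
  proof (induction i)
    case (Suc i)
    have "(tor r ^^ Suc i) ` S = tor r ` (tor r ^^ i) ` S" by (simp add: image_image)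
    then show ?case using 1[OF Suc] by simp
  qed (use that in simp)
  ultimately have "proper r L S" if "proper r L (tor r ` S)" "0 < r"
    using that by metis
  moreover have "r = 0 \<Longrightarrow> tor r ` S = S" by (auto simp: tor_def)
  ultimately show ?thesis using 1 by (metis gr_zeroI)
qed

lemma proper_tor_pow: "proper r L ((tor r ^^ i) ` S) \<longleftrightarrow> proper r L S"
proof (induction i)
  case (Suc i)
  have "(tor r ^^ Suc i) ` S = tor r ` (tor r ^^ i) ` S" by (simp add: image_image)
  then show ?case using Suc proper_tor by simp
qed simp

lemma proper_rot: "proper r L (rot r ` S) \<longleftrightarrow> proper r L S"
  using proper_tor[of r L "rot r ` S"] by (simp add: image_image)

text \<open>This is where primality enters the topology. If a rotation by \<open>d\<close> fixes \<open>S\<close>, then so do all multiples of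
\<open>d\<close> modulo \<open>r\<close>, and these are all the residues. So \<open>S\<close> would contain all rows of a family that it meets.\<close>

lemma no_proper_period:
  assumes r: "prime r" and S: "proper r L S" "S \<noteq> {}" and d: "0 < d" "d < r"
  shows "(tor r ^^ d) ` S \<noteq> S"
proof
  assume eq: "(tor r ^^ d) ` S = S"
  obtain v where v: "v \<in> S" using S by blast
  then have kv: "fst v < L" "snd v < r" using S by (auto simp: proper_def labels_def)
  have "(rot r ^^ d) ` (tor r ^^ d) ` S = S"
    by (simp only: image_image rot_pow_tor_pow image_ident)
  then have "(rot r ^^ d) ` S = S" using eq by simp
  then have step: "(rot r ^^ d) w \<in> S" if "w \<in> S" for w using that by blast
  have all: "(fst v, (snd v + e * d) mod r) \<in> S" for e
  proof (induction e)
    case 0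
    then show ?case using v kv by simp
  next
    case (Suc e)
    have "0 < r" using kv by simp
    then show ?case using step[OF Suc] by (simp add: rot_pow mod_simps algebra_simps)
  qed
  obtain s where s: "s < r" "(fst v, s) \<notin> S" using S kv by (auto simp: proper_def)
  have "coprime d r"
    using r d by (metis coprime_commute nat_dvd_not_less prime_imp_coprime_nat)
  then obtain x where "[d * x = Suc 0] (mod r)" using cong_solve_coprime_nat by blast
  then have "[d * x * (s + (r - snd v)) = Suc 0 * (s + (r - snd v))] (mod r)" by (rule cong_scalar_right)
  then obtain e where e: "[d * e = s + (r - snd v)] (mod r)" by (auto simp: mult.assoc)
  have "(snd v + e * d) mod r = (snd v + (s + (r - snd v))) mod r"
    using e by (metis cong_def mod_add_right_eq mult.commute)
  also have "\<dots> = s" using s kv by simp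
  finally show False using all[of e] s by simp
qed

text \<open>One set in each orbit of rotations. The sets that are chosen form a fundamental domain, which is used
twice: for the exactness of the label complex and for equivariant choices of labels.\<close>

definition orbit_rep :: "nat \<Rightarrow> vertex set \<Rightarrow> vertex set" where
  "orbit_rep r S = (SOME S'. \<exists>i. S' = (tor r ^^ i) ` S)"

definition chosen :: "nat \<Rightarrow> vertex set \<Rightarrow> bool" where
  "chosen r S \<longleftrightarrow> orbit_rep r S = S"

lemma orbit_rep_tor: 
  assumes "0 < r" shows "orbit_rep r ((tor r ^^ i) ` S) = orbit_rep r S"
proof -
  have "(\<exists>j. S' = (tor r ^^ j) ` (tor r ^^ i) ` S) \<longleftrightarrow> (\<exists>j. S' = (tor r ^^ j) ` S)" for S'
  proof
    assume "\<exists>j. S' = (tor r ^^ j) ` (tor r ^^ i) ` S"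
    then show "\<exists>j. S' = (tor r ^^ j) ` S" by (metis funpow_add image_comp)
  next
    assume "\<exists>j. S' = (tor r ^^ j) ` S"
    then obtain j where j: "S' = (tor r ^^ j) ` S" by blast
    have "(tor r ^^ (r * i)) v = v" for v
      by (induction i) (simp_all add: funpow_add)
    moreover have "r * i = (r * i - i) + i" using assms by simp
    ultimately have "(tor r ^^ j) v = (tor r ^^ (j + (r * i - i))) ((tor r ^^ i) v)" for v
      by (metis comp_apply funpow_add)
    then show "\<exists>j. S' = (tor r ^^ j) ` (tor r ^^ i) ` S"
      unfolding j by (intro exI[of _ "j + (r * i - i)"]) (simp add: image_image)
  qed
  then show ?thesis unfolding orbit_rep_def by simp
qed

lemma chosen_unique:
  assumes r: "prime r" and S: "proper r L S" "S \<noteq> {}"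
  shows "\<exists>!i. i < r \<and> chosen r ((tor r ^^ i) ` S)"
proof -
  have r0: "0 < r" using r prime_gt_0_nat by blast
  obtain j where j: "orbit_rep r S = (tor r ^^ j) ` S"
    using someI_ex[of "\<lambda>S'. \<exists>i. S' = (tor r ^^ i) ` S"] unfolding orbit_rep_def by blast
  have "(tor r ^^ j) v = (tor r ^^ (j mod r)) v" for v
  proof -
    have "(tor r ^^ (r * k)) v = v" for k by (induction k) (simp_all add: funpow_add)
    then show ?thesis by (metis comp_apply funpow_add mod_mult_div_eq)
  qed
  then have "(tor r ^^ j) ` S = (tor r ^^ (j mod r)) ` S" by auto
  then have ex: "j mod r < r \<and> chosen r ((tor r ^^ (j mod r)) ` S)"
    using j r0 by (simp add: chosen_def orbit_rep_tor)
  have "i = i'" if "i < i'" "i' < r" "chosen r ((tor r ^^ i) ` S)" "chosen r ((tor r ^^ i') ` S)" for i i'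
  proof -
    have "(tor r ^^ i) ` S = (tor r ^^ i') ` S"
      using that r0 by (simp add: chosen_def orbit_rep_tor)
    also have "\<dots> = (tor r ^^ (i' - i)) ` (tor r ^^ i) ` S"
      using that by (metis funpow_add image_comp le_add_diff_inverse2 less_imp_le)
    finally show ?thesis
      using no_proper_period[OF r proper_tor_pow[THEN iffD2, OF S(1)], of i "i' - i"] that(1,2) S(2)
      by (metis image_is_empty less_imp_diff_less zero_less_diff)
  qed
  then show ?thesis using ex by (metis linorder_neqE_nat)
qed

section \<open>Alternating functions as oriented chains\<close>

text \<open>An oriented chain is encoded by the function that sends a list of vertices to the coefficient of the
simplex oriented by that list. No vertex order has to be fixed, the action of a vertex permutation
is plain composition, and the boundary is a sum over the first list entry.\<close>

definition alternating :: "('v list \<Rightarrow> int) \<Rightarrow> bool" where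
  "alternating x \<longleftrightarrow> (\<forall>a v w b. x (a @ v # w # b) = - x (a @ w # v # b))"

lemma alternatingD: "alternating x \<Longrightarrow> x (a @ v # w # b) = - x (a @ w # v # b)"
  unfolding alternating_def by blast

lemma alternating_diff:
  assumes "alternating x" "alternating y" shows "alternating (x - y)"
  unfolding alternating_def
proof (intro allI)
  fix a v w b
  show "(x - y) (a @ v # w # b) = - (x - y) (a @ w # v # b)"
    unfolding minus_apply using alternatingD[OF assms(1), of a v w b] alternatingD[OF assms(2), of a v w b]
    by linarith
qed

lemma alternating_distinct:
  assumes "alternating x" "x l \<noteq> 0" shows "distinct l"
proof (rule ccontr)
  assume "\<not> distinct l"
  then obtain a y b c where l: "l = a @ [y] @ b @ [y] @ c"
    using not_distinct_decomp by blast
  have "x (a @ y # b @ y # c) = 0" for a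
  proof (induction b arbitrary: a)
    case Nil
    show ?case using alternatingD[OF assms(1), of a y y c] by simp
  next
    case (Cons v b)
    have "x (a @ y # v # b @ y # c) = - x ((a @ [v]) @ y # b @ y # c)"
      using alternatingD[OF assms(1), of a y v "b @ y # c"] by simp
    then show ?case using Cons[of "a @ [v]"] by simp
  qed
  then show False using assms(2) l by simp
qed

definition slice :: "('v list \<Rightarrow> int) \<Rightarrow> 'v \<Rightarrow> 'v list \<Rightarrow> int" where
  "slice x v l = x (v # l)"

lemma alternating_slice:
  assumes "alternating x" shows "alternating (slice x v)"
  unfolding alternating_def
proof (intro allI)
  fix a p q b
  have "x ((v # a) @ p # q # b) = - x ((v # a) @ q # p # b)" by (rule alternatingD[OF assms])
  then show "slice x v (a @ p # q # b) = - slice x v (a @ q # p # b)"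
    unfolding slice_def append_Cons .
qed

text \<open>The exterior product with the vertex \<open>v\<close>, expanded along the list as a determinant would be.\<close>

fun wedge :: "'v \<Rightarrow> ('v list \<Rightarrow> int) \<Rightarrow> 'v list \<Rightarrow> int" where
  "wedge v x [] = 0"
| "wedge v x (a # l) = (if a = v then x l else 0) - wedge v (slice x a) l"

lemma wedge_sum: "wedge v (\<lambda>l. \<Sum>i\<in>I. c i * x i l) l = (\<Sum>i\<in>I. c i * wedge v (x i) l)"
proof (induction l arbitrary: x)
  case (Cons a l)
  have "slice (\<lambda>l. \<Sum>i\<in>I. c i * x i l) a = (\<lambda>l. \<Sum>i\<in>I. c i * slice (x i) a l)"
    by (simp add: slice_def fun_eq_iff)
  then show ?case
    using Cons.IH[of "\<lambda>i. slice (x i) a"]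
    by (cases "a = v") (simp_all add: sum_subtractf algebra_simps sum_negf)
qed simp

lemma wedge_scale: "wedge v (\<lambda>l. c * x l) l = c * wedge v x l"
  using wedge_sum[where I = "{()}" and c = "\<lambda>_. c" and x = "\<lambda>_. x"] by simp

lemma wedge_minus:
  assumes "\<And>l. y l = - x l" shows "wedge v y l = - wedge v x l"
proof -
  have "y = (\<lambda>l. (-1) * x l)" using assms by (simp add: fun_eq_iff)
  then show ?thesis using wedge_scale[of v "-1" x l] by simp
qed

lemma alternating_wedge:
  assumes "alternating x" shows "alternating (wedge v x)"
  unfolding alternating_def
proof (intro allI)
  fix a p q b
  show "wedge v x (a @ p # q # b) = - wedge v x (a @ q # p # b)"
    using assms
  proof (induction a arbitrary: x)
    case Nil
    have "wedge v (slice (slice x p) q) b = - wedge v (slice (slice x q) p) b"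
      using alternatingD[OF Nil, of "[]" p q] by (intro wedge_minus) (simp add: slice_def)
    then show ?case by (simp add: slice_def)
  next
    case (Cons h a)
    show ?case
      using Cons.IH[OF alternating_slice[OF Cons.prems]] alternatingD[OF Cons.prems, of a p q b] by simp
  qed
qed

lemma wedge_nonzero:
  "wedge v x l \<noteq> 0 \<Longrightarrow> \<exists>l'. x l' \<noteq> 0 \<and> length l = Suc (length l') \<and> set l = insert v (set l')"
proof (induction l arbitrary: x)
  case (Cons a l)
  have "a = v \<and> x l \<noteq> 0 \<or> wedge v (slice x a) l \<noteq> 0"
    using Cons.prems by (cases "a = v"; cases "wedge v (slice x a) l = 0") simp_all
  then consider "a = v" "x l \<noteq> 0" | "wedge v (slice x a) l \<noteq> 0" by blast
  then show ?case
  proof cases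
    case 2
    obtain l' where l': "x (a # l') \<noteq> 0" "length l = Suc (length l')" "set l = insert v (set l')"
      using Cons.IH[OF 2] unfolding slice_def by blast
    have "set (a # l) = insert v (set (a # l'))" using l'(3) by auto
    then show ?thesis using l'(1,2) by (intro exI[of _ "a # l'"]) simp
  next
    case 1
    then show ?thesis by (intro exI[of _ l]) simp
  qed
qed simp

definition alt_bd :: "'v set \<Rightarrow> ('v list \<Rightarrow> int) \<Rightarrow> 'v list \<Rightarrow> int" where
  "alt_bd V x l = (\<Sum>v\<in>V. x (v # l))"

lemma alt_bd_wedge:
  assumes "finite V" "v \<in> V"
  shows "alt_bd V (wedge v x) = x - wedge v (alt_bd V x)"
proof
  fix l
  have "alt_bd V x = (\<lambda>l. \<Sum>a\<in>V. 1 * slice x a l)" by (simp add: alt_bd_def slice_def fun_eq_iff)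
  then have "wedge v (alt_bd V x) l = (\<Sum>a\<in>V. wedge v (slice x a) l)"
    using wedge_sum[of v "\<lambda>_. 1"] by simp
  then show "alt_bd V (wedge v x) l = (x - wedge v (alt_bd V x)) l"
    using assms by (simp add: alt_bd_def sum_subtractf)
qed

lemma alt_bd_diff: "alt_bd V (x - y) = alt_bd V x - alt_bd V y"
  by (simp add: alt_bd_def fun_eq_iff sum_subtractf)

text \<open>Exchanging the two vertices that are summed over changes the sign of every term.\<close>

lemma alt_bd_alt_bd:
  assumes "alternating x" shows "alt_bd V (alt_bd V x) = 0"
proof
  fix l
  have "alt_bd V (alt_bd V x) l = (\<Sum>v\<in>V. \<Sum>w\<in>V. x (w # v # l))" by (simp add: alt_bd_def)
  also have "\<dots> = (\<Sum>v\<in>V. \<Sum>w\<in>V. - x (v # w # l))"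
    by (intro sum.cong refl) (rule alternatingD[OF assms, of "[]", unfolded append_Nil])
  also have "\<dots> = - (\<Sum>v\<in>V. \<Sum>w\<in>V. x (w # v # l))"
    by (simp add: sum_negf) (rule sum.swap)
  also have "\<dots> = - alt_bd V (alt_bd V x) l" by (simp add: alt_bd_def)
  finally show "alt_bd V (alt_bd V x) l = 0 l" by simp
qed

lemma alternating_alt_bd:
  assumes "alternating x" shows "alternating (alt_bd V x)"
  unfolding alternating_def
proof (intro allI)
  fix a p q b
  have "x (v # a @ p # q # b) = - x (v # a @ q # p # b)" for v
    using alternatingD[OF assms, of "v # a" p q b] by simp
  then show "alt_bd V x (a @ p # q # b) = - alt_bd V x (a @ q # p # b)"
    unfolding alt_bd_def sum_negf[symmetric] by (rule sum.cong[OF refl])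
qed

lemma slice_alt_bd:
  assumes "alternating x"
  shows "alt_bd V (slice x v) = - slice (alt_bd V x) v"
proof
  fix l
  have "(\<Sum>w\<in>V. x (v # w # l)) = (\<Sum>w\<in>V. - x (w # v # l))"
    by (intro sum.cong refl) (rule alternatingD[OF assms, of "[]", unfolded append_Nil])
  then show "alt_bd V (slice x v) l = (- slice (alt_bd V x) v) l"
    by (simp add: alt_bd_def slice_def sum_negf)
qed

text \<open>Euler's identity for alternating forms: contracting with every vertex and multiplying it back counts
the entries of the list.\<close>

lemma sum_wedge_slice:
  assumes "finite V" "alternating x" "set l \<subseteq> V"
  shows "(\<Sum>v\<in>V. wedge v (slice x v) l) = int (length l) * x l"
  using assms(2,3)
proof (induction l arbitrary: x)
  case (Cons a l)
  have "wedge v (slice (slice x v) a) l = - wedge v (slice (slice x a) v) l" for v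
    using alternatingD[OF Cons.prems(1), of "[]" v a] by (intro wedge_minus) (simp add: slice_def)
  then have "wedge v (slice x v) (a # l) =
      (if a = v then x (v # l) else 0) + wedge v (slice (slice x a) v) l" for v
    by (simp add: slice_def[of x])
  then have "(\<Sum>v\<in>V. wedge v (slice x v) (a # l)) =
      (\<Sum>v\<in>V. if a = v then x (v # l) else 0) + (\<Sum>v\<in>V. wedge v (slice (slice x a) v) l)"
    by (simp only: sum.distrib)
  also have "\<dots> = x (a # l) + int (length l) * x (a # l)"
    using Cons.IH[OF alternating_slice[OF Cons.prems(1)], of a] Cons.prems(2) assms(1)
    by (simp add: slice_def[of x a l])
  finally show ?case by (simp add: algebra_simps)
qed simp

definition unit_fun :: "'v list \<Rightarrow> int" where
  "unit_fun l = (if l = [] then 1 else 0)"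

text \<open>The chain of a single oriented simplex \<open>t\<close>. Its value at \<open>l\<close> is the determinant of the matrix with
entries \<open>[t\<^sub>i = l\<^sub>j]\<close>; it vanishes if \<open>t\<close> has repetitions.\<close>

primrec oriented :: "'v list \<Rightarrow> 'v list \<Rightarrow> int" where
  "oriented [] = unit_fun"
| "oriented (v # t) = wedge v (oriented t)"

lemma alternating_oriented: "alternating (oriented t)"
  by (induction t) (auto simp: alternating_wedge, simp add: alternating_def unit_fun_def)

lemma oriented_nonzero: "oriented t l \<noteq> 0 \<Longrightarrow> length l = length t \<and> set l = set t"
proof (induction t arbitrary: l)
  case Nil
  then show ?case by (auto simp: unit_fun_def split: if_splits)
next
  case (Cons v t)
  then show ?case using wedge_nonzero[of v "oriented t" l] by auto
qed

lemma wedge_map: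
  assumes "\<And>v. g (f v) = v" "\<And>v. f (g v) = v"
  shows "wedge (f v) x l = wedge v (\<lambda>l. x (map f l)) (map g l)"
proof (induction l arbitrary: x)
  case (Cons a l)
  have "slice (\<lambda>l. x (map f l)) (g a) = (\<lambda>l. slice x a (map f l))"
    using assms by (simp add: slice_def fun_eq_iff)
  moreover have "a = f v \<longleftrightarrow> g a = v" using assms by auto
  moreover have "map f (map g l) = l" using assms by (simp add: comp_def)
  ultimately show ?case using Cons.IH[of "slice x a"] by simp
qed simp

lemma oriented_map:
  assumes "\<And>v. g (f v) = v" "\<And>v. f (g v) = v"
  shows "oriented (map f t) l = oriented t (map g l)"
proof (induction t arbitrary: l)
  case (Cons v t)
  have "oriented (map f t) = (\<lambda>l. oriented t (map g l))" using Cons by blast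
  then show ?case
    using wedge_map[of g f v "\<lambda>l. oriented t (map g l)" l] assms by (simp add: comp_def)
qed (simp add: unit_fun_def)

section \<open>The complex of proper label sets\<close>

definition alt_chains :: "nat \<Rightarrow> nat \<Rightarrow> nat \<Rightarrow> (vertex list \<Rightarrow> int) set" where
  "alt_chains r L q = {x. alternating x \<and> (\<forall>l. x l \<noteq> 0 \<longrightarrow> length l = q \<and> proper r L (set l))}"

text \<open>The sign \<open>\<sigma>\<close> is 1 for odd \<open>r\<close>. For \<open>r = 2\<close> a rotation may reverse the fundamental cycle, and \<open>\<sigma>\<close>
compensates for that.\<close>

definition alt_rot :: "nat \<Rightarrow> int \<Rightarrow> (vertex list \<Rightarrow> int) \<Rightarrow> vertex list \<Rightarrow> int" where
  "alt_rot r \<sigma> x l = \<sigma> * x (map (tor r) l)"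

lemma alt_rot_pow: "(alt_rot r \<sigma> ^^ i) x l = \<sigma> ^ i * x ((map (tor r) ^^ i) l)"
proof (induction i arbitrary: l)
  case (Suc i)
  have "(map (tor r) ^^ Suc i) l = (map (tor r) ^^ i) (map (tor r) l)"
    by (simp only: funpow_Suc_right comp_apply)
  then show ?case using Suc by (simp add: alt_rot_def)
qed simp

lemma map_tor_pow_r [simp]: "(map (tor r) ^^ r) l = l"
  unfolding map_funpow[symmetric] by (simp add: map_idI)

lemma sum_fun_apply: "sum f A l = (\<Sum>a\<in>A. f a l)"
  by (induction A rule: infinite_finite_induct) auto

definition sign_ok :: "nat \<Rightarrow> int \<Rightarrow> bool" where
  "sign_ok r \<sigma> \<longleftrightarrow> \<sigma> = 1 \<or> (r = 2 \<and> \<sigma> = -1)"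

lemma sign_ok_pow: "sign_ok r \<sigma> \<Longrightarrow> \<sigma> ^ r = 1"
  by (auto simp: sign_ok_def)

lemma sign_ok_val: 
  assumes "sign_ok r \<sigma>" shows "int r dvd (\<Sum>i<r. \<sigma> ^ i * c)" "int r dvd c - \<sigma> * c"
proof -
  have "(\<Sum>i<r. \<sigma> ^ i * c) = (if \<sigma> = 1 then int r * c else 0)" 
    using assms by (auto simp: sign_ok_def numeral_2_eq_2)
  then show "int r dvd (\<Sum>i<r. \<sigma> ^ i * c)" by simp
  show "int r dvd c - \<sigma> * c" using assms by (auto simp: sign_ok_def)
qed

text \<open>The action on nonempty proper sets is free, and restricting a chain to the lists with chosen entry set
is the projection that exactness needs. It preserves alternating functions because it depends on
the entry set only.\<close>

lemma alt_chains_exact_pair: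
  assumes r: "prime r" and \<sigma>: "sign_ok r \<sigma>"
  shows "exact_pair (alt_chains r L) (alt_bd (labels r L)) (\<lambda>x. x []) r
    (norm_op r (alt_rot r \<sigma>)) (diff_op (alt_rot r \<sigma>))"
proof (rule exact_pair_free[where P = "\<lambda>x l. if chosen r (set l) then x l else 0"])
  show r0: "0 < r" using r prime_gt_0_nat by blast
  show "0 \<in> alt_chains r L q" for q by (auto simp: alt_chains_def alternating_def)
  show "x - y \<in> alt_chains r L q" if "x \<in> alt_chains r L q" "y \<in> alt_chains r L q" for x y q
  proof -
    have "x l \<noteq> 0 \<or> y l \<noteq> 0" if "(x - y) l \<noteq> 0" for l using that by auto
    then show ?thesis using that unfolding alt_chains_def by (blast intro: alternating_diff)
  qed
  show "alt_bd (labels r L) x \<in> alt_chains r L q" if x: "x \<in> alt_chains r L (Suc q)" for x q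
  proof -
    have "length l = q \<and> proper r L (set l)" if "alt_bd (labels r L) x l \<noteq> 0" for l
    proof -
      have "\<not> (\<forall>v. x (v # l) = 0)"
      proof
        assume "\<forall>v. x (v # l) = 0"
        then have "alt_bd (labels r L) x l = 0" unfolding alt_bd_def by (intro sum.neutral) blast
        then show False using that by blast
      qed
      then obtain v where "x (v # l) \<noteq> 0" by blast
      then have "length (v # l) = Suc q" "proper r L (set (v # l))"
        using x unfolding alt_chains_def by blast+
      then show ?thesis using proper_mono[of r L "set (v # l)" "set l"] by auto
    qed
    then show ?thesis using x by (auto simp: alt_chains_def alternating_alt_bd)
  qed
  show "alt_bd (labels r L) (x - y) = alt_bd (labels r L) x - alt_bd (labels r L) y" for x y
    by (rule alt_bd_diff)
  show "alt_bd (labels r L) (alt_bd (labels r L) x) = 0" if "x \<in> alt_chains r L q" for x q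
    using that by (simp add: alt_chains_def alt_bd_alt_bd)
  show "(x - y) [] = x [] - y []" for x y :: "vertex list \<Rightarrow> int" by simp
  show "alt_rot r \<sigma> (x - y) = alt_rot r \<sigma> x - alt_rot r \<sigma> y" for x y
    by (simp add: alt_rot_def fun_eq_iff algebra_simps)
  show "alt_rot r \<sigma> x \<in> alt_chains r L q" if x: "x \<in> alt_chains r L q" for x q
  proof -
    have "length l = q \<and> proper r L (set l)" if "alt_rot r \<sigma> x l \<noteq> 0" for l
    proof -
      have "x (map (tor r) l) \<noteq> 0" using that by (auto simp: alt_rot_def)
      then show ?thesis using x proper_tor[of r L "set l"] by (auto simp: alt_chains_def)
    qed
    moreover have "alternating (alt_rot r \<sigma> x)"
      unfolding alternating_def
    proof (intro allI)
      fix a v w b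
      have "x (map (tor r) a @ tor r v # tor r w # map (tor r) b) =
          - x (map (tor r) a @ tor r w # tor r v # map (tor r) b)"
        using x by (intro alternatingD) (simp add: alt_chains_def)
      then show "alt_rot r \<sigma> x (a @ v # w # b) = - alt_rot r \<sigma> x (a @ w # v # b)"
        unfolding alt_rot_def map_append list.map by simp
    qed
    ultimately show ?thesis by (auto simp: alt_chains_def)
  qed
  show "alt_bd (labels r L) (alt_rot r \<sigma> x) = alt_rot r \<sigma> (alt_bd (labels r L) x)" for x
  proof
    fix l
    have "(\<Sum>v\<in>labels r L. x (tor r v # map (tor r) l)) = (\<Sum>v\<in>labels r L. x (v # map (tor r) l))"
      by (rule sum.reindex_bij_witness[of _ "rot r" "tor r"]) auto
    then show "alt_bd (labels r L) (alt_rot r \<sigma> x) l = alt_rot r \<sigma> (alt_bd (labels r L) x) l"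
      by (simp add: alt_bd_def alt_rot_def flip: sum_distrib_left)
  qed
  show "(alt_rot r \<sigma> ^^ r) x = x" for x
    using sign_ok_pow[OF \<sigma>] by (simp add: fun_eq_iff alt_rot_pow)
  have e: "(map (tor r) ^^ i) [] = []" for i by (simp flip: map_funpow)
  show "int r dvd norm_op r (alt_rot r \<sigma>) x []" for x
    using sign_ok_val[OF \<sigma>] by (simp add: norm_op_def sum_fun_apply alt_rot_pow e)
  show "int r dvd diff_op (alt_rot r \<sigma>) x []" for x
    using sign_ok_val[OF \<sigma>] by (simp add: diff_op_def alt_rot_def)
  show "(\<lambda>l. if chosen r (set l) then (x - y) l else 0) =
      (\<lambda>l. if chosen r (set l) then x l else 0) - (\<lambda>l. if chosen r (set l) then y l else 0)" for x y :: "vertex list \<Rightarrow> int"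
    by (auto simp: fun_eq_iff)
  show "(\<lambda>l. if chosen r (set l) then x l else 0) \<in> alt_chains r L q" if "x \<in> alt_chains r L q" for x q
  proof -
    have sw: "set (a @ v # w # b) = set (a @ w # v # b)" for a b and v w :: vertex by auto
    have "alternating (\<lambda>l. if chosen r (set l) then x l else 0)"
      unfolding alternating_def
    proof (intro allI)
      fix a v w b
      have "x (a @ v # w # b) = - x (a @ w # v # b)"
        using that by (intro alternatingD) (simp add: alt_chains_def)
      then show "(if chosen r (set (a @ v # w # b)) then x (a @ v # w # b) else 0) =
          - (if chosen r (set (a @ w # v # b)) then x (a @ w # v # b) else 0)"
        unfolding sw[of a v w b] by (cases "chosen r (set (a @ w # v # b))") (simp_all del: set_append list.set)
    qed
    then show ?thesis using that by (auto simp: alt_chains_def)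
  qed
  show "(\<Sum>i<r. (alt_rot r \<sigma> ^^ i) (\<lambda>l. if chosen r (set l) then (alt_rot r \<sigma> ^^ (r - i)) x l else 0)) = x"
    if x: "x \<in> alt_chains r L (Suc q)" for x q
  proof
    fix l
    have "(\<Sum>i<r. (alt_rot r \<sigma> ^^ i) (\<lambda>l. if chosen r (set l) then (alt_rot r \<sigma> ^^ (r - i)) x l else 0)) l
      = (\<Sum>i<r. if chosen r ((tor r ^^ i) ` set l) then x l else 0)"
    proof (unfold sum_fun_apply, rule sum.cong)
      fix i assume "i \<in> {..<r}"
      then have i: "(r - i) + i = r" by simp
      have "(map (tor r) ^^ (r - i)) ((map (tor r) ^^ i) l) = l"
        by (metis comp_apply funpow_add i map_tor_pow_r)
      moreover have "\<sigma> ^ i * \<sigma> ^ (r - i) = 1"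
        using i sign_ok_pow[OF \<sigma>] by (metis add.commute power_add)
      then have "\<sigma> ^ i * (\<sigma> ^ (r - i) * c) = c" for c by (metis mult.assoc mult_1)
      moreover have "set ((map (tor r) ^^ i) l) = (tor r ^^ i) ` set l" by (simp flip: map_funpow)
      ultimately show "(alt_rot r \<sigma> ^^ i) (\<lambda>l. if chosen r (set l) then (alt_rot r \<sigma> ^^ (r - i)) x l else 0) l
        = (if chosen r ((tor r ^^ i) ` set l) then x l else 0)"
        by (simp add: alt_rot_pow)
    qed simp
    also have "\<dots> = x l"
    proof (cases "x l = 0")
      case False
      then have l: "proper r L (set l)" "set l \<noteq> {}" using x by (auto simp: alt_chains_def)
      obtain i where i: "i < r" "chosen r ((tor r ^^ i) ` set l)"
        "\<And>j. j < r \<Longrightarrow> chosen r ((tor r ^^ j) ` set l) \<Longrightarrow> j = i"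
        using chosen_unique[OF r l] by blast
      have "chosen r ((tor r ^^ j) ` set l) \<longleftrightarrow> j = i" if "j < r" for j
        using i that by blast
      then have "(\<Sum>j<r. if chosen r ((tor r ^^ j) ` set l) then x l else 0) = (\<Sum>j<r. if j = i then x l else 0)"
        by (intro sum.cong) simp_all
      then show ?thesis using i(1) by simp
    next
      case True
      then show ?thesis by (simp only: if_cancel sum.neutral_const)
    qed
    finally show "(\<Sum>i<r. (alt_rot r \<sigma> ^^ i) (\<lambda>l. if chosen r (set l) then (alt_rot r \<sigma> ^^ (r - i)) x l else 0)) l = x l" .
  qed
qed

text \<open>Below the top degree the cone with apex \<open>(0, 0)\<close> still misses a row.\<close>

lemma alt_chains_cone:
  assumes z: "z \<in> alt_chains r 1 q" "alt_bd (labels r 1) z = 0" and q: "q < r - 1"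
  shows "\<exists>u\<in>alt_chains r 1 (Suc q). alt_bd (labels r 1) u = z"
proof
  have v: "(0, 0) \<in> labels r 1" using q by (simp add: labels_def)
  have "wedge v 0 l = 0" for v :: vertex and l using wedge_nonzero[of v 0 l] by auto
  then have "wedge (0, 0) (alt_bd (labels r 1) z) = 0" unfolding z(2) by (intro ext) simp
  then show "alt_bd (labels r 1) (wedge (0, 0) z) = z"
    using alt_bd_wedge[OF finite_labels v, of z] by simp
  have "length l = Suc q \<and> proper r 1 (set l)" if nz: "wedge (0, 0) z l \<noteq> 0" for l
  proof -
    obtain l' where l': "z l' \<noteq> 0" "length l = Suc (length l')" "set l = insert (0, 0) (set l')"
      using wedge_nonzero[OF nz] by blast
    have l: "length l = Suc q" "set l \<subseteq> labels r 1"
      using l' z v by (auto simp: alt_chains_def proper_def)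
    have "\<exists>s<r. (0, s) \<notin> set l"
    proof (rule ccontr)
      assume "\<not> (\<exists>s<r. (0, s) \<notin> set l)"
      then have "Pair 0 ` {..<r} \<subseteq> set l" by auto
      then have "card (Pair (0::nat) ` {..<r}) \<le> card (set l)" by (intro card_mono) auto
      moreover have "card (Pair (0::nat) ` {..<r}) = r" by (simp add: card_image inj_on_def)
      ultimately show False using card_length[of l] l q by linarith
    qed
    then show ?thesis using l by (auto simp: proper_def)
  qed
  then show "wedge (0, 0) z \<in> alt_chains r 1 (Suc q)"
    using z by (auto simp: alt_chains_def alternating_wedge)
qed

lemma alt_chains_top:
  assumes x: "x \<in> alt_chains r L q" and q: "q > L * (r - 1)"
  shows "x = 0"
proof
  fix l
  show "x l = 0 l"
  proof (rule ccontr)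
    assume "x l \<noteq> 0 l"
    then have l: "length l = q" "proper r L (set l)" "distinct l"
      using x alternating_distinct by (auto simp: alt_chains_def)
    have "\<forall>k\<in>{..<L}. \<exists>s<r. (k, s) \<notin> set l" using l by (simp add: proper_def)
    then obtain m where m: "\<And>k. k < L \<Longrightarrow> m k < r \<and> (k, m k) \<notin> set l" by (metis lessThan_iff)
    have "set l \<subseteq> (SIGMA k:{..<L}. {..<r} - {m k})"
      using l m by (fastforce simp: proper_def labels_def)
    then have "card (set l) \<le> card (SIGMA k:{..<L}. {..<r} - {m k})" by (intro card_mono) auto
    also have "\<dots> = L * (r - 1)" using m by simp
    finally show False using l q by (simp add: distinct_card)
  qed
qed

section \<open>Chains of ordered simplices\<close>

type_synonym list_chain = "vertex list \<Rightarrow>\<^sub>0 int"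

abbreviation keys :: "('a \<Rightarrow>\<^sub>0 int) \<Rightarrow> 'a set" where
  "keys \<equiv> Poly_Mapping.keys"

abbreviation coeff_Nil :: "list_chain \<Rightarrow> int" where
  "coeff_Nil c \<equiv> Poly_Mapping.lookup c []"

text \<open>Most identities between chains below are checked on simplices with this rule.\<close>

lemma frag_hom_eq:
  fixes f g :: "('a \<Rightarrow>\<^sub>0 int) \<Rightarrow> 'g::ab_group_add"
  assumes "\<And>a b. f (a - b) = f a - f b" "\<And>a b. g (a - b) = g a - g b"
    and "\<And>t. t \<in> keys c \<Longrightarrow> f (frag_of t) = g (frag_of t)"
  shows "f c = g c"
proof -
  have "f x = g x" if "keys x \<subseteq> K" "\<And>t. t \<in> K \<Longrightarrow> f (frag_of t) = g (frag_of t)" for x K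
    using that(1)
  proof (induction x rule: frag_induction)
    case zero
    show ?case using assms(1)[of 0 0] assms(2)[of 0 0] by simp
  qed (simp_all add: assms(1,2) that(2))
  then show ?thesis using assms(3) by blast
qed

definition cons_frag :: "vertex \<Rightarrow> list_chain \<Rightarrow> list_chain" where
  "cons_frag v = frag_extend (\<lambda>t. frag_of (v # t))"

text \<open>The boundary of an ordered simplex in the augmented complex, so a single vertex has the empty list
as its boundary.\<close>

primrec list_bd :: "vertex list \<Rightarrow> list_chain" where
  "list_bd [] = 0"
| "list_bd (v # t) = frag_of t - cons_frag v (list_bd t)"

definition chain_bd :: "list_chain \<Rightarrow> list_chain" where
  "chain_bd = frag_extend list_bd"

lemma cons_frag_simps [simp]:
  "cons_frag v (frag_of t) = frag_of (v # t)" "cons_frag v 0 = 0"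
  by (simp_all add: cons_frag_def)

lemma cons_frag_diff: "cons_frag v (a - b) = cons_frag v a - cons_frag v b"
  and cons_frag_cmul: "cons_frag v (frag_cmul k a) = frag_cmul k (cons_frag v a)"
  by (simp_all add: cons_frag_def frag_extend_diff frag_extend_cmul)

lemma chain_bd_simps [simp]: "chain_bd (frag_of t) = list_bd t" "chain_bd 0 = 0"
  by (simp_all add: chain_bd_def)

lemma chain_bd_diff: "chain_bd (a - b) = chain_bd a - chain_bd b"
  and chain_bd_cmul: "chain_bd (frag_cmul k a) = frag_cmul k (chain_bd a)"
  by (simp_all add: chain_bd_def frag_extend_diff frag_extend_cmul)

lemma chain_bd_cons: "chain_bd (cons_frag v c) = c - cons_frag v (chain_bd c)"
  by (rule frag_hom_eq[where c = c]) (simp_all add: cons_frag_diff chain_bd_diff)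

lemma chain_bd_chain_bd: "chain_bd (chain_bd c) = 0"
proof -
  have "chain_bd (list_bd t) = 0" for t
    by (induction t) (simp_all add: chain_bd_diff chain_bd_cons)
  then show ?thesis
    using frag_hom_eq[where c = c and f = "\<lambda>c. chain_bd (chain_bd c)" and g = "\<lambda>_. 0"]
    by (simp add: chain_bd_diff)
qed

lemma keys_cons_frag: "keys (cons_frag v c) \<subseteq> (#) v ` keys c"
  using keys_frag_extend[of "\<lambda>t. frag_of (v # t)" c] by (auto simp: cons_frag_def)

lemma keys_list_bd: "s \<in> keys (list_bd t) \<Longrightarrow> \<exists>a v b. t = a @ v # b \<and> s = a @ b"
proof (induction t arbitrary: s)
  case (Cons w t)
  then consider "s = t" | s' where "s = w # s'" "s' \<in> keys (list_bd t)"
  proof -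
    have "s \<in> keys (frag_of t) \<union> keys (cons_frag w (list_bd t))"
      using Cons.prems keys_diff[of "frag_of t" "cons_frag w (list_bd t)"] by (simp only: list_bd.simps) blast
    then have "s = t \<or> s \<in> (#) w ` keys (list_bd t)"
      using keys_cons_frag[of w "list_bd t"] unfolding keys_frag_of by blast
    then show thesis using that by blast
  qed
  then show ?case
  proof cases
    case 1
    then show ?thesis by (intro exI[of _ "[]"]) auto
  next
    case 2
    then obtain a v b where "t = a @ v # b" "s' = a @ b" using Cons.IH by blast
    then show ?thesis using 2 by (intro exI[of _ "w # a"]) auto
  qed
qed simp

definition rot_frag :: "nat \<Rightarrow> list_chain \<Rightarrow> list_chain" where
  "rot_frag r = frag_extend (\<lambda>t. frag_of (map (rot r) t))"

lemma rot_frag_simps [simp]: "rot_frag r (frag_of t) = frag_of (map (rot r) t)" "rot_frag r 0 = 0"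
  by (simp_all add: rot_frag_def)

lemma rot_frag_diff: "rot_frag r (a - b) = rot_frag r a - rot_frag r b"
  and rot_frag_cmul: "rot_frag r (frag_cmul k a) = frag_cmul k (rot_frag r a)"
  by (simp_all add: rot_frag_def frag_extend_diff frag_extend_cmul)

lemma rot_frag_cons: "rot_frag r (cons_frag v c) = cons_frag (rot r v) (rot_frag r c)"
  by (rule frag_hom_eq[where c = c]) (simp_all add: cons_frag_diff rot_frag_diff)

lemma chain_bd_rot: "chain_bd (rot_frag r c) = rot_frag r (chain_bd c)"
proof -
  have "chain_bd (frag_of (map (rot r) t)) = rot_frag r (list_bd t)" for t
    by (induction t) (simp_all add: rot_frag_diff rot_frag_cons)
  then show ?thesis
    using frag_hom_eq[where c = c and f = "\<lambda>c. chain_bd (rot_frag r c)"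
        and g = "\<lambda>c. rot_frag r (chain_bd c)"]
    by (simp add: chain_bd_diff rot_frag_diff)
qed

lemma keys_rot_frag: "keys (rot_frag r c) \<subseteq> map (rot r) ` keys c"
  using keys_frag_extend[of "\<lambda>t. frag_of (map (rot r) t)" c] by (auto simp: rot_frag_def)

definition list_rot :: "nat \<Rightarrow> int \<Rightarrow> list_chain \<Rightarrow> list_chain" where
  "list_rot r \<sigma> c = frag_cmul \<sigma> (rot_frag r c)"

lemma frag_cmul_diff: "frag_cmul k (a - b) = frag_cmul k a - frag_cmul k b"
  using frag_cmul_distrib2[of k "a - b" b] by simp

lemma list_rot_diff: "list_rot r \<sigma> (a - b) = list_rot r \<sigma> a - list_rot r \<sigma> b"
  by (simp add: list_rot_def rot_frag_diff frag_cmul_diff)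

lemma list_rot_pow_diff: "(list_rot r \<sigma> ^^ i) (a - b) = (list_rot r \<sigma> ^^ i) a - (list_rot r \<sigma> ^^ i) b"
  by (induction i) (simp_all add: list_rot_diff)

lemma list_rot_pow_of: "(list_rot r \<sigma> ^^ i) (frag_of t) = frag_cmul (\<sigma> ^ i) (frag_of ((map (rot r) ^^ i) t))"
  by (induction i) (simp_all add: list_rot_def rot_frag_cmul)

lemma list_rot_pow_cmul: "(list_rot r \<sigma> ^^ i) (frag_cmul k c) = frag_cmul k ((list_rot r \<sigma> ^^ i) c)"
  by (induction i) (simp_all add: list_rot_def rot_frag_cmul mult.commute)

text \<open>Faces are lists, so the rotations act freely on all nonempty ones.\<close>

definition simplicial :: "nat \<Rightarrow> vertex list set \<Rightarrow> bool" where
  "simplicial r T \<longleftrightarrow> (\<forall>a v b. a @ v # b \<in> T \<longrightarrow> a @ b \<in> T) \<and> (\<forall>t\<in>T. map (rot r) t \<in> T) \<and>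
    (\<forall>t\<in>T. \<forall>v\<in>set t. snd v < r)"

definition list_chains :: "vertex list set \<Rightarrow> nat \<Rightarrow> list_chain set" where
  "list_chains T q = {c. \<forall>t\<in>keys c. t \<in> T \<and> length t = q}"

text \<open>The projection to the fundamental domain of the simplices whose first vertex lies in row 0.\<close>

definition head_frag :: "list_chain \<Rightarrow> list_chain" where
  "head_frag = frag_extend (\<lambda>t. if t \<noteq> [] \<and> snd (hd t) = 0 then frag_of t else 0)"

lemma map_rot_pow: "(map (rot r) ^^ i) t = map (\<lambda>v. (fst v, if snd v < r then (snd v + i) mod r else snd v)) t"
  by (simp flip: map_funpow add: rot_pow)

lemma list_chains_exact_pair:
  assumes r: "0 < r" and \<sigma>: "sign_ok r \<sigma>" and T: "simplicial r T"
  shows "exact_pair (list_chains T) chain_bd coeff_Nil r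
    (norm_op r (list_rot r \<sigma>)) (diff_op (list_rot r \<sigma>))"
proof (rule exact_pair_free[where P = head_frag])
  show "0 < r" by fact
  show "0 \<in> list_chains T q" for q by (simp add: list_chains_def)
  show "x - y \<in> list_chains T q" if "x \<in> list_chains T q" "y \<in> list_chains T q" for x y q
    using that keys_diff[of x y] by (auto simp: list_chains_def)
  show "chain_bd x \<in> list_chains T q" if x: "x \<in> list_chains T (Suc q)" for x q
    unfolding list_chains_def
  proof (intro CollectI ballI)
    fix s assume "s \<in> keys (chain_bd x)"
    then obtain t where t: "t \<in> keys x" "s \<in> keys (list_bd t)"
      using keys_frag_extend[of list_bd x] unfolding chain_bd_def by blast
    obtain a v b where "t = a @ v # b" "s = a @ b" using keys_list_bd[OF t(2)] by blast
    moreover have "t \<in> T" "length t = Suc q" using t(1) x by (auto simp: list_chains_def)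
    moreover have "\<And>a v b. a @ v # b \<in> T \<Longrightarrow> a @ b \<in> T" using T unfolding simplicial_def by blast
    ultimately show "s \<in> T \<and> length s = q" by simp
  qed
  show "chain_bd (x - y) = chain_bd x - chain_bd y" for x y by (rule chain_bd_diff)
  show "chain_bd (chain_bd x) = 0" for x by (rule chain_bd_chain_bd)
  show "Poly_Mapping.lookup (x - y) [] = Poly_Mapping.lookup x [] - Poly_Mapping.lookup y []"
    for x y :: list_chain by (simp add: lookup_minus)
  show "list_rot r \<sigma> (x - y) = list_rot r \<sigma> x - list_rot r \<sigma> y" for x y by (rule list_rot_diff)
  show "list_rot r \<sigma> x \<in> list_chains T q" if "x \<in> list_chains T q" for x q
  proof -
    have "t \<in> T \<and> length t = q" if "t \<in> keys (list_rot r \<sigma> x)" for t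
    proof -
      have "t \<in> map (rot r) ` keys x"
        using that keys_rot_frag[of r x] unfolding list_rot_def keys_cmul_iff by blast
      then obtain s where s: "s \<in> keys x" "t = map (rot r) s" by blast
      then have "s \<in> T" "length s = q" using \<open>x \<in> list_chains T q\<close> by (auto simp: list_chains_def)
      then show ?thesis using s(2) T by (simp add: simplicial_def)
    qed
    then show ?thesis by (simp add: list_chains_def)
  qed
  show "chain_bd (list_rot r \<sigma> x) = list_rot r \<sigma> (chain_bd x)" for x
    by (simp add: list_rot_def chain_bd_cmul chain_bd_rot)
  have rot_id: "(map (rot r) ^^ r) t = t" for t by (simp flip: map_funpow add: map_idI)
  show "(list_rot r \<sigma> ^^ r) x = x" for x
    by (rule frag_hom_eq[where c = x]) (simp_all add: list_rot_pow_diff list_rot_pow_of sign_ok_pow[OF \<sigma>] rot_id)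
  have "Poly_Mapping.lookup (rot_frag r c) [] = Poly_Mapping.lookup c []" for c
    by (rule frag_hom_eq[where c = c]) (simp_all add: rot_frag_diff lookup_minus)
  then have l: "Poly_Mapping.lookup ((list_rot r \<sigma> ^^ i) c) [] = \<sigma> ^ i * Poly_Mapping.lookup c []" for c i
    by (induction i) (simp_all add: list_rot_def)
  have ls: "Poly_Mapping.lookup (\<Sum>i\<in>I. f i) k = (\<Sum>i\<in>I. Poly_Mapping.lookup (f i) k)"
    for I :: "nat set" and f :: "nat \<Rightarrow> list_chain" and k
    by (induction I rule: infinite_finite_induct) (simp_all add: lookup_add)
  show "int r dvd Poly_Mapping.lookup (norm_op r (list_rot r \<sigma>) x) []" for x
    using sign_ok_val[OF \<sigma>] by (simp add: norm_op_def ls l)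
  show "int r dvd Poly_Mapping.lookup (diff_op (list_rot r \<sigma>) x) []" for x
    using sign_ok_val[OF \<sigma>] l[where i = 1 and c = x] by (simp add: diff_op_def lookup_minus)
  show hd: "head_frag (x - y) = head_frag x - head_frag y" for x y
    by (simp add: head_frag_def frag_extend_diff)
  show "head_frag x \<in> list_chains T q" if "x \<in> list_chains T q" for x q
  proof -
    have "t \<in> keys x" if th: "t \<in> keys (head_frag x)" for t
    proof -
      obtain s where "s \<in> keys x"
        "t \<in> keys (if s \<noteq> [] \<and> snd (hd s) = 0 then frag_of s else 0)"
        using th keys_frag_extend[of "\<lambda>t. if t \<noteq> [] \<and> snd (hd t) = 0 then frag_of t else 0" x]
        unfolding head_frag_def by blast
      then show ?thesis by (simp split: if_splits)
    qed
    then show ?thesis using that by (simp add: list_chains_def)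
  qed
  show "(\<Sum>i<r. (list_rot r \<sigma> ^^ i) (head_frag ((list_rot r \<sigma> ^^ (r - i)) x))) = x"
    if x: "x \<in> list_chains T (Suc q)" for x q
  proof (rule frag_hom_eq[where c = x and g = "\<lambda>x. x"])
    fix t assume "t \<in> keys x"
    then have "t \<in> T" and t0: "t \<noteq> []" using x by (auto simp: list_chains_def)
    then have t: "t \<noteq> []" "snd (hd t) < r" using T hd_in_set[OF t0] unfolding simplicial_def by blast+
    define s where "s = snd (hd t)"
    have "(list_rot r \<sigma> ^^ i) (head_frag ((list_rot r \<sigma> ^^ (r - i)) (frag_of t))) = (if i = s then frag_of t else 0)"
      if i: "i < r" for i
    proof -
      have "(s + (r - i)) mod r = 0 \<longleftrightarrow> i = s"
      proof
        assume "(s + (r - i)) mod r = 0"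
        then obtain k where k: "s + (r - i) = r * k" by (auto simp: mod_eq_0_iff_dvd)
        have "0 < r * k" "r * k < r * 2" using i t k s_def by linarith+
        then have "k = 1" by (simp add: nat_mult_less_cancel_disj)
        then show "i = s" using k i by simp
      qed (use i in simp)
      then have h: "snd (hd ((map (rot r) ^^ (r - i)) t)) = 0 \<longleftrightarrow> i = s" "(map (rot r) ^^ (r - i)) t \<noteq> []"
        using t by (auto simp: map_rot_pow hd_map s_def)
      have "(map (rot r) ^^ i) ((map (rot r) ^^ (r - i)) t) = t"
        using i rot_id by (metis comp_apply funpow_add le_add_diff_inverse less_imp_le)
      moreover have "\<sigma> ^ (r - i) * \<sigma> ^ i = 1"
        using i sign_ok_pow[OF \<sigma>] by (metis le_add_diff_inverse2 less_imp_le power_add)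
      moreover have "head_frag ((list_rot r \<sigma> ^^ (r - i)) (frag_of t)) =
          (if i = s then frag_cmul (\<sigma> ^ (r - i)) (frag_of ((map (rot r) ^^ (r - i)) t)) else 0)"
        using h by (simp add: list_rot_pow_of head_frag_def frag_extend_cmul)
      moreover have "(list_rot r \<sigma> ^^ i) 0 = 0" using list_rot_pow_diff[where r = r and \<sigma> = \<sigma> and i = i and a = 0 and b = 0] by simp
      ultimately show ?thesis by (auto simp: list_rot_pow_cmul list_rot_pow_of)
    qed
    then have "(\<Sum>i<r. (list_rot r \<sigma> ^^ i) (head_frag ((list_rot r \<sigma> ^^ (r - i)) (frag_of t)))) =
        (\<Sum>i<r. if i = s then frag_of t else 0)" by (intro sum.cong) simp_all
    then show "(\<Sum>i<r. (list_rot r \<sigma> ^^ i) (head_frag ((list_rot r \<sigma> ^^ (r - i)) (frag_of t)))) = frag_of t"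
      using t by (simp add: s_def)
  qed (simp_all add: list_rot_pow_diff hd sum_subtractf)
qed

section \<open>Linear maps on chains\<close>

definition lin :: "('k \<Rightarrow> 'l \<Rightarrow> int) \<Rightarrow> ('k \<Rightarrow>\<^sub>0 int) \<Rightarrow> 'l \<Rightarrow> int" where
  "lin h c l = (\<Sum>k\<in>keys c. Poly_Mapping.lookup c k * h k l)"

lemma lin_superset:
  assumes "finite K" "keys c \<subseteq> K"
  shows "lin h c l = (\<Sum>k\<in>K. Poly_Mapping.lookup c k * h k l)"
  unfolding lin_def by (rule sum.mono_neutral_left) (use assms in \<open>auto simp: in_keys_iff\<close>)

lemma lin_diff: "lin h (a - b) = lin h a - lin h b"
proof
  fix l
  have "keys (a - b) \<subseteq> keys a \<union> keys b" by (rule keys_diff)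
  then show "lin h (a - b) l = (lin h a - lin h b) l"
    by (simp add: lin_superset[where K = "keys a \<union> keys b"] lookup_minus
        left_diff_distrib sum_subtractf)
qed

lemma lin_of [simp]: "lin h (frag_of k) = h k" and lin_0 [simp]: "lin h 0 = 0"
  by (simp_all add: lin_def fun_eq_iff)

lemma lin_cmul: "lin h (frag_cmul k c) l = k * lin h c l"
  by (subst lin_superset[where K = "keys c"])
    (auto simp: keys_cmul lin_def sum_distrib_left mult.assoc)

lemma lin_closed:
  assumes "0 \<in> S" "\<And>x y. x \<in> S \<Longrightarrow> y \<in> S \<Longrightarrow> x - y \<in> S"
    and "\<And>k. k \<in> keys c \<Longrightarrow> h k \<in> S"
  shows "lin h c \<in> S"
proof -
  have "lin h x \<in> S" if "keys x \<subseteq> keys c" for x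
    using that
  proof (induction x rule: frag_induction)
    case zero
    show ?case unfolding lin_0 by (rule assms(1))
  next
    case (one k)
    then show ?case unfolding lin_of by (rule assms(3))
  next
    case (diff a b)
    then show ?case unfolding lin_diff by (rule assms(2))
  qed
  then show ?thesis by blast
qed

lemma norm_op_hom:
  assumes "\<And>x y. h (x - y) = h x - h y" "\<And>x. h (\<tau> x) = \<tau>' (h x)"
  shows "h (norm_op r \<tau> x) = norm_op r \<tau>' (h x)" "h (diff_op \<tau> x) = diff_op \<tau>' (h x)"
proof -
  have "Modules.additive h" using assms(1) by (rule additiveI)
  moreover have "h ((\<tau> ^^ i) x) = (\<tau>' ^^ i) (h x)" for i by (induction i) (simp_all add: assms)
  ultimately show "h (norm_op r \<tau> x) = norm_op r \<tau>' (h x)"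
    by (simp add: norm_op_def additive.sum)
  show "h (diff_op \<tau> x) = diff_op \<tau>' (h x)" by (simp add: diff_op_def assms)
qed

section \<open>Joins\<close>

definition cat_chain :: "list_chain \<Rightarrow> list_chain \<Rightarrow> list_chain" where
  "cat_chain u w = frag_extend (\<lambda>s. frag_extend (\<lambda>t. frag_of (s @ t)) w) u"

lemma cat_chain_diff_left: "cat_chain (a - b) w = cat_chain a w - cat_chain b w"
  by (simp add: cat_chain_def frag_extend_diff)

lemma cat_chain_diff_right: "cat_chain u (a - b) = cat_chain u a - cat_chain u b"
  by (rule frag_hom_eq[where c = u]) (simp_all add: cat_chain_def frag_extend_diff)

lemma cat_chain_of: "cat_chain (frag_of s) (frag_of t) = frag_of (s @ t)"
  by (simp add: cat_chain_def)

lemma cat_chain_zero [simp]: "cat_chain 0 w = 0" "cat_chain u 0 = 0"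
  using cat_chain_diff_left[of 0 0 w] cat_chain_diff_right[of u 0 0] by auto

lemma cat_chain_Nil [simp]: "cat_chain (frag_of []) w = w"
  by (rule frag_hom_eq[where c = w]) (simp_all add: cat_chain_diff_right cat_chain_of)

lemma cat_chain_cmul_left: "cat_chain (frag_cmul k u) w = frag_cmul k (cat_chain u w)"
  by (simp add: cat_chain_def frag_extend_cmul)

lemma cat_chain_cmul_right: "cat_chain u (frag_cmul k w) = frag_cmul k (cat_chain u w)"
  by (rule frag_hom_eq[where c = u]) (simp_all add: cat_chain_def frag_extend_diff frag_extend_cmul frag_cmul_diff)

lemma cat_chain_cons: "cat_chain (cons_frag v u) w = cons_frag v (cat_chain u w)"
proof (rule frag_hom_eq[where c = u])
  fix s
  show "cat_chain (cons_frag v (frag_of s)) w = cons_frag v (cat_chain (frag_of s) w)"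
    by (rule frag_hom_eq[where c = w]) (simp_all add: cat_chain_diff_right cons_frag_diff cat_chain_of)
qed (simp_all add: cat_chain_diff_left cons_frag_diff)

text \<open>In the Leibniz rule the second summand vanishes because \<open>w\<close> is a cycle.\<close>

lemma chain_bd_cat_chain:
  assumes "chain_bd w = 0" shows "chain_bd (cat_chain u w) = cat_chain (chain_bd u) w"
proof (rule frag_hom_eq[where c = u])
  fix s
  show "chain_bd (cat_chain (frag_of s) w) = cat_chain (chain_bd (frag_of s)) w"
  proof (induction s)
    case (Cons v s)
    have "cat_chain (frag_of (v # s)) w = cons_frag v (cat_chain (frag_of s) w)"
      using cat_chain_cons[of v "frag_of s" w] by simp
    then show ?case using Cons by (simp add: chain_bd_cons cat_chain_diff_left cat_chain_cons)
  qed (simp add: assms)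
qed (simp_all add: cat_chain_diff_left chain_bd_diff)

lemma rot_frag_cat_chain: "rot_frag r (cat_chain u w) = cat_chain (rot_frag r u) (rot_frag r w)"
proof (rule frag_hom_eq[where c = u])
  fix s
  show "rot_frag r (cat_chain (frag_of s) w) = cat_chain (rot_frag r (frag_of s)) (rot_frag r w)"
    by (rule frag_hom_eq[where c = w]) (simp_all add: cat_chain_diff_right rot_frag_diff cat_chain_of)
qed (simp_all add: cat_chain_diff_left rot_frag_diff)

lemma keys_cat_chain: "x \<in> keys (cat_chain u w) \<Longrightarrow>
  \<exists>s t. s \<in> keys u \<and> t \<in> keys w \<and> x = s @ t"
proof -
  assume "x \<in> keys (cat_chain u w)"
  then obtain s where s: "s \<in> keys u"
    "x \<in> keys (frag_extend (\<lambda>t. frag_of (s @ t)) w)"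
    using keys_frag_extend[of "\<lambda>s. frag_extend (\<lambda>t. frag_of (s @ t)) w" u]
    unfolding cat_chain_def by blast
  then obtain t where "t \<in> keys w" "x \<in> keys (frag_of (s @ t))"
    using keys_frag_extend[of "\<lambda>t. frag_of (s @ t)" w] by blast
  then show ?thesis using s(1) unfolding keys_frag_of by blast
qed

abbreviation list_ladder where
  "list_ladder T \<equiv> ladder (list_chains T) chain_bd coeff_Nil"

lemma ladder_cmul:
  assumes "list_ladder T A B q z c"
    and "\<And>k u. A (frag_cmul k u) = frag_cmul k (A u)" "\<And>k u. B (frag_cmul k u) = frag_cmul k (B u)"
  shows "list_ladder T A B q (frag_cmul k z) (k * c)"
  using assms
proof (induction rule: ladder.induct)
  case (base z A B)
  then have "frag_cmul k z \<in> list_chains T 0" by (auto simp: list_chains_def)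
  from ladder.base[of "frag_cmul k z" "list_chains T", OF this, of chain_bd "\<lambda>c. Poly_Mapping.lookup c []" A B]
  show ?case by simp
next
  case (step u q B A c)
  then have "frag_cmul k u \<in> list_chains T (Suc q)" by (auto simp: list_chains_def)
  moreover have "list_ladder T B A q
      (chain_bd (frag_cmul k u)) (k * c)"
    using step by (simp add: chain_bd_cmul)
  ultimately have "list_ladder T A B (Suc q)
      (A (frag_cmul k u)) (k * c)" by (rule ladder.step)
  then show ?case using step.prems by simp
qed

text \<open>Multiplicativity. Joining every rung of a ladder for \<open>z\<close> with the cycle \<open>w\<close> gives a ladder for the join
that ends, after \<open>q\<close> steps, with \<open>c\<close> copies of \<open>w\<close>; a ladder for \<open>w\<close> continues it. The parity of \<open>q\<close>
decides which operator comes next.\<close>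

lemma ladder_cat_chain:
  assumes "list_ladder T1 A1 B1 q z c"
    and "\<And>q u. u \<in> list_chains T1 q \<Longrightarrow> cat_chain u w \<in> list_chains T (q + q')"
    and "chain_bd w = 0"
    and "\<And>u. A (cat_chain u w) = cat_chain (A1 u) w" "\<And>u. B (cat_chain u w) = cat_chain (B1 u) w"
    and "\<And>k u. A (frag_cmul k u) = frag_cmul k (A u)" "\<And>k u. B (frag_cmul k u) = frag_cmul k (B u)"
    and "list_ladder T
      (if even q then A else B) (if even q then B else A) q' w c'"
  shows "list_ladder T A B (q + q') (cat_chain z w) (c * c')"
  using assms(1,4-)
proof (induction arbitrary: A B rule: ladder.induct)
  case (base z A1 B1)
  have "z = frag_cmul (Poly_Mapping.lookup z []) (frag_of [])"
  proof (rule poly_mapping_eqI)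
    fix t
    show "Poly_Mapping.lookup z t =
        Poly_Mapping.lookup (frag_cmul (Poly_Mapping.lookup z []) (frag_of [])) t"
    proof (cases "t = []")
      case False
      then have "t \<notin> keys z" using base(1) by (auto simp: list_chains_def)
      then show ?thesis using False by (simp add: in_keys_iff)
    qed simp
  qed
  then have "cat_chain z w = frag_cmul (Poly_Mapping.lookup z []) w"
    using cat_chain_cmul_left[of "Poly_Mapping.lookup z []" "frag_of []" w] by simp
  then show ?case using ladder_cmul[of T A B q' w c' "Poly_Mapping.lookup z []"] base by simp
next
  case (step u q B1 A1 c)
  have "list_ladder T B A (q + q')
      (cat_chain (chain_bd u) w) (c * c')"
    by (rule step.IH) (use step.prems in \<open>cases "even q"; simp\<close>)+
  then have "list_ladder T A B (Suc (q + q'))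
      (A (cat_chain u w)) (c * c')"
    using assms(2)[OF step.hyps(1)] chain_bd_cat_chain[OF assms(3)]
    by (intro ladder.step) simp_all
  then show ?case using step.prems by simp
qed

section \<open>Chains on chessboards\<close>

text \<open>Distributes an alternating function on lists of rows over the columns of \<open>J\<close>: the simplex with rows
\<open>s\<^sub>1, \<dots>, s\<^sub>q\<close> in the columns of \<open>J\<close> gets the coefficient \<open>x [(0, s\<^sub>1), \<dots>, (0, s\<^sub>q)]\<close>. Applied to a
fundamental cycle of the boundary of the simplex on \<open>r\<close> rows, with \<open>r - 1\<close> columns, this is a
fundamental cycle of the chessboard complex.\<close>

primrec chess :: "nat \<Rightarrow> nat list \<Rightarrow> (vertex list \<Rightarrow> int) \<Rightarrow> list_chain" where
  "chess r [] x = frag_cmul (x []) (frag_of [])"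
| "chess r (c # J) x = (\<Sum>s<r. cons_frag (c, s) (chess r J (slice x (0, s))))"

lemma cons_frag_sum: "cons_frag v (\<Sum>i\<in>I. f i) = (\<Sum>i\<in>I. cons_frag v (f i))"
  by (rule additive.sum[OF additiveI]) (rule cons_frag_diff)

lemma chain_bd_sum: "chain_bd (\<Sum>i\<in>I. f i) = (\<Sum>i\<in>I. chain_bd (f i))"
  by (rule additive.sum[OF additiveI]) (rule chain_bd_diff)

lemma rot_frag_sum: "rot_frag r (\<Sum>i\<in>I. f i) = (\<Sum>i\<in>I. rot_frag r (f i))"
  by (rule additive.sum[OF additiveI]) (rule rot_frag_diff)

lemma chess_diff: "chess r J (x - y) = chess r J x - chess r J y"
proof (induction J arbitrary: x y)
  case Nil
  show ?case by (simp add: frag_cmul_diff_distrib)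
next
  case (Cons c J)
  have "slice (x - y) v = slice x v - slice y v" for v by (simp add: slice_def fun_eq_iff)
  then show ?case by (simp only: chess.simps Cons cons_frag_diff sum_subtractf)
qed

lemma chess_zero: "chess r J 0 = 0"
  using chess_diff[of r J 0 0] by simp

lemma alt_bd_one_row: "alt_bd (labels r 1) x = (\<Sum>s<r. slice x (0, s))"
proof
  fix l
  have "labels r 1 = Pair 0 ` {..<r}" by (auto simp: labels_def)
  then have "alt_bd (labels r 1) x l = (\<Sum>s<r. x ((0, s) # l))"
    by (simp add: alt_bd_def sum.reindex inj_on_def)
  then show "alt_bd (labels r 1) x l = (\<Sum>s<r. slice x (0, s)) l"
    by (simp add: slice_def sum_fun_apply)
qed

text \<open>Deleting the entry of one column leaves a sum over the row that stood there, and for an alternating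
function this is its boundary up to sign.\<close>

lemma chain_bd_chess:
  assumes "alternating x" "alt_bd (labels r 1) x = 0"
  shows "chain_bd (chess r J x) = 0"
  using assms
proof (induction J arbitrary: x)
  case Nil
  show ?case by (simp add: chain_bd_cmul)
next
  case (Cons c J)
  have "alt_bd (labels r 1) (slice x (0, s)) = 0" for s
    using slice_alt_bd[OF Cons.prems(1), of "labels r 1" "(0, s)"] unfolding Cons.prems(2)
    by (simp add: slice_def fun_eq_iff)
  then have "chain_bd (chess r J (slice x (0, s))) = 0" for s
    using Cons.IH[OF alternating_slice[OF Cons.prems(1)]] by simp
  then have "chain_bd (chess r (c # J) x) = (\<Sum>s<r. chess r J (slice x (0, s)))"
    by (simp add: chain_bd_sum chain_bd_cons)
  also have "\<dots> = chess r J (\<Sum>s<r. slice x (0, s))"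
    by (rule additive.sum[OF additiveI[of "chess r J"], symmetric]) (rule chess_diff)
  also have "\<dots> = 0" using Cons.prems(2) unfolding alt_bd_one_row by (simp only: chess_zero)
  finally show ?case .
qed

lemma chess_rot: "rot_frag r (chess r J x) = chess r J (alt_rot r 1 x)"
proof (induction J arbitrary: x)
  case Nil
  show ?case by (simp add: rot_frag_cmul alt_rot_def)
next
  case (Cons c J)
  have s: "slice (alt_rot r 1 x) v = alt_rot r 1 (slice x (tor r v))" for v
    by (simp add: slice_def alt_rot_def fun_eq_iff)
  have "rot_frag r (chess r (c # J) x) =
      (\<Sum>s<r. cons_frag (rot r (c, s)) (chess r J (alt_rot r 1 (slice x (0, s)))))"
    by (simp add: rot_frag_sum rot_frag_cons Cons)
  also have "\<dots> = (\<Sum>s<r. cons_frag (c, s) (chess r J (alt_rot r 1 (slice x (tor r (0, s))))))"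
  proof (rule sum.reindex_bij_witness[of _ "\<lambda>s. snd (tor r (0, s))" "\<lambda>s. snd (rot r (0, s))"])
    fix s assume s: "s \<in> {..<r}"
    have e: "(k, snd (rot r (k', s'))) = rot r (k, s')" "(k, snd (tor r (k', s'))) = tor r (k, s')" for k k' s'
      by (simp_all add: rot_def tor_def)
    show "snd (tor r (0, snd (rot r (0, s)))) = s" "snd (rot r (0, snd (tor r (0, s)))) = s"
      by (simp_all only: e tor_rot rot_tor snd_conv)
    show "snd (rot r (0, s)) \<in> {..<r}" "snd (tor r (0, s)) \<in> {..<r}" using s by simp_all
    show "cons_frag (c, snd (rot r (0, s))) (chess r J (alt_rot r 1 (slice x (tor r (0, snd (rot r (0, s))))))) =
      cons_frag (rot r (c, s)) (chess r J (alt_rot r 1 (slice x (0, s))))"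
      by (simp only: e tor_rot)
  qed
  also have "\<dots> = chess r (c # J) (alt_rot r 1 x)" by (simp add: s)
  finally show ?case .
qed

text \<open>Forgetting the column turns a vertex of the chessboard into a label of the single family 0.\<close>

definition row_label :: "vertex \<Rightarrow> vertex" where "row_label v = (0, snd v)"

lemma row_label_rot: "row_label (rot r v) = rot r (row_label v)"
  by (simp add: row_label_def rot_def)

lemma keys_chess:
  "t \<in> keys (chess r J x) \<Longrightarrow>
    map fst t = J \<and> x (map row_label t) \<noteq> 0 \<and> snd ` set t \<subseteq> {..<r}"
proof (induction J arbitrary: x t)
  case Nil
  then show ?case by (auto simp: keys_cmul_iff split: if_splits)
next
  case (Cons c J)
  then obtain s where s: "s < r" "t \<in> keys (cons_frag (c, s) (chess r J (slice x (0, s))))"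
    using keys_sum[of "\<lambda>s. cons_frag (c, s) (chess r J (slice x (0, s)))" "{..<r}"] by auto
  then obtain t' where t': "t = (c, s) # t'" "t' \<in> keys (chess r J (slice x (0, s)))"
    using keys_cons_frag by blast
  from Cons.IH[OF t'(2)] show ?case using t'(1) s(1) by (auto simp: slice_def row_label_def)
qed

definition project :: "list_chain \<Rightarrow> vertex list \<Rightarrow> int" where
  "project = lin (\<lambda>t. oriented (map row_label t))"

lemma project_diff: "project (a - b) = project a - project b"
  by (simp only: project_def lin_diff)

lemma project_sum: "project (\<Sum>i\<in>I. f i) = (\<Sum>i\<in>I. project (f i))"
  by (rule additive.sum[OF additiveI]) (rule project_diff)

lemma project_of: "project (frag_of t) = oriented (map row_label t)"
  by (simp add: project_def)

lemma wedge_diff: "wedge v (x - y) = wedge v x - wedge v y"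
proof -
  have "wedge v (x - y) l = wedge v x l - wedge v y l" for l
  proof (induction l arbitrary: x y)
    case (Cons a l)
    have "slice (x - y) a = slice x a - slice y a" by (simp add: slice_def fun_eq_iff)
    then show ?case unfolding wedge.simps by (simp only: Cons) simp
  qed simp
  then show ?thesis by (simp add: fun_eq_iff)
qed

lemma project_cons: "project (cons_frag v c) = wedge (row_label v) (project c)"
proof (rule frag_hom_eq[where c = c])
  show "project (cons_frag v (a - b)) = project (cons_frag v a) - project (cons_frag v b)" for a b
    by (simp only: cons_frag_diff project_diff)
  show "wedge (row_label v) (project (a - b)) = wedge (row_label v) (project a) - wedge (row_label v) (project b)" for a b
    by (simp only: project_diff wedge_diff)
qed (simp add: project_of)

text \<open>A top simplex of the boundary of the simplex on \<open>r\<close> rows is hit by all distributions of its rows over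
the columns, always with the same sign.\<close>

lemma project_chess:
  assumes "alternating x" "\<And>l. x l \<noteq> 0 \<Longrightarrow> length l = length J \<and> set l \<subseteq> labels r 1"
  shows "project (chess r J x) = (\<lambda>l. fact (length J) * x l)"
  using assms
proof (induction J arbitrary: x)
  case Nil
  have "project (chess r [] x) = (\<lambda>l. x [] * unit_fun l)"
    by (simp add: project_def lin_cmul fun_eq_iff)
  also have "\<dots> = x" using Nil.prems(2) by (fastforce simp: unit_fun_def)
  finally show ?case by simp
next
  case (Cons c J)
  have sl: "project (chess r J (slice x (0, s))) = (\<lambda>l. fact (length J) * slice x (0, s) l)" for s
  proof (rule Cons.IH)
    show "alternating (slice x (0, s))" by (rule alternating_slice[OF Cons.prems(1)])
    show "length l = length J \<and> set l \<subseteq> labels r 1" if "slice x (0, s) l \<noteq> 0" for l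
      using Cons.prems(2)[of "(0, s) # l"] that by (simp add: slice_def)
  qed
  have "labels r 1 = Pair 0 ` {..<r}" by (auto simp: labels_def)
  then have li: "(\<Sum>s<r. f (0, s)) = sum f (labels r 1)" for f :: "vertex \<Rightarrow> int"
    by (simp add: sum.reindex inj_on_def)
  show ?case
  proof
    fix l
    have "project (chess r (c # J) x) l = (\<Sum>s<r. wedge (0, s) (project (chess r J (slice x (0, s)))) l)"
      unfolding chess.simps project_sum sum_fun_apply project_cons by (simp add: row_label_def)
    also have "\<dots> = (\<Sum>s<r. fact (length J) * wedge (0, s) (slice x (0, s)) l)"
      by (simp add: sl wedge_scale)
    also have "\<dots> = fact (length J) * (\<Sum>v\<in>labels r 1. wedge v (slice x v) l)"
      using li[of "\<lambda>v. wedge v (slice x v) l"] by (simp flip: sum_distrib_left)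
    also have "\<dots> = fact (length (c # J)) * x l"
    proof (cases "set l \<subseteq> labels r 1")
      case True
      have "x l = 0 \<or> length l = Suc (length J)" using Cons.prems(2)[of l] by auto
      then show ?thesis
        using sum_wedge_slice[OF finite_labels Cons.prems(1) True] by auto
    next
      case False
      have "wedge v (slice x v) l = 0" if v: "v \<in> labels r 1" for v
      proof (rule ccontr)
        assume "wedge v (slice x v) l \<noteq> 0"
        then obtain l' where "x (v # l') \<noteq> 0" "set l = insert v (set l')"
          using wedge_nonzero[of v "slice x v" l] unfolding slice_def by blast
        then show False using Cons.prems(2)[of "v # l'"] False by auto
      qed
      moreover have "x l = 0" using Cons.prems(2)[of l] False by blast
      ultimately show ?thesis by simp
    qed
    finally show "project (chess r (c # J) x) l = fact (length (c # J)) * x l" .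
  qed
qed

text \<open>The chessboard complex on the columns \<open>S\<close>: non-attacking placements of rooks.\<close>

definition board :: "nat \<Rightarrow> nat set \<Rightarrow> vertex list set" where
  "board r S = {t. distinct (map fst t) \<and> distinct (map snd t) \<and>
    fst ` set t \<subseteq> S \<and> snd ` set t \<subseteq> {..<r}}"

lemma distinct_map_rot: "distinct (map snd (map (rot r) t)) \<longleftrightarrow> distinct (map snd t)"
proof -
  have "inj (\<lambda>s. snd (rot r (0, s)))"
  proof (rule injI)
    fix s s' assume "snd (rot r (0, s)) = snd (rot r (0, s'))"
    then have "rot r (0, s) = rot r (0, s')" by (simp add: prod_eq_iff)
    then show "s = s'" by simp
  qed
  moreover have "map snd (map (rot r) t) = map (\<lambda>s. snd (rot r (0, s))) (map snd t)"
    by (simp add: rot_def)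
  ultimately show ?thesis by (metis distinct_map inj_on_subset subset_UNIV)
qed

lemma simplicial_board: "simplicial r (board r S)"
proof -
  have "map (rot r) t \<in> board r S" if "t \<in> board r S" for t
  proof -
    have "map fst (map (rot r) t) = map fst t" by simp
    moreover have "fst ` set (map (rot r) t) = fst ` set t"
      by (auto simp: image_image)
    moreover have "snd ` set (map (rot r) t) \<subseteq> {..<r}" using that by (auto simp: board_def)
    ultimately show ?thesis using that distinct_map_rot[of r t] unfolding board_def mem_Collect_eq by metis
  qed
  moreover have "a @ b \<in> board r S" if "a @ v # b \<in> board r S" for a v b
    using that by (auto simp: board_def)
  moreover have "\<forall>v\<in>set t. snd v < r" if "t \<in> board r S" for t using that by (auto simp: board_def)
  ultimately show ?thesis unfolding simplicial_def by blast
qed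

lemma alt_rot_1_unit: "alt_rot r 1 unit_fun = unit_fun"
  by (simp add: alt_rot_def unit_fun_def fun_eq_iff)

lemma project_closed:
  assumes r: "prime r" and S: "finite S" "card S = r - 1" and c: "c \<in> list_chains (board r S) q"
  shows "project c \<in> alt_chains r 1 q"
  unfolding project_def
proof (rule lin_closed)
  interpret exact_pair "alt_chains r 1" "alt_bd (labels r 1)" "\<lambda>x. x []" r
      "norm_op r (alt_rot r 1)" "diff_op (alt_rot r 1)"
    by (rule alt_chains_exact_pair[OF r]) (simp add: sign_ok_def)
  show "0 \<in> alt_chains r 1 q" by (rule zero_closed)
  show "x - y \<in> alt_chains r 1 q" if "x \<in> alt_chains r 1 q" "y \<in> alt_chains r 1 q" for x y
    using that by (rule diff_closed)
  fix t assume "t \<in> keys c"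
  then have t: "t \<in> board r S" "length t = q" using c by (auto simp: list_chains_def)
  have "length t = card (set (map fst t))" using t distinct_card[of "map fst t"] by (simp add: board_def)
  also have "\<dots> \<le> card S" using t by (intro card_mono S) (auto simp: board_def)
  finally have len: "length t \<le> r - 1" using S by simp
  have "proper r 1 (set (map row_label t))"
    unfolding proper_def
  proof (intro conjI allI impI)
    show "set (map row_label t) \<subseteq> labels r 1" using t by (auto simp: board_def row_label_def labels_def)
    fix k :: nat assume "k < 1"
    have "\<not> {..<r} \<subseteq> set (map snd t)"
    proof
      assume "{..<r} \<subseteq> set (map snd t)"
      then have "r \<le> card (set (map snd t))" using card_mono[of "set (map snd t)" "{..<r}"] by simp
      then show False using card_length[of "map snd t"] len prime_gt_0_nat[OF r] by simp
    qed
    then show "\<exists>s<r. (k, s) \<notin> set (map row_label t)" by (force simp: row_label_def)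
  qed
  then show "oriented (map row_label t) \<in> alt_chains r 1 q"
    using oriented_nonzero[of "map row_label t"] t(2) alternating_oriented[of "map row_label t"]
    unfolding alt_chains_def by fastforce
qed

lemma project_bd:
  assumes "c \<in> list_chains (board r S) q"
  shows "project (chain_bd c) = alt_bd (labels r 1) (project c)"
proof (rule frag_hom_eq[where c = c])
  fix t assume "t \<in> keys c"
  then have "snd ` set t \<subseteq> {..<r}" using assms by (auto simp: list_chains_def board_def)
  then show "project (chain_bd (frag_of t)) = alt_bd (labels r 1) (project (frag_of t))"
  proof (induction t)
    case Nil
    have "alt_bd (labels r 1) unit_fun = 0" by (simp add: alt_bd_def unit_fun_def fun_eq_iff)
    moreover have "project 0 = 0" using project_diff[of 0 0] by simp
    ultimately show ?case by (simp add: project_of)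
  next
    case (Cons v t)
    have "row_label v \<in> labels r 1" using Cons.prems by (auto simp: row_label_def labels_def)
    then show ?case using Cons
      by (simp add: project_diff project_of project_cons alt_bd_wedge)
  qed
next
  show "project (chain_bd (a - b)) = project (chain_bd a) - project (chain_bd b)" for a b
    by (simp only: chain_bd_diff project_diff)
  show "alt_bd (labels r 1) (project (a - b)) =
      alt_bd (labels r 1) (project a) - alt_bd (labels r 1) (project b)" for a b
    by (simp only: project_diff alt_bd_diff)
qed

lemma project_rot: "project (list_rot r 1 c) = alt_rot r 1 (project c)"
proof (rule frag_hom_eq[where c = c])
  fix t
  have e: "map row_label (map (rot r) t) = map (rot r) (map row_label t)" by (simp add: row_label_rot)
  have "oriented (map row_label (map (rot r) t)) l = oriented (map row_label t) (map (tor r) l)" for l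
    unfolding e by (rule oriented_map) simp_all
  then show "project (list_rot r 1 (frag_of t)) = alt_rot r 1 (project (frag_of t))"
    by (simp add: list_rot_def project_of alt_rot_def fun_eq_iff del: map_map)
next
  show "project (list_rot r 1 (a - b)) = project (list_rot r 1 a) - project (list_rot r 1 b)" for a b
    by (simp only: list_rot_diff project_diff)
  show "alt_rot r 1 (project (a - b)) = alt_rot r 1 (project a) - alt_rot r 1 (project b)" for a b
    unfolding project_diff by (simp add: alt_rot_def fun_eq_iff)
qed

section \<open>A cycle of the rainbow complex with nonzero ladder number\<close>

text \<open>The operator whose image contains the fundamental cycle of one chessboard complex, and its partner.
The rotation of the \<open>r\<close> rows is an even permutation for odd \<open>r\<close> and odd for \<open>r = 2\<close>, so the cycle is
a norm in the first case and a difference in the second.\<close>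

definition op_top :: "nat \<Rightarrow> ('g \<Rightarrow> 'g) \<Rightarrow> 'g \<Rightarrow> 'g::ab_group_add" where
  "op_top r \<tau> = (if r = 2 then diff_op \<tau> else norm_op r \<tau>)"

definition op_low :: "nat \<Rightarrow> ('g \<Rightarrow> 'g) \<Rightarrow> 'g \<Rightarrow> 'g::ab_group_add" where
  "op_low r \<tau> = (if r = 2 then norm_op r \<tau> else diff_op \<tau>)"

lemma alt_chains_op_pair:
  assumes "prime r" "sign_ok r \<sigma>"
  shows "exact_pair (alt_chains r L) (alt_bd (labels r L)) (\<lambda>x. x []) r
    (op_top r (alt_rot r \<sigma>)) (op_low r (alt_rot r \<sigma>))"
  using alt_chains_exact_pair[OF assms, of L] exact_pair_swap[OF alt_chains_exact_pair[OF assms, of L]]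
  by (cases "r = 2") (simp_all only: op_top_def op_low_def if_True if_False simp_thms)

lemma list_chains_op_pair:
  assumes "prime r" "sign_ok r \<sigma>" "simplicial r T"
  shows "exact_pair (list_chains T) chain_bd coeff_Nil r (op_top r (list_rot r \<sigma>)) (op_low r (list_rot r \<sigma>))"
  using list_chains_exact_pair[OF prime_gt_0_nat[OF assms(1)] assms(2,3)]
    exact_pair_swap[OF list_chains_exact_pair[OF prime_gt_0_nat[OF assms(1)] assms(2,3)]]
  by (cases "r = 2") (simp_all only: op_top_def op_low_def if_True if_False simp_thms)

lemma op_hom:
  assumes "\<And>x y. h (x - y) = h x - h y" "\<And>x. h (\<tau> x) = \<tau>' (h x)"
  shows "h (op_top r \<tau> x) = op_top r \<tau>' (h x)" "h (op_low r \<tau> x) = op_low r \<tau>' (h x)"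
  by (simp_all add: op_top_def op_low_def norm_op_hom[where h = h and \<tau> = \<tau> and \<tau>' = \<tau>', OF assms])

text \<open>The ladder for \<open>Z\<close> exists because the action is free; its number is found by projection. The projection of
\<open>Z\<close> is \<open>(r - 1)!\<close> times the cycle \<open>z\<close> from \<open>ladder_ascend\<close>, whose number is 1, and \<open>(r - 1)!\<close> is
prime to \<open>r\<close>.\<close>

lemma board_ladder:
  assumes r: "prime r" and J: "distinct J" "length J = r - 1"
  shows "\<exists>Z c. Z \<in> list_chains (board r (set J)) (r - 1) \<and> chain_bd Z = 0 \<and>
    op_low r (list_rot r 1) Z = 0 \<and> \<not> int r dvd c \<and>
    list_ladder (board r (set J)) (op_top r (list_rot r 1)) (op_low r (list_rot r 1)) (r - 1) Z c"
proof -
  have "r = 2 \<or> 2 < r" using prime_ge_2_nat[OF r] by linarith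
  then have par: "even (r - 1) \<longleftrightarrow> r \<noteq> 2" using prime_odd_nat[OF r] by auto
  have ok: "sign_ok r 1" by (simp add: sign_ok_def)
  let ?X = "alt_chains r 1" and ?d = "alt_bd (labels r 1)" and ?v = "\<lambda>x::vertex list \<Rightarrow> int. x []"
  note ep = alt_chains_exact_pair[OF r ok, of 1]
  have ops: "(if even (r - 1) then norm_op r \<tau> else diff_op \<tau>) = op_top r \<tau>"
    "(if even (r - 1) then diff_op \<tau> else norm_op r \<tau>) = op_low r \<tau>" for \<tau> :: "'g \<Rightarrow> 'g::ab_group_add"
    using par by (auto simp: op_top_def op_low_def)
  have unit: "unit_fun \<in> ?X 0"
    using alternating_oriented[of "[]"] proper_empty[OF prime_gt_0_nat[OF r]]
    by (auto simp: alt_chains_def unit_fun_def split: if_splits)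
  have unit_bd: "?d unit_fun = 0" by (simp add: alt_bd_def unit_fun_def fun_eq_iff)
  have unit_inv: "diff_op (alt_rot r 1) unit_fun = 0" by (simp add: diff_op_def alt_rot_1_unit)
  obtain z where z: "z \<in> ?X (r - 1)" "?d z = 0" "op_low r (alt_rot r 1) z = 0"
    "ladder ?X ?d ?v (op_top r (alt_rot r 1)) (op_low r (alt_rot r 1)) (r - 1) z (unit_fun ([] :: vertex list))"
    using ladder_ascend[OF ep unit unit_bd unit_inv alt_chains_cone order_refl, of "r - 1"]
    unfolding ops by blast
  have one: "unit_fun ([] :: vertex list) = 1" by (simp add: unit_fun_def)
  have alt: "alternating z" and supp: "\<And>l. z l \<noteq> 0 \<Longrightarrow> length l = length J \<and> set l \<subseteq> labels r 1"
    using z(1) J by (auto simp: alt_chains_def proper_def)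
  \<comment> \<open>\<open>z\<close> is a top-dimensional cycle of the boundary of the simplex on the \<open>r\<close> rows.\<close>
  define Z where "Z = chess r J z"
  have keys: "t \<in> board r (set J) \<and> length t = r - 1" if "t \<in> keys Z" for t
  proof -
    have t: "map fst t = J" "z (map row_label t) \<noteq> 0" "snd ` set t \<subseteq> {..<r}"
      using keys_chess that unfolding Z_def by blast+
    have "distinct (map row_label t)" using alternating_distinct[OF alt t(2)] .
    moreover have "map row_label t = map (Pair 0) (map snd t)" by (induction t) (simp_all add: row_label_def)
    ultimately have "distinct (map (Pair (0::nat)) (map snd t))" by simp
    then have "distinct (map snd t)" by (simp only: distinct_map)
    moreover have "fst ` set t = set J" using t(1) by force
    moreover have "length t = length J" using t(1) by (metis length_map)
    ultimately show ?thesis using t J by (simp add: board_def)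
  qed
  then have Z: "Z \<in> list_chains (board r (set J)) (r - 1)" by (simp add: list_chains_def)
  have Z_bd: "chain_bd Z = 0" unfolding Z_def by (rule chain_bd_chess[OF alt z(2)])
  have "chess r J (alt_rot r 1 x) = list_rot r 1 (chess r J x)" for x by (simp add: list_rot_def chess_rot)
  from op_hom(2)[where h = "chess r J" and \<tau> = "alt_rot r 1" and \<tau>' = "list_rot r 1", OF chess_diff this]
  have "op_low r (list_rot r 1) Z = chess r J (op_low r (alt_rot r 1) z)" unfolding Z_def by simp
  then have Z_inv: "op_low r (list_rot r 1) Z = 0" using z(3) by (simp only: chess_zero)
  obtain c where c: "list_ladder (board r (set J))
      (op_top r (list_rot r 1)) (op_low r (list_rot r 1)) (r - 1) Z c"
    using ladder_exists[OF list_chains_op_pair[OF r ok simplicial_board] Z Z_bd Z_inv] by blast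
  have S: "finite (set J)" "card (set J) = r - 1" using J by (auto simp: distinct_card)
  have "ladder ?X ?d ?v (op_top r (alt_rot r 1)) (op_low r (alt_rot r 1)) (r - 1) (project Z) c"
  proof (rule ladder_hom[OF c])
    show "project x \<in> ?X q" if "x \<in> list_chains (board r (set J)) q" for q x
      using project_closed[OF r S that] .
    show "project (chain_bd x) = ?d (project x)" if "x \<in> list_chains (board r (set J)) (Suc q)" for q x
      using project_bd[OF that] .
    show "project x [] = coeff_Nil x" if "x \<in> list_chains (board r (set J)) 0" for x
    proof -
      have k: "keys x \<subseteq> {[]}" using that by (auto simp: list_chains_def)
      show ?thesis unfolding project_def lin_superset[OF _ k, simplified] by (simp add: unit_fun_def)
    qed
    show "project (op_top r (list_rot r 1) x) = op_top r (alt_rot r 1) (project x)"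
      "project (op_low r (list_rot r 1) x) = op_low r (alt_rot r 1) (project x)" for x
      using op_hom[where h = project and \<tau> = "list_rot r 1" and \<tau>' = "alt_rot r 1", OF project_diff project_rot]
      by blast+
  qed
  moreover have "project Z = (\<Sum>i<(fact (r - 1) :: nat). z)"
  proof
    fix l
    have "project Z l = fact (length J) * z l"
      unfolding Z_def using project_chess[OF alt supp] by (rule fun_cong)
    then show "project Z l = (\<Sum>i<(fact (r - 1) :: nat). z) l"
      unfolding sum_fun_apply using J by simp
  qed
  ultimately have "int r dvd c - int (fact (r - 1)) * 1"
    using ladder_multiple[OF z(4) alt_chains_op_pair[OF r ok], of "fact (r - 1)"]
      ladder_unique[OF _ _ alt_chains_op_pair[OF r ok]] unfolding one by metis
  moreover have "\<not> int r dvd int (fact (r - 1))"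
    using prime_dvd_fact_iff[OF r, of "r - 1"] prime_gt_0_nat[OF r] unfolding int_dvd_int_iff by simp
  ultimately have "\<not> int r dvd c" by (metis dvd_diff_right_iff mult.right_neutral)
  then show ?thesis using Z Z_bd Z_inv c by blast
qed

text \<open>The blocks of \<open>r - 1\<close> consecutive columns are the colour classes. The column \<open>L * (r - 1)\<close> is alone in
block \<open>L\<close>.\<close>

definition rainbow :: "nat \<Rightarrow> nat \<Rightarrow> vertex list set" where
  "rainbow r L = {t. distinct (map fst t) \<and> (\<forall>v\<in>set t. fst v \<le> L * (r - 1) \<and> snd v < r) \<and>
    (\<forall>v\<in>set t. \<forall>w\<in>set t. fst v div (r - 1) = fst w div (r - 1) \<and> snd v = snd w \<longrightarrow> v = w)}"

lemma simplicial_rainbow: "simplicial r (rainbow r L)"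
proof -
  have "map (rot r) t \<in> rainbow r L" if "t \<in> rainbow r L" for t
  proof -
    have "rot r v = rot r w" if "v \<in> set t" "w \<in> set t" "fst v div (r - 1) = fst w div (r - 1)"
      "snd (rot r v) = snd (rot r w)" for v w
    proof -
      have "snd v < r" "snd w < r" using \<open>t \<in> rainbow r L\<close> that by (auto simp: rainbow_def)
      have "rot r (0, snd u) = (0, snd (rot r u))" for u :: vertex by (simp add: rot_def)
      then have "rot r (0, snd v) = rot r (0, snd w)" using that(4) by simp
      then have "snd v = snd w" unfolding rot_eq_iff by simp
      then have "v = w" using \<open>t \<in> rainbow r L\<close> that by (auto simp: rainbow_def)
      then show ?thesis by simp
    qed
    moreover have "map fst (map (rot r) t) = map fst t" by simp
    ultimately show ?thesis using that unfolding rainbow_def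
      by (simp del: map_map)
  qed
  moreover have "a @ b \<in> rainbow r L" if "a @ v # b \<in> rainbow r L" for a v b
    using that by (auto simp: rainbow_def)
  moreover have "\<forall>v\<in>set t. snd v < r" if "t \<in> rainbow r L" for t using that by (auto simp: rainbow_def)
  ultimately show ?thesis unfolding simplicial_def by blast
qed

lemma list_rot_cat_chain:
  assumes "rot_frag r w = frag_cmul \<eta> w" "\<sigma> * \<eta> = 1"
  shows "list_rot r \<sigma> (cat_chain u w) = cat_chain (list_rot r 1 u) w"
  using assms by (simp add: list_rot_def rot_frag_cat_chain cat_chain_cmul_right)

lemma op_cmul: "op_top r (list_rot r \<sigma>) (frag_cmul k u) = frag_cmul k (op_top r (list_rot r \<sigma>) u)"
  "op_low r (list_rot r \<sigma>) (frag_cmul k u) = frag_cmul k (op_low r (list_rot r \<sigma>) u)"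
proof -
  have "frag_cmul k (list_rot r \<sigma> x) = list_rot r \<sigma> (frag_cmul k x)" for x
    by (simp add: list_rot_def rot_frag_cmul mult.commute)
  note h = op_hom[where h = "frag_cmul k" and \<tau> = "list_rot r \<sigma>" and \<tau>' = "list_rot r \<sigma>", OF frag_cmul_diff this]
  show "op_top r (list_rot r \<sigma>) (frag_cmul k u) = frag_cmul k (op_top r (list_rot r \<sigma>) u)"
    "op_low r (list_rot r \<sigma>) (frag_cmul k u) = frag_cmul k (op_low r (list_rot r \<sigma>) u)"
    using h by simp_all
qed

lemma norm_op_2: "norm_op 2 \<tau> x = x + \<tau> x"
  by (simp add: norm_op_def numeral_2_eq_2)

text \<open>For \<open>r = 2\<close> changing the sign exchanges norm and difference. This makes the odd number \<open>r - 1 = 1\<close> of steps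
per block compatible with \<open>ladder_cat_chain\<close>.\<close>

lemma op_neg_2:
  "op_top 2 (list_rot 2 (- \<sigma>)) = op_low 2 (list_rot 2 \<sigma>)" "op_low 2 (list_rot 2 (- \<sigma>)) = op_top 2 (list_rot 2 \<sigma>)"
proof -
  have t: "list_rot 2 (- \<sigma>) u = - list_rot 2 \<sigma> u" for u by (simp add: list_rot_def)
  show "op_top 2 (list_rot 2 (- \<sigma>)) = op_low 2 (list_rot 2 \<sigma>)" "op_low 2 (list_rot 2 (- \<sigma>)) = op_top 2 (list_rot 2 \<sigma>)"
    by (simp_all add: fun_eq_iff op_top_def op_low_def diff_op_def t norm_op_2[of "list_rot 2 (- \<sigma>)"] norm_op_2[of "list_rot 2 \<sigma>"])
qed

text \<open>The join of the first \<open>j\<close> chessboard cycles. Each factor is reversed by the rotation if \<open>r = 2\<close>, and the sign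
in the operators follows this.\<close>

lemma rainbow_ladder:
  assumes r: "prime r" and "j \<le> L"
  shows "\<exists>M c. M \<in> list_chains (rainbow r L) (j * (r - 1)) \<and>
    (\<forall>t\<in>keys M. \<forall>v\<in>set t. fst v < j * (r - 1)) \<and> chain_bd M = 0 \<and>
    rot_frag r M = frag_cmul ((if r = 2 then -1 else 1) ^ j) M \<and> \<not> int r dvd c \<and>
    list_ladder (rainbow r L)
      (op_top r (list_rot r ((if r = 2 then -1 else 1) ^ Suc j))) (op_low r (list_rot r ((if r = 2 then -1 else 1) ^ Suc j)))
      (j * (r - 1)) M c"
  using assms(2)
proof (induction j)
  case 0
  have "frag_of [] \<in> list_chains (rainbow r L) 0" by (simp add: list_chains_def rainbow_def)
  from ladder.base[of _ "list_chains (rainbow r L)", OF this, of chain_bd coeff_Nil]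
  show ?case using prime_gt_1_nat[OF r] \<open>frag_of [] \<in> _\<close>
    by (intro exI[of _ "frag_of []"] exI[of _ 1]) simp
next
  case (Suc j)
  let ?p = "r - 1" and ?T = "rainbow r L"
  \<comment> \<open>The sign by which a rotation acts on a single chessboard cycle.\<close>
  define \<eta> :: int where "\<eta> = (if r = 2 then -1 else 1)"
  have \<eta>2: "\<eta> * \<eta> = 1" by (simp add: \<eta>_def)
  then have \<eta>j: "\<eta> ^ Suc (Suc j) * \<eta> ^ j = 1" 
    by (simp add: power_mult_distrib[symmetric] flip: mult.assoc) 
  obtain M c where M: "M \<in> list_chains ?T (j * ?p)"
    "\<And>t v. t \<in> keys M \<Longrightarrow> v \<in> set t \<Longrightarrow> fst v < j * ?p"
    "chain_bd M = 0" "rot_frag r M = frag_cmul (\<eta> ^ j) M" "\<not> int r dvd c"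
    "list_ladder ?T (op_top r (list_rot r (\<eta> ^ Suc j))) (op_low r (list_rot r (\<eta> ^ Suc j)))
      (j * ?p) M c"
    using Suc unfolding \<eta>_def by (metis Suc_leD)
  let ?J = "[j * ?p..<Suc j * ?p]"
  obtain Z b where Z: "Z \<in> list_chains (board r (set ?J)) ?p" "chain_bd Z = 0"
    "op_low r (list_rot r 1) Z = 0" "\<not> int r dvd b"
    "list_ladder (board r (set ?J)) (op_top r (list_rot r 1)) (op_low r (list_rot r 1)) ?p Z b"
    using board_ladder[OF r, of ?J] by auto
  let ?M = "cat_chain Z M" and ?s = "\<eta> ^ Suc (Suc j)"
  have cat: "s @ t \<in> ?T \<and> (\<forall>v\<in>set (s @ t). fst v < Suc j * ?p)"
    if s: "s \<in> board r (set ?J)" and t: "t \<in> keys M" for s t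
  proof -
    have sv: "j * ?p \<le> fst v" "fst v < Suc j * ?p" "snd v < r" if "v \<in> set s" for v
      using s that by (auto simp: board_def)
    have tv: "fst v < j * ?p" if "v \<in> set t" for v using M(2) t that by blast
    have tT: "t \<in> ?T" using M(1) t by (auto simp: list_chains_def)
    have p0: "0 < ?p" using prime_gt_1_nat[OF r] by simp
    have sd: "fst v div ?p = j" if "v \<in> set s" for v
      using sv[OF that] p0 by (intro div_nat_eqI) (simp_all add: mult.commute)
    have td: "fst v div ?p < j" if "v \<in> set t" for v
      using tv[OF that] p0 by (simp add: div_less_iff_less_mult)
    have ss: "v = w" if "v \<in> set s" "w \<in> set s" "snd v = snd w" for v w
    proof -
      have "inj_on snd (set s)" using s by (simp add: board_def distinct_map)
      then show ?thesis using that by (meson inj_onD)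
    qed
    have "Suc j * ?p \<le> L * ?p" using Suc.prems by (rule mult_le_mono1)
    then have b: "fst v \<le> L * ?p" if "v \<in> set s" for v using sv(2)[OF that] by linarith
    have "distinct (map fst (s @ t))"
      using s tT sv tv by (fastforce simp: board_def rainbow_def)
    moreover have "v = w" if vw: "v \<in> set (s @ t)" "w \<in> set (s @ t)" "fst v div ?p = fst w div ?p"
      "snd v = snd w" for v w
    proof -
      consider "v \<in> set s" "w \<in> set s" | "v \<in> set s" "w \<in> set t" | "v \<in> set t" "w \<in> set s"
        | "v \<in> set t" "w \<in> set t" using vw(1,2) by auto
      then show ?thesis
      proof cases
        case 1
        then show ?thesis using ss vw(4) by blast
      next
        case 2
        then show ?thesis using sd[of v] td[of w] that(3) by simp
      next
        case 3
        then show ?thesis using sd[of w] td[of v] that(3) by simp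
      next
        case 4
        then show ?thesis using tT that(3,4) unfolding rainbow_def by blast
      qed
    qed
    moreover have "\<forall>v\<in>set (s @ t). fst v \<le> L * ?p \<and> snd v < r"
      using b sv(3) tT by (auto simp: rainbow_def)
    ultimately have "s @ t \<in> ?T" unfolding rainbow_def by blast
    moreover have "fst v < Suc j * ?p" if "v \<in> set (s @ t)" for v
      using that sv(2) tv by (fastforce intro: less_le_trans)
    ultimately show ?thesis by blast
  qed
  have closed: "cat_chain u M \<in> list_chains ?T (q + j * ?p)" if u: "u \<in> list_chains (board r (set ?J)) q" for u q
    unfolding list_chains_def
  proof (intro CollectI ballI)
    fix x assume "x \<in> keys (cat_chain u M)"
    then obtain s t where "s \<in> keys u" "t \<in> keys M" "x = s @ t"
      using keys_cat_chain by blast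
    then show "x \<in> ?T \<and> length x = q + j * ?p"
      using cat[of s t] u M(1) by (auto simp: list_chains_def)
  qed
  have "list_ladder ?T (op_top r (list_rot r ?s)) (op_low r (list_rot r ?s)) (?p + j * ?p) ?M (b * c)"
  proof (rule ladder_cat_chain[OF Z(5) closed M(3) _ _ op_cmul])
    have "cat_chain (list_rot r 1 u) M = list_rot r ?s (cat_chain u M)" for u
      using list_rot_cat_chain[OF M(4) \<eta>j] by simp
    note h = op_hom[where h = "\<lambda>u. cat_chain u M" and \<tau> = "list_rot r 1" and \<tau>' = "list_rot r ?s", OF cat_chain_diff_left this]
    show "op_top r (list_rot r ?s) (cat_chain u M) = cat_chain (op_top r (list_rot r 1) u) M"
      "op_low r (list_rot r ?s) (cat_chain u M) = cat_chain (op_low r (list_rot r 1) u) M" for u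
      using h by simp_all
    show "list_ladder ?T
      (if even ?p then op_top r (list_rot r ?s) else op_low r (list_rot r ?s))
      (if even ?p then op_low r (list_rot r ?s) else op_top r (list_rot r ?s)) (j * ?p) M c"
    proof (cases "r = 2")
      case True
      have "?s = - (\<eta> ^ Suc j)" by (simp add: \<eta>_def True)
      then show ?thesis using M(6) op_neg_2[of "\<eta> ^ Suc j"] by (simp only: True) simp
    next
      case False
      then have "2 < r" using prime_ge_2_nat[OF r] by simp
      then have "even ?p" using prime_odd_nat[OF r] by simp
      then show ?thesis using M(6) False by (simp add: \<eta>_def)
    qed
  qed
  moreover have "?M \<in> list_chains ?T (Suc j * ?p)" using closed[OF Z(1)] by simp
  moreover have "\<forall>t\<in>keys ?M. \<forall>v\<in>set t. fst v < Suc j * ?p"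
    using keys_cat_chain cat Z(1) unfolding list_chains_def by blast
  moreover have "chain_bd ?M = 0" using chain_bd_cat_chain[OF M(3), of Z] Z(2) by simp
  moreover have "rot_frag r ?M = frag_cmul (\<eta> ^ Suc j) ?M"
  proof -
    have "rot_frag r Z = frag_cmul \<eta> Z"
    proof (cases "r = 2")
      case True
      then have "Z + rot_frag r Z = 0"
        using Z(3) by (simp add: op_low_def norm_op_2 list_rot_def)
      then show ?thesis using True by (simp add: \<eta>_def eq_neg_iff_add_eq_0 add.commute)
    next
      case False
      then show ?thesis using Z(3) by (simp add: op_low_def diff_op_def list_rot_def \<eta>_def)
    qed
    then show ?thesis
      by (simp add: rot_frag_cat_chain M(4) cat_chain_cmul_left cat_chain_cmul_right mult.commute)
  qed
  moreover have "\<not> int r dvd b * c"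
    using M(5) Z(4) r by (simp add: prime_dvd_mult_iff)
  ultimately show ?case unfolding \<eta>_def[symmetric] by (metis add.commute mult_Suc)
qed

section \<open>Equivariant labels\<close>

definition spread :: "nat \<Rightarrow> nat \<Rightarrow> (vertex \<Rightarrow> real) set" where
  "spread r L = {y. \<exists>v\<in>labels r L. \<exists>w\<in>labels r L. fst v = fst w \<and> y v \<noteq> y w}"

text \<open>A pair \<open>(k, s)\<close> is a peak if some difference \<open>y (k, s) - y (k, s')\<close> is the largest difference within any
family. This condition is closed in \<open>y\<close>.\<close>

definition peaks :: "nat \<Rightarrow> nat \<Rightarrow> (vertex \<Rightarrow> real) \<Rightarrow> vertex set" where
  "peaks r L y = {v \<in> labels r L. \<exists>u\<in>labels r L. fst u = fst v \<and>
    (\<forall>a\<in>labels r L. \<forall>b\<in>labels r L. fst a = fst b \<longrightarrow> y a - y b \<le> y v - y u)}"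

lemma peaks_nonempty:
  assumes "y \<in> spread r L" shows "peaks r L y \<noteq> {}"
proof -
  define S where "S = {(a, b) \<in> labels r L \<times> labels r L. fst a = fst b}"
  have fin: "finite S" unfolding S_def by (rule finite_subset[of _ "labels r L \<times> labels r L"]) auto
  have ne: "S \<noteq> {}" using assms by (auto simp: S_def spread_def)
  define m where "m = Max ((\<lambda>(a, b). y a - y b) ` S)"
  have "m \<in> (\<lambda>(a, b). y a - y b) ` S" unfolding m_def using fin ne by (intro Max_in) auto
  then obtain v u where vu: "(v, u) \<in> S" "m = y v - y u" by auto
  have le: "y a - y b \<le> m" if "(a, b) \<in> S" for a b
    unfolding m_def using fin that by (intro Max_ge) auto
  have "v \<in> peaks r L y"
    unfolding peaks_def
  proof (intro CollectI conjI bexI[of _ u] ballI impI)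
    fix a b assume "a \<in> labels r L" "b \<in> labels r L" "fst a = fst b"
    then show "y a - y b \<le> y v - y u" using le[of a b] vu(2) by (simp add: S_def)
  qed (use vu in \<open>auto simp: S_def\<close>)
  then show ?thesis by blast
qed

text \<open>If all rows of a family were peaks, each of them would be maximal, so the family would be constant; but its
spread is the largest one.\<close>

lemma peaks_proper:
  assumes "y \<in> spread r L" shows "proper r L (peaks r L y)"
  unfolding proper_def
proof (intro conjI allI impI)
  show "peaks r L y \<subseteq> labels r L" by (auto simp: peaks_def)
  fix k assume k: "k < L"
  show "\<exists>s<r. (k, s) \<notin> peaks r L y"
  proof (rule ccontr)
    assume "\<not> (\<exists>s<r. (k, s) \<notin> peaks r L y)"
    then have all: "v \<in> peaks r L y" if "v \<in> labels r L" "fst v = k" for v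
      using that by (cases v) (auto simp: labels_def)
    obtain v w where vw: "v \<in> labels r L" "w \<in> labels r L" "fst v = fst w" "y v \<noteq> y w"
      using assms by (auto simp: spread_def)
    have "(k, snd v) \<in> peaks r L y" using k vw by (intro all) (auto simp: labels_def)
    then obtain u where u: "u \<in> labels r L" "fst u = k"
      "\<And>a b. a \<in> labels r L \<Longrightarrow> b \<in> labels r L \<Longrightarrow> fst a = fst b \<Longrightarrow> y a - y b \<le> y (k, snd v) - y u"
      by (auto simp: peaks_def)
    have pos: "0 < y (k, snd v) - y u" using u(3)[OF vw(1,2,3)] u(3)[OF vw(2,1)] vw(3,4) by simp
    obtain u' where u': "u' \<in> labels r L" "fst u' = k"
      "\<And>a b. a \<in> labels r L \<Longrightarrow> b \<in> labels r L \<Longrightarrow> fst a = fst b \<Longrightarrow> y a - y b \<le> y u - y u'"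
      using all[OF u(1,2)] u(2) by (auto simp: peaks_def)
    have "(k, snd v) \<in> labels r L" using k vw(1) by (auto simp: labels_def)
    from u'(3)[OF this u'(1)] u'(2) have "y (k, snd v) - y u' \<le> y u - y u'" by simp
    then show False using pos by simp
  qed
qed

lemma peaks_rot: "peaks r L (y \<circ> tor r) = rot r ` peaks r L y"
proof -
  have sub: "v \<in> peaks r L (y \<circ> tor r) \<longleftrightarrow> tor r v \<in> peaks r L y" for v
  proof
    assume "v \<in> peaks r L (y \<circ> tor r)"
    then obtain u where u: "v \<in> labels r L" "u \<in> labels r L" "fst u = fst v"
      "\<And>a b. a \<in> labels r L \<Longrightarrow> b \<in> labels r L \<Longrightarrow> fst a = fst b \<Longrightarrow>
        y (tor r a) - y (tor r b) \<le> y (tor r v) - y (tor r u)"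
      by (auto simp: peaks_def)
    have "y a - y b \<le> y (tor r v) - y (tor r u)"
      if "a \<in> labels r L" "b \<in> labels r L" "fst a = fst b" for a b
      using u(4)[of "rot r a" "rot r b"] that by simp
    then show "tor r v \<in> peaks r L y" using u(1-3) unfolding peaks_def
      by (intro CollectI conjI bexI[of _ "tor r u"]) auto
  next
    assume "tor r v \<in> peaks r L y"
    then obtain u where u: "tor r v \<in> labels r L" "u \<in> labels r L" "fst u = fst (tor r v)"
      "\<And>a b. a \<in> labels r L \<Longrightarrow> b \<in> labels r L \<Longrightarrow> fst a = fst b \<Longrightarrow> y a - y b \<le> y (tor r v) - y u"
      unfolding peaks_def by blast
    then show "v \<in> peaks r L (y \<circ> tor r)" unfolding peaks_def
      by (intro CollectI conjI bexI[of _ "rot r u"]) auto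
  qed
  show ?thesis
  proof (intro equalityI subsetI)
    fix v assume "v \<in> peaks r L (y \<circ> tor r)"
    then show "v \<in> rot r ` peaks r L y" using sub by (metis image_eqI rot_tor)
  next
    fix v assume "v \<in> rot r ` peaks r L y"
    then show "v \<in> peaks r L (y \<circ> tor r)" using sub by auto
  qed
qed

definition shift_index :: "nat \<Rightarrow> vertex set \<Rightarrow> nat" where
  "shift_index r A = (THE i. i < r \<and> chosen r ((tor r ^^ i) ` A))"

text \<open>An equivariant element of \<open>A\<close>: rotate \<open>A\<close> to the chosen set of its orbit, pick an element there and rotate
back.\<close>

definition select :: "nat \<Rightarrow> vertex set \<Rightarrow> vertex" where
  "select r A = (rot r ^^ shift_index r A) (SOME v. v \<in> (tor r ^^ shift_index r A) ` A)"

lemma select_in: "A \<noteq> {} \<Longrightarrow> select r A \<in> A"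
proof -
  assume "A \<noteq> {}"
  then have "(SOME v. v \<in> (tor r ^^ shift_index r A) ` A) \<in> (tor r ^^ shift_index r A) ` A"
    by (intro some_in_eq[THEN iffD2]) simp
  then show ?thesis unfolding select_def using rot_pow_tor_pow by auto
qed

lemma rot_pow_mod: "(rot r ^^ (i mod r)) v = (rot r ^^ i) v"
  by (simp add: rot_pow mod_simps)

lemma tor_pow_mod: "(tor r ^^ (i mod r)) v = (tor r ^^ i) v"
  by (metis rot_pow_mod rot_pow_tor_pow tor_pow_rot_pow)

lemma select_rot:
  assumes r: "prime r" and A: "proper r L A" "A \<noteq> {}"
  shows "select r (rot r ` A) = rot r (select r A)"
proof -
  have ex: "\<exists>!i. i < r \<and> chosen r ((tor r ^^ i) ` A)" by (rule chosen_unique[OF r A])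
  define i where "i = shift_index r A"
  have i: "i < r" "chosen r ((tor r ^^ i) ` A)"
    using theI'[OF ex] unfolding i_def shift_index_def by blast+
  have im: "(tor r ^^ (Suc i mod r)) ` rot r ` A = (tor r ^^ i) ` A"
    by (simp only: image_image tor_pow_mod funpow_Suc_right comp_apply tor_rot)
  have ex': "\<exists>!j. j < r \<and> chosen r ((tor r ^^ j) ` rot r ` A)"
    using chosen_unique[OF r, of L "rot r ` A"] A proper_rot by auto
  have "Suc i mod r < r \<and> chosen r ((tor r ^^ (Suc i mod r)) ` rot r ` A)"
    using i im prime_gt_0_nat[OF r] by simp
  then have si: "shift_index r (rot r ` A) = Suc i mod r"
    unfolding shift_index_def by (rule the1_equality[OF ex'])
  show ?thesis
    unfolding select_def si im i_def[symmetric] rot_pow_mod by simp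
qed

definition peak_label :: "nat \<Rightarrow> nat \<Rightarrow> (vertex \<Rightarrow> real) \<Rightarrow> vertex" where
  "peak_label r L y = select r (peaks r L y)"

lemma peak_label_in: "y \<in> spread r L \<Longrightarrow> peak_label r L y \<in> peaks r L y"
  unfolding peak_label_def by (intro select_in peaks_nonempty)

lemma peak_label_rot:
  assumes "prime r" "y \<in> spread r L" shows "peak_label r L (y \<circ> tor r) = rot r (peak_label r L y)"
  unfolding peak_label_def peaks_rot using select_rot[OF assms(1) peaks_proper[OF assms(2)] peaks_nonempty[OF assms(2)]] .

abbreviation spread_top :: "nat \<Rightarrow> nat \<Rightarrow> (vertex \<Rightarrow> real) topology" where
  "spread_top r L \<equiv> top_of_set (spread r L)"

text \<open>As being a peak is a closed condition, near \<open>z\<close> only peaks of \<open>z\<close> are peaks. The labels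
of a singular simplex inside such a set are therefore a proper set.\<close>

definition nbhd :: "nat \<Rightarrow> nat \<Rightarrow> (vertex \<Rightarrow> real) \<Rightarrow> (vertex \<Rightarrow> real) set" where
  "nbhd r L z = {y \<in> spread r L. peaks r L y \<subseteq> peaks r L z}"

lemma openin_nbhd: "openin (spread_top r L) (nbhd r L z)"
proof -
  have cl: "closed {y. v \<in> peaks r L y}" for v
  proof -
    have "{y. v \<in> peaks r L y} = (if v \<in> labels r L then \<Union>u\<in>{u\<in>labels r L. fst u = fst v}.
        \<Inter>(a, b)\<in>{(a, b). a \<in> labels r L \<and> b \<in> labels r L \<and> fst a = fst b}. {y. y a - y b \<le> y v - y u} else {})"
      by (auto simp: peaks_def)
    moreover have "closed {y :: vertex \<Rightarrow> real. y a - y b \<le> y v - y u}" for a b u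
      by (intro closed_Collect_le continuous_on_diff continuous_on_product_coordinates)
    then have "closed (\<Union>u\<in>{u\<in>labels r L. fst u = fst v}.
        \<Inter>(a, b)\<in>{(a, b). a \<in> labels r L \<and> b \<in> labels r L \<and> fst a = fst b}. {y :: vertex \<Rightarrow> real. y a - y b \<le> y v - y u})"
      by (intro closed_UN closed_INT) auto
    ultimately show ?thesis by simp
  qed
  have "nbhd r L z = spread r L \<inter> - (\<Union>v\<in>labels r L - peaks r L z. {y. v \<in> peaks r L y})"
    by (auto simp: nbhd_def peaks_def)
  moreover have "closed (\<Union>v\<in>labels r L - peaks r L z. {y. v \<in> peaks r L y})"
    using cl by (intro closed_UN) auto
  ultimately show ?thesis by (simp only: openin_open open_Compl) blast
qed

section \<open>The chain map induced by the labels\<close>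

definition corner :: "nat \<Rightarrow> nat \<Rightarrow> real" where
  "corner i = (\<lambda>j. if j = i then 1 else 0)"

lemma corner_in: "i \<le> p \<Longrightarrow> corner i \<in> standard_simplex p"
  by (simp add: corner_def)

definition corner_labels :: "nat \<Rightarrow> nat \<Rightarrow> nat \<Rightarrow> ((nat \<Rightarrow> real) \<Rightarrow> vertex \<Rightarrow> real) \<Rightarrow> vertex list" where
  "corner_labels r L p f = map (\<lambda>i. peak_label r L (f (corner i))) [0..<Suc p]"

definition delete :: "nat \<Rightarrow> 'v list \<Rightarrow> 'v list" where
  "delete k t = take k t @ drop (Suc k) t"

lemma delete_simps [simp]: "delete 0 (v # t) = t" "delete (Suc k) (v # t) = v # delete k t"
  by (simp_all add: delete_def)

lemma nth_delete: "k < length t \<Longrightarrow> i < length t - 1 \<Longrightarrow> delete k t ! i = t ! (if i < k then i else Suc i)"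
  by (auto simp: delete_def nth_append min_def)

lemma length_delete: "k < length t \<Longrightarrow> length (delete k t) = length t - 1"
  by (simp add: delete_def)

lemma alt_bd_oriented:
  assumes "finite V" "set t \<subseteq> V"
  shows "alt_bd V (oriented t) l = (\<Sum>k<length t. (-1) ^ k * oriented (delete k t) l)"
  using assms(2)
proof (induction t arbitrary: l)
  case Nil
  show ?case by (simp add: alt_bd_def unit_fun_def)
next
  case (Cons v t)
  have "alt_bd V (oriented t) = (\<lambda>l. \<Sum>k<length t. (-1) ^ k * oriented (delete k t) l)"
    using Cons by (simp add: fun_eq_iff)
  then have "wedge v (alt_bd V (oriented t)) l = (\<Sum>k<length t. (-1) ^ k * oriented (v # delete k t) l)"
    by (simp only: wedge_sum oriented.simps)
  moreover have "alt_bd V (oriented (v # t)) l = oriented t l - wedge v (alt_bd V (oriented t)) l"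
    using alt_bd_wedge[OF assms(1), of v "oriented t"] Cons.prems by simp
  ultimately show ?case
    by (simp add: sum.lessThan_Suc_shift sum_negf del: sum.lessThan_Suc oriented.simps)
qed

lemma list_bd_sum: "list_bd t = (\<Sum>k<length t. frag_cmul ((-1) ^ k) (frag_of (delete k t)))"
proof (induction t)
  case (Cons v t)
  have "cons_frag v (list_bd t) = (\<Sum>k<length t. frag_cmul ((-1) ^ k) (frag_of (v # delete k t)))"
    by (simp add: Cons cons_frag_sum cons_frag_cmul)
  then show ?case
    by (simp add: sum.lessThan_Suc_shift del: sum.lessThan_Suc flip: sum_negf)
qed simp

definition label_map :: "nat \<Rightarrow> nat \<Rightarrow> nat \<Rightarrow> (vertex \<Rightarrow> real) chain \<Rightarrow> vertex list \<Rightarrow> int" where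
  "label_map r L p = lin (\<lambda>f. oriented (corner_labels r L p f))"

lemma label_map_diff: "label_map r L p (a - b) = label_map r L p a - label_map r L p b"
  by (simp only: label_map_def lin_diff)

lemma label_map_of: "label_map r L p (frag_of f) = oriented (corner_labels r L p f)"
  by (simp add: label_map_def)

lemma singular_simplex_spread:
  "singular_simplex p (spread_top r L) f \<Longrightarrow> x \<in> standard_simplex p \<Longrightarrow> f x \<in> spread r L"
  by (auto simp: singular_simplex_def continuous_map_def)

lemma simplical_face_corner:
  "simplical_face k (corner i) = corner (if i < k then i else Suc i)"
  by (auto simp: simplical_face_def corner_def fun_eq_iff)

lemma corner_labels_face:
  assumes "k \<le> Suc p"
  shows "corner_labels r L p (singular_face (Suc p) k f) = delete k (corner_labels r L (Suc p) f)"
proof (rule nth_equalityI)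
  have len: "length (corner_labels r L q f) = Suc q" for q and f :: "(nat \<Rightarrow> real) \<Rightarrow> vertex \<Rightarrow> real"
    by (simp add: corner_labels_def)
  show l: "length (corner_labels r L p (singular_face (Suc p) k f)) = length (delete k (corner_labels r L (Suc p) f))"
    using assms by (simp add: len length_delete)
  fix i assume "i < length (corner_labels r L p (singular_face (Suc p) k f))"
  then have i: "i < Suc p" by (simp add: len)
  then have "singular_face (Suc p) k f (corner i) = f (corner (if i < k then i else Suc i))"
    using corner_in[of i p] by (simp add: singular_face_def simplical_face_corner)
  then have "corner_labels r L p (singular_face (Suc p) k f) ! i = peak_label r L (f (corner (if i < k then i else Suc i)))"
    using i by (simp add: corner_labels_def del: upt_Suc)
  also have "\<dots> = corner_labels r L (Suc p) f ! (if i < k then i else Suc i)"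
    using i by (simp add: corner_labels_def del: upt_Suc)
  also have "\<dots> = delete k (corner_labels r L (Suc p) f) ! i"
    using i assms by (intro nth_delete[symmetric]) (simp_all add: len)
  finally show "corner_labels r L p (singular_face (Suc p) k f) ! i = delete k (corner_labels r L (Suc p) f) ! i" .
qed

lemma lin_frag_sum:
  "lin h (\<Sum>k\<in>K. frag_cmul (c k) (frag_of (f k))) l = (\<Sum>k\<in>K. c k * h (f k) l)"
proof -
  have "lin h (\<Sum>k\<in>K. frag_cmul (c k) (frag_of (f k))) = (\<Sum>k\<in>K. lin h (frag_cmul (c k) (frag_of (f k))))"
    by (rule additive.sum[OF additiveI[of "lin h"]]) (rule lin_diff)
  then show ?thesis by (simp add: sum_fun_apply lin_cmul)
qed

lemma label_map_boundary:
  assumes "singular_chain (Suc p) (spread_top r L) c"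
  shows "alt_bd (labels r L) (label_map r L (Suc p) c) = label_map r L p (chain_boundary (Suc p) c)"
proof (rule frag_hom_eq[where c = c])
  fix f assume "f \<in> keys c"
  then have f: "singular_simplex (Suc p) (spread_top r L) f" using assms by (auto simp: singular_chain_def)
  have V: "set (corner_labels r L (Suc p) f) \<subseteq> labels r L"
  proof
    fix v assume "v \<in> set (corner_labels r L (Suc p) f)"
    then obtain i where "i \<le> Suc p" "v = peak_label r L (f (corner i))"
      unfolding corner_labels_def set_map set_upt by (auto simp: less_Suc_eq_le)
    then have "v \<in> peaks r L (f (corner i))"
      using peak_label_in[OF singular_simplex_spread[OF f corner_in]] by blast
    then show "v \<in> labels r L" by (simp add: peaks_def)
  qed
  have len: "length (corner_labels r L (Suc p) f) = Suc (Suc p)" by (simp add: corner_labels_def)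
  show "alt_bd (labels r L) (label_map r L (Suc p) (frag_of f)) = label_map r L p (chain_boundary (Suc p) (frag_of f))"
  proof
    fix l
    have "label_map r L p (chain_boundary (Suc p) (frag_of f)) l =
        (\<Sum>k\<le>Suc p. (-1) ^ k * oriented (corner_labels r L p (singular_face (Suc p) k f)) l)"
      unfolding label_map_def chain_boundary_of by (simp only: nat.distinct if_False lin_frag_sum)
    also have "\<dots> = (\<Sum>k<Suc (Suc p). (-1) ^ k * oriented (delete k (corner_labels r L (Suc p) f)) l)"
      unfolding lessThan_Suc_atMost by (intro sum.cong refl) (simp add: corner_labels_face)
    also have "\<dots> = alt_bd (labels r L) (label_map r L (Suc p) (frag_of f)) l"
      unfolding label_map_of alt_bd_oriented[OF finite_labels V] len ..
    finally show "alt_bd (labels r L) (label_map r L (Suc p) (frag_of f)) l =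
        label_map r L p (chain_boundary (Suc p) (frag_of f)) l" by simp
  qed
next
  show "alt_bd (labels r L) (label_map r L (Suc p) (a - b)) =
      alt_bd (labels r L) (label_map r L (Suc p) a) - alt_bd (labels r L) (label_map r L (Suc p) b)" for a b
    by (simp only: label_map_diff alt_bd_diff)
  show "label_map r L p (chain_boundary (Suc p) (a - b)) =
      label_map r L p (chain_boundary (Suc p) a) - label_map r L p (chain_boundary (Suc p) b)" for a b
    by (simp only: label_map_diff chain_boundary_diff)
qed

lemma label_map_rot:
  assumes r: "prime r" and c: "singular_chain p (spread_top r L) c"
  shows "label_map r L p (chain_map p (\<lambda>y. y \<circ> tor r) c) = alt_rot r 1 (label_map r L p c)"
proof (rule frag_hom_eq[where c = c])
  fix f assume "f \<in> keys c"
  then have f: "singular_simplex p (spread_top r L) f" using c by (auto simp: singular_chain_def)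
  have e: "corner_labels r L p (simplex_map p (\<lambda>y. y \<circ> tor r) f) = map (rot r) (corner_labels r L p f)"
    unfolding corner_labels_def map_map
  proof (rule map_cong[OF refl])
    fix i assume "i \<in> set [0..<Suc p]"
    then have i: "corner i \<in> standard_simplex p" by (intro corner_in) auto
    then have "simplex_map p (\<lambda>y. y \<circ> tor r) f (corner i) = f (corner i) \<circ> tor r"
      by (simp add: simplex_map_def)
    then show "peak_label r L (simplex_map p (\<lambda>y. y \<circ> tor r) f (corner i)) = (rot r \<circ> (\<lambda>i. peak_label r L (f (corner i)))) i"
      using peak_label_rot[OF r singular_simplex_spread[OF f i]] by simp
  qed
  have "oriented (map (rot r) (corner_labels r L p f)) l = oriented (corner_labels r L p f) (map (tor r) l)" for l
    by (rule oriented_map) simp_all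
  then show "label_map r L p (chain_map p (\<lambda>y. y \<circ> tor r) (frag_of f)) = alt_rot r 1 (label_map r L p (frag_of f))"
    unfolding chain_map_of label_map_of e by (simp add: alt_rot_def fun_eq_iff)
next
  show "label_map r L p (chain_map p (\<lambda>y. y \<circ> tor r) (a - b)) =
      label_map r L p (chain_map p (\<lambda>y. y \<circ> tor r) a) - label_map r L p (chain_map p (\<lambda>y. y \<circ> tor r) b)" for a b
    by (simp only: chain_map_diff label_map_diff)
  show "alt_rot r 1 (label_map r L p (a - b)) = alt_rot r 1 (label_map r L p a) - alt_rot r 1 (label_map r L p b)" for a b
    unfolding label_map_diff by (simp add: alt_rot_def fun_eq_iff)
qed

lemma label_map_closed:
  assumes r: "prime r"
    and small: "\<And>f. f \<in> keys c \<Longrightarrow> \<exists>z\<in>spread r L. f ` standard_simplex p \<subseteq> nbhd r L z"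
  shows "label_map r L p c \<in> alt_chains r L (Suc p)"
  unfolding label_map_def
proof (rule lin_closed)
  interpret exact_pair "alt_chains r L" "alt_bd (labels r L)" "\<lambda>x. x []" r
      "norm_op r (alt_rot r 1)" "diff_op (alt_rot r 1)"
    by (rule alt_chains_exact_pair[OF r]) (simp add: sign_ok_def)
  show "0 \<in> alt_chains r L (Suc p)" by (rule zero_closed)
  show "x - y \<in> alt_chains r L (Suc p)" if "x \<in> alt_chains r L (Suc p)" "y \<in> alt_chains r L (Suc p)" for x y
    using that by (rule diff_closed)
  fix f assume "f \<in> keys c"
  then obtain z where z: "z \<in> spread r L" "f ` standard_simplex p \<subseteq> nbhd r L z" using small by blast
  have "set (corner_labels r L p f) \<subseteq> peaks r L z"
  proof
    fix v assume "v \<in> set (corner_labels r L p f)"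
    then obtain i where "i \<le> p" "v = peak_label r L (f (corner i))"
      unfolding corner_labels_def set_map set_upt by (auto simp: less_Suc_eq_le)
    moreover have "f (corner i) \<in> nbhd r L z" using z(2) corner_in[OF \<open>i \<le> p\<close>] by blast
    ultimately show "v \<in> peaks r L z" using peak_label_in[of "f (corner i)" r L] by (auto simp: nbhd_def)
  qed
  then have "proper r L (set (corner_labels r L p f))" using peaks_proper[OF z(1)] proper_mono by blast
  moreover have "length (corner_labels r L p f) = Suc p" by (simp add: corner_labels_def)
  ultimately show "oriented (corner_labels r L p f) \<in> alt_chains r L (Suc p)"
    using oriented_nonzero[of "corner_labels r L p f"] alternating_oriented[of "corner_labels r L p f"]
    unfolding alt_chains_def by fastforce
qed

section \<open>From rainbow faces to row sums\<close>

definition point :: "vertex list \<Rightarrow> (nat \<Rightarrow> real) \<Rightarrow> nat \<Rightarrow> real" where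
  "point t \<alpha> c = (\<Sum>i<length t. if fst (t ! i) = c then \<alpha> i else 0)"

text \<open>The vector of all sums at the point with barycentric coordinates \<open>\<alpha>\<close> in the face \<open>t\<close>.\<close>

definition row_sums :: "nat \<Rightarrow> (nat \<Rightarrow> nat \<Rightarrow> (nat \<Rightarrow> real) \<Rightarrow> real) \<Rightarrow> vertex list \<Rightarrow> (nat \<Rightarrow> real) \<Rightarrow> vertex \<Rightarrow> real" where
  "row_sums L g t \<alpha> v = (if fst v < L then
    (\<Sum>i<length t. if snd (t ! i) = snd v then g (fst v) (fst (t ! i)) (point t \<alpha>) else 0) else 0)"

definition facet :: "nat \<Rightarrow> (nat \<Rightarrow> nat \<Rightarrow> (nat \<Rightarrow> real) \<Rightarrow> real) \<Rightarrow> vertex list \<Rightarrow> (nat \<Rightarrow> real) \<Rightarrow> vertex \<Rightarrow> real" where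
  "facet L g t = restrict (row_sums L g t) (standard_simplex (length t - 1))"

lemma sum_skip:
  fixes G :: "nat \<Rightarrow> 'a::comm_monoid_add"
  assumes "k < q" "G k = 0"
  shows "(\<Sum>i<q. G i) = (\<Sum>i<q - 1. G (if i < k then i else Suc i))"
proof -
  have "(\<Sum>i<q. G i) = (\<Sum>i\<in>{..<q} - {k}. G i)"
    using assms by (simp add: sum.remove[of _ k])
  also have "\<dots> = (\<Sum>i<q - 1. G (if i < k then i else Suc i))"
    by (rule sum.reindex_bij_witness[where i = "\<lambda>i. if i < k then i else Suc i"
          and j = "\<lambda>j. if j < k then j else j - 1"]) (use assms(1) in \<open>auto split: if_splits\<close>)
  finally show ?thesis .
qed

lemma face_skip: "simplical_face k \<alpha> (if i < k then i else Suc i) = \<alpha> i"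
  by (simp add: simplical_face_def)

lemma point_delete:
  assumes "k < length t"
  shows "point (delete k t) \<alpha> = point t (simplical_face k \<alpha>)"
proof
  fix c
  have "point t (simplical_face k \<alpha>) c = (\<Sum>i<length t - 1.
      if fst (t ! (if i < k then i else Suc i)) = c then simplical_face k \<alpha> (if i < k then i else Suc i) else 0)"
    unfolding point_def by (rule sum_skip[OF assms]) (simp add: simplical_face_def)
  also have "\<dots> = point (delete k t) \<alpha> c"
    unfolding point_def length_delete[OF assms] face_skip
    by (intro sum.cong refl) (simp add: nth_delete[OF assms])
  finally show "point (delete k t) \<alpha> c = point t (simplical_face k \<alpha>) c" by simp
qed

lemma snd_rot_eq: "snd (rot r v) = snd w \<longleftrightarrow> snd v = snd (tor r w)"
proof -
  have "snd (rot r v) = snd w \<longleftrightarrow> rot r (0, snd v) = (0, snd w)" by (simp add: rot_def)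
  also have "\<dots> \<longleftrightarrow> (0, snd v) = tor r (0, snd w)" by (metis rot_tor tor_rot)
  also have "\<dots> \<longleftrightarrow> snd v = snd (tor r w)" by (simp add: tor_def)
  finally show ?thesis .
qed

lemma row_sums_rot: "row_sums L g (map (rot r) t) \<alpha> = row_sums L g t \<alpha> \<circ> tor r"
proof -
  have "point (map (rot r) t) \<alpha> = point t \<alpha>"
    by (auto simp: point_def fun_eq_iff intro!: sum.cong)
  then have "row_sums L g (map (rot r) t) \<alpha> v = row_sums L g t \<alpha> (tor r v)" for v
    unfolding row_sums_def using snd_rot_eq[of r _ v] by (simp cong: if_cong)
  then show ?thesis by (simp add: fun_eq_iff)
qed

lemma finite_rainbow: "finite (rainbow r L)"
proof (rule finite_subset)
  show "rainbow r L \<subseteq> {t. set t \<subseteq> {..L * (r - 1)} \<times> {..<r} \<and> length t \<le> Suc (L * (r - 1))}"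
  proof
    fix t assume t: "t \<in> rainbow r L"
    have "length t = card (set (map fst t))" using t distinct_card[of "map fst t"] by (simp add: rainbow_def)
    also have "\<dots> \<le> card {..L * (r - 1)}" using t by (intro card_mono) (auto simp: rainbow_def)
    finally show "t \<in> {t. set t \<subseteq> {..L * (r - 1)} \<times> {..<r} \<and> length t \<le> Suc (L * (r - 1))}"
      using t by (auto simp: rainbow_def)
  qed
  show "finite {t. set t \<subseteq> {..L * (r - 1)} \<times> {..<r} \<and> length t \<le> Suc (L * (r - 1))}"
    by (intro finite_lists_length_le) simp
qed

lemma point_in_simplex:
  assumes t: "t \<in> rainbow r L" "t \<noteq> []" and \<alpha>: "\<alpha> \<in> standard_simplex (length t - 1)"
  shows "point t \<alpha> \<in> standard_simplex (L * (r - 1))"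
proof -
  have a: "0 \<le> \<alpha> i" for i using \<alpha> by (simp add: standard_simplex_def)
  have "{..length t - 1} = {..<length t}" using t(2) by (cases t) auto
  then have s: "(\<Sum>i<length t. \<alpha> i) = 1" using \<alpha> by (simp add: standard_simplex_def)
  have le: "fst (t ! i) \<le> L * (r - 1)" if "i < length t" for i
    using t(1) nth_mem[OF that] by (auto simp: rainbow_def)
  have "0 \<le> point t \<alpha> c" for c unfolding point_def using a by (intro sum_nonneg) simp
  moreover have "point t \<alpha> c \<le> 1" for c
  proof -
    have "point t \<alpha> c \<le> (\<Sum>i<length t. \<alpha> i)" unfolding point_def by (rule sum_mono) (simp add: a)
    then show ?thesis using s by simp
  qed
  moreover have "point t \<alpha> c = 0" if "L * (r - 1) < c" for c
    unfolding point_def using le that by (intro sum.neutral) force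
  moreover have "(\<Sum>c\<le>L * (r - 1). point t \<alpha> c) = 1"
  proof -
    have "(\<Sum>c\<le>L * (r - 1). point t \<alpha> c) =
        (\<Sum>i<length t. \<Sum>c\<le>L * (r - 1). if fst (t ! i) = c then \<alpha> i else 0)"
      unfolding point_def by (rule sum.swap)
    also have "\<dots> = (\<Sum>i<length t. \<alpha> i)" using le by (intro sum.cong) simp_all
    finally show ?thesis using s by simp
  qed
  ultimately show ?thesis by (simp add: standard_simplex_def)
qed

lemma continuous_on_fun_apply: "continuous_on S (\<lambda>\<alpha> :: nat \<Rightarrow> real. \<alpha> i)"
  by (rule continuous_on_subset[OF continuous_on_product_coordinates]) simp

lemma continuous_on_point: "continuous_on S (point t)"
proof (rule continuous_on_coordinatewise_then_product)
  fix c
  have "continuous_on S (\<lambda>\<alpha>. if fst (t ! i) = c then \<alpha> i else 0)" for i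
    by (cases "fst (t ! i) = c") (simp_all add: continuous_on_fun_apply)
  then show "continuous_on S (\<lambda>\<alpha>. point t \<alpha> c)"
    unfolding point_def by (intro continuous_on_sum)
qed

text \<open>The situation to be refuted: every point of the rainbow complex has row sums that differ.\<close>

locale spread_facets =
  fixes r L :: nat and g :: "nat \<Rightarrow> nat \<Rightarrow> (nat \<Rightarrow> real) \<Rightarrow> real"
  assumes r: "prime r"
    and cont: "\<And>k c. k < L \<Longrightarrow> c \<le> L * (r - 1) \<Longrightarrow> continuous_on (standard_simplex (L * (r - 1))) (g k c)"
    and g_zero: "\<And>k c x. k < L \<Longrightarrow> c \<le> L * (r - 1) \<Longrightarrow> x \<in> standard_simplex (L * (r - 1)) \<Longrightarrow>
      x c = 0 \<Longrightarrow> g k c x = 0"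
    and spread: "\<And>t \<alpha>. t \<in> rainbow r L \<Longrightarrow> t \<noteq> [] \<Longrightarrow> \<alpha> \<in> standard_simplex (length t - 1) \<Longrightarrow>
      row_sums L g t \<alpha> \<in> spread r L"
begin

lemma singular_simplex_facet:
  assumes t: "t \<in> rainbow r L" "t \<noteq> []"
  shows "singular_simplex (length t - 1) (spread_top r L) (facet L g t)"
proof -
  let ?S = "standard_simplex (length t - 1)"
  have "continuous_on ?S (\<lambda>\<alpha>. row_sums L g t \<alpha> v)" for v
  proof (cases "fst v < L")
    case True
    have "continuous_on ?S (\<lambda>\<alpha>. if snd (t ! i) = snd v then g (fst v) (fst (t ! i)) (point t \<alpha>) else 0)"
      if "i < length t" for i
    proof -
      have "fst (t ! i) \<le> L * (r - 1)" using t(1) nth_mem[OF that] by (auto simp: rainbow_def)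
      then have "continuous_on ?S (\<lambda>\<alpha>. g (fst v) (fst (t ! i)) (point t \<alpha>))"
        using True point_in_simplex[OF t]
        by (intro continuous_on_compose2[OF cont continuous_on_point]) auto
      then show ?thesis by (cases "snd (t ! i) = snd v") simp_all
    qed
    then have "continuous_on ?S (\<lambda>\<alpha>. \<Sum>i<length t.
        if snd (t ! i) = snd v then g (fst v) (fst (t ! i)) (point t \<alpha>) else 0)"
      by (intro continuous_on_sum) blast
    then show ?thesis using True by (simp add: row_sums_def)
  qed (simp add: row_sums_def)
  then have "continuous_on ?S (row_sums L g t)" by (rule continuous_on_coordinatewise_then_product)
  then have "continuous_on ?S (facet L g t)" by (simp add: facet_def cong: continuous_on_cong)
  moreover have "facet L g t \<in> ?S \<rightarrow> spread r L" using spread[OF t] by (simp add: facet_def)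
  moreover have "facet L g t \<in> extensional ?S" by (simp add: facet_def)
  ultimately show ?thesis
    unfolding singular_simplex_def euclidean_product_topology by (auto simp: continuous_map_in_subtopology)
qed

text \<open>On the face that omits the vertex \<open>k\<close> the coordinate of its column is 0, so its summand is 0 as well.\<close>

lemma facet_delete:
  assumes t: "t \<in> rainbow r L" "length t = Suc (Suc p)" and k: "k < length t"
  shows "singular_face (Suc p) k (facet L g t) = facet L g (delete k t)"
proof
  fix \<alpha>
  have len: "length (delete k t) = Suc p" using k t by (simp add: length_delete)
  show "singular_face (Suc p) k (facet L g t) \<alpha> = facet L g (delete k t) \<alpha>"
  proof (cases "\<alpha> \<in> standard_simplex p")
    case True
    let ?\<beta> = "simplical_face k \<alpha>"
    have \<beta>: "?\<beta> \<in> standard_simplex (Suc p)"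
      using simplical_face_in_standard_simplex[of "Suc p" k \<alpha>] True k t by simp
    have x: "point t ?\<beta> \<in> standard_simplex (L * (r - 1))"
      using point_in_simplex[OF t(1)] \<beta> t(2) by (cases t) auto
    have "point t ?\<beta> (fst (t ! k)) = (\<Sum>i<length t. if i = k then ?\<beta> i else 0)"
      unfolding point_def
    proof (intro sum.cong refl)
      fix i assume "i \<in> {..<length t}"
      then have "fst (t ! i) = fst (t ! k) \<longleftrightarrow> i = k"
        using t(1) k nth_eq_iff_index_eq[of "map fst t" i k] by (simp add: rainbow_def)
      then show "(if fst (t ! i) = fst (t ! k) then ?\<beta> i else 0) = (if i = k then ?\<beta> i else 0)" by simp
    qed
    also have "\<dots> = 0" by (simp add: simplical_face_def)
    finally have zero: "point t ?\<beta> (fst (t ! k)) = 0" .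
    have le: "fst (t ! k) \<le> L * (r - 1)" using t(1) nth_mem[OF k] by (auto simp: rainbow_def)
    have "row_sums L g t ?\<beta> v = row_sums L g (delete k t) \<alpha> v" for v
    proof (cases "fst v < L")
      case True
      have "row_sums L g t ?\<beta> v = (\<Sum>i<length t. if snd (t ! i) = snd v then g (fst v) (fst (t ! i)) (point t ?\<beta>) else 0)"
        using True by (simp add: row_sums_def)
      also have "\<dots> = (\<Sum>i<length t - 1. if snd (t ! (if i < k then i else Suc i)) = snd v
          then g (fst v) (fst (t ! (if i < k then i else Suc i))) (point t ?\<beta>) else 0)"
        by (rule sum_skip[OF k]) (simp add: g_zero[OF True le x zero])
      also have "\<dots> = row_sums L g (delete k t) \<alpha> v"
        unfolding row_sums_def point_delete[OF k] length_delete[OF k] using True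
        by (simp only: if_True, intro sum.cong refl) (simp add: nth_delete[OF k])
      finally show ?thesis .
    qed (simp add: row_sums_def)
    then show ?thesis using True \<beta> t(2) len by (simp add: singular_face_def facet_def fun_eq_iff)
  qed (simp add: singular_face_def facet_def len)
qed

lemma facet_rot:
  assumes "t \<noteq> []"
  shows "facet L g (map (rot r) t) = simplex_map (length t - 1) (\<lambda>y. y \<circ> tor r) (facet L g t)"
  by (rule ext) (simp add: facet_def simplex_map_def row_sums_rot)

definition refined :: "nat \<Rightarrow> vertex list \<Rightarrow> (vertex \<Rightarrow> real) chain" where
  "refined N t = (singular_subdivision (length t - 1) ^^ N) (frag_of (facet L g t))"

text \<open>The chain map from the rainbow complex to the label complex: subdivide, then take labels.\<close>

definition combinatorial :: "nat \<Rightarrow> vertex list \<Rightarrow> vertex list \<Rightarrow> int" where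
  "combinatorial N t = (if t = [] then unit_fun else label_map r L (length t - 1) (refined N t))"

lemma singular_chain_iterate:
  "singular_chain p X c \<Longrightarrow> singular_chain p X ((singular_subdivision p ^^ N) c)"
  by (induction N) (simp_all add: singular_chain_singular_subdivision)

lemma chain_boundary_iterate:
  assumes "singular_chain p X c"
  shows "chain_boundary p ((singular_subdivision p ^^ N) c) = (singular_subdivision (p - Suc 0) ^^ N) (chain_boundary p c)"
proof (induction N)
  case (Suc N)
  have "chain_boundary p (singular_subdivision p ((singular_subdivision p ^^ N) c)) =
      singular_subdivision (p - Suc 0) (chain_boundary p ((singular_subdivision p ^^ N) c))"
    by (rule chain_boundary_singular_subdivision[OF singular_chain_iterate[OF assms]])
  then show ?case using Suc by simp
qed simp

lemma naturality_iterate: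
  assumes "singular_chain p X c"
  shows "(singular_subdivision p ^^ N) (chain_map p h c) = chain_map p h ((singular_subdivision p ^^ N) c)"
proof (induction N)
  case (Suc N)
  have "singular_subdivision p (chain_map p h ((singular_subdivision p ^^ N) c)) =
      chain_map p h (singular_subdivision p ((singular_subdivision p ^^ N) c))"
    by (rule naturality_singular_subdivision[OF singular_chain_iterate[OF assms]])
  then show ?case using Suc by simp
qed simp

lemma singular_chain_facet:
  assumes "t \<in> rainbow r L" "t \<noteq> []"
  shows "singular_chain (length t - 1) (spread_top r L) (frag_of (facet L g t))"
  using singular_simplex_facet[OF assms] by (simp add: singular_chain_of)

text \<open>Lebesgue's covering lemma; one number of subdivisions serves for the finitely many faces.\<close>

lemma small_refinement:
  "\<exists>N. \<forall>t\<in>rainbow r L. t \<noteq> [] \<longrightarrow> (\<forall>f\<in>keys (refined N t).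
    \<exists>z\<in>spread r L. f ` standard_simplex (length t - 1) \<subseteq> nbhd r L z)"
proof -
  have "\<exists>n. \<forall>m\<ge>n. \<forall>f\<in>keys (refined m t).
      \<exists>z\<in>spread r L. f ` standard_simplex (length t - 1) \<subseteq> nbhd r L z"
    if t: "t \<in> rainbow r L" "t \<noteq> []" for t
  proof (rule sufficient_iterated_singular_subdivision_exists[of "nbhd r L ` spread r L" "spread_top r L"
        "length t - 1" "frag_of (facet L g t)"])
    show "openin (spread_top r L) U" if "U \<in> nbhd r L ` spread r L" for U
      using that openin_nbhd by blast
    show "topspace (spread_top r L) \<subseteq> \<Union> (nbhd r L ` spread r L)" by (auto simp: nbhd_def)
    show "singular_chain (length t - 1) (spread_top r L) (frag_of (facet L g t))"
      by (rule singular_chain_facet[OF t])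
  qed (unfold refined_def, blast)
  then obtain n where n: "\<And>t m. t \<in> rainbow r L \<Longrightarrow> t \<noteq> [] \<Longrightarrow> n t \<le> m \<Longrightarrow>
      \<forall>f\<in>keys (refined m t). \<exists>z\<in>spread r L. f ` standard_simplex (length t - 1) \<subseteq> nbhd r L z"
    by metis
  have "n t \<le> Max (n ` rainbow r L)" if "t \<in> rainbow r L" for t
    using that finite_rainbow by (intro Max_ge) auto
  then show ?thesis using n by blast
qed

lemma combinatorial_bd:
  assumes t: "t \<in> rainbow r L"
  shows "alt_bd (labels r L) (combinatorial N t) = lin (combinatorial N) (list_bd t)"
proof -
  consider "t = []" | v where "t = [v]" | p where "length t = Suc (Suc p)"
    by (metis length_0_conv length_Suc_conv not0_implies_Suc)
  then show ?thesis
  proof cases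
    case 1
    then show ?thesis by (simp add: combinatorial_def alt_bd_def unit_fun_def fun_eq_iff)
  next
    case 2
    have sc: "singular_chain 0 (spread_top r L) (frag_of (facet L g t))"
      using singular_chain_facet[OF t] 2 by simp
    have "(singular_subdivision 0 ^^ N) (frag_of (facet L g t)) = frag_of (facet L g t)"
      by (induction N) (simp_all add: singular_subdivision_zero[OF sc])
    then have c: "combinatorial N t = oriented [peak_label r L (facet L g t (corner 0))]"
      using 2 by (simp add: combinatorial_def refined_def label_map_of corner_labels_def)
    have "facet L g t (corner 0) \<in> spread r L"
      using singular_simplex_spread[OF singular_simplex_facet[OF t], of "corner 0"] 2 corner_in[of 0 0] by simp
    then have "peak_label r L (facet L g t (corner 0)) \<in> labels r L"
      using peak_label_in unfolding peaks_def by blast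
    then have "alt_bd (labels r L) (combinatorial N t) l = unit_fun l" for l
      unfolding c by (subst alt_bd_oriented) simp_all
    moreover have "lin (combinatorial N) (list_bd t) = unit_fun"
      using 2 by (simp add: combinatorial_def)
    ultimately show ?thesis by (simp add: fun_eq_iff)
  next
    case (3 p)
    then have tn: "t \<noteq> []" by auto
    define \<psi> where "\<psi> u = label_map r L p ((singular_subdivision p ^^ N) (frag_extend (frag_of \<circ> facet L g) u))" for u
    have sc: "singular_chain (Suc p) (spread_top r L) (frag_of (facet L g t))"
      using singular_chain_facet[OF t tn] 3 by simp
    have "chain_boundary (Suc p) (frag_of (facet L g t)) =
        (\<Sum>k<length t. frag_cmul ((-1) ^ k) (frag_of (facet L g (delete k t))))"
      unfolding chain_boundary_of 3 lessThan_Suc_atMost using facet_delete[OF t 3]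
      by (simp only: nat.distinct if_False, intro sum.cong refl) (simp add: 3 less_Suc_eq_le)
    also have "\<dots> = frag_extend (frag_of \<circ> facet L g) (list_bd t)"
      unfolding list_bd_sum by (simp add: frag_extend_sum frag_extend_cmul comp_def)
    finally have "alt_bd (labels r L) (combinatorial N t) = \<psi> (list_bd t)"
      using label_map_boundary[OF singular_chain_iterate[OF sc], of N] chain_boundary_iterate[OF sc, of N] tn 3
      by (simp add: combinatorial_def refined_def \<psi>_def)
    also have "\<psi> (list_bd t) = lin (combinatorial N) (list_bd t)"
    proof (rule frag_hom_eq[where c = "list_bd t" and f = \<psi>])
      show "\<psi> (a - b) = \<psi> a - \<psi> b" for a b
        unfolding \<psi>_def frag_extend_diff singular_subdivision_power_diff label_map_diff ..
      show "lin (combinatorial N) (a - b) = lin (combinatorial N) a - lin (combinatorial N) b" for a b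
        by (rule lin_diff)
      fix s assume "s \<in> keys (list_bd t)"
      then obtain a v b where "t = a @ v # b" "s = a @ b" using keys_list_bd by blast
      then have "length s = Suc p" using 3 by simp
      then show "\<psi> (frag_of s) = lin (combinatorial N) (frag_of s)"
        by (auto simp: \<psi>_def combinatorial_def refined_def)
    qed
    finally show ?thesis .
  qed
qed

lemma combinatorial_rot:
  assumes t: "t \<in> rainbow r L"
  shows "combinatorial N (map (rot r) t) = alt_rot r 1 (combinatorial N t)"
proof (cases "t = []")
  case True
  then show ?thesis by (simp add: combinatorial_def alt_rot_1_unit)
next
  case False
  note sc = singular_chain_facet[OF t False]
  have "refined N (map (rot r) t) = chain_map (length t - 1) (\<lambda>y. y \<circ> tor r) (refined N t)"
    unfolding refined_def facet_rot[OF False] naturality_iterate[OF sc, symmetric] by simp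
  moreover have "singular_chain (length t - 1) (spread_top r L) (refined N t)"
    unfolding refined_def by (rule singular_chain_iterate[OF sc])
  ultimately show ?thesis using False label_map_rot[OF r] by (simp add: combinatorial_def)
qed

text \<open>Over the cycle of \<open>rainbow_ladder\<close> the single last column spans a cone. The image of the cone has degree \<open>L * (r - 1) + 1\<close>
and vanishes, so the image of the cycle is 0, although it has a ladder whose number is prime to \<open>r\<close>.\<close>

lemma contradiction: False
proof -
  let ?p = "r - 1" and ?T = "rainbow r L"
  obtain N where N: "\<And>t f. t \<in> ?T \<Longrightarrow> t \<noteq> [] \<Longrightarrow> f \<in> keys (refined N t) \<Longrightarrow>
    \<exists>z\<in>spread r L. f ` standard_simplex (length t - 1) \<subseteq> nbhd r L z"
    using small_refinement by blast
  define h where "h = lin (combinatorial N)"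
  define \<sigma> :: int where "\<sigma> = (if r = 2 then -1 else 1) ^ Suc L"
  have \<sigma>: "sign_ok r \<sigma>"
    by (cases "even L") (simp_all add: \<sigma>_def sign_ok_def)
  note ep = alt_chains_op_pair[OF r \<sigma>, of L]
  interpret exact_pair "alt_chains r L" "alt_bd (labels r L)" "\<lambda>x. x []" r
      "op_top r (alt_rot r \<sigma>)" "op_low r (alt_rot r \<sigma>)" by (rule ep)
  have comb: "combinatorial N t \<in> alt_chains r L (length t)" if t: "t \<in> ?T" for t
  proof (cases "t = []")
    case True
    have "unit_fun \<in> alt_chains r L 0"
      using alternating_oriented[of "[]"] proper_empty[OF prime_gt_0_nat[OF r]]
      by (auto simp: alt_chains_def unit_fun_def split: if_splits)
    then show ?thesis using True by (simp add: combinatorial_def)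
  next
    case False
    then show ?thesis using label_map_closed[OF r, of "refined N t" L "length t - 1"] N[OF t False]
      by (simp add: combinatorial_def)
  qed
  have h_closed: "h c \<in> alt_chains r L q" if "c \<in> list_chains ?T q" for c q
    unfolding h_def
  proof (rule lin_closed[OF zero_closed diff_closed])
    show "combinatorial N t \<in> alt_chains r L q" if "t \<in> keys c" for t
      using comb[of t] that \<open>c \<in> list_chains ?T q\<close> by (auto simp: list_chains_def)
  qed
  have h_bd: "h (chain_bd c) = alt_bd (labels r L) (h c)" if "c \<in> list_chains ?T q" for c q
  proof (rule frag_hom_eq[where c = c])
    show "h (chain_bd (a - b)) = h (chain_bd a) - h (chain_bd b)" for a b
      by (simp only: h_def chain_bd_diff lin_diff)
    show "alt_bd (labels r L) (h (a - b)) = alt_bd (labels r L) (h a) - alt_bd (labels r L) (h b)" for a b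
      by (simp only: h_def alt_bd_diff lin_diff)
    fix t assume "t \<in> keys c"
    then have "t \<in> ?T" using that by (auto simp: list_chains_def)
    then show "h (chain_bd (frag_of t)) = alt_bd (labels r L) (h (frag_of t))"
      using combinatorial_bd[of t N] by (simp add: h_def)
  qed
  have h_rot: "h (list_rot r \<sigma> c) = alt_rot r \<sigma> (h c)" if "c \<in> list_chains ?T q" for c q
  proof (rule frag_hom_eq[where c = c])
    show "h (list_rot r \<sigma> (a - b)) = h (list_rot r \<sigma> a) - h (list_rot r \<sigma> b)" for a b
      by (simp only: h_def list_rot_diff lin_diff)
    show "alt_rot r \<sigma> (h (a - b)) = alt_rot r \<sigma> (h a) - alt_rot r \<sigma> (h b)" for a b
      unfolding h_def lin_diff by (simp add: alt_rot_def fun_eq_iff algebra_simps)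
    fix t assume "t \<in> keys c"
    then have t: "t \<in> ?T" using that by (auto simp: list_chains_def)
    show "h (list_rot r \<sigma> (frag_of t)) = alt_rot r \<sigma> (h (frag_of t))"
    proof
      fix l
      show "h (list_rot r \<sigma> (frag_of t)) l = alt_rot r \<sigma> (h (frag_of t)) l"
        unfolding h_def list_rot_def lin_cmul rot_frag_simps lin_of combinatorial_rot[OF t]
        by (simp add: alt_rot_def)
    qed
  qed
  interpret src: exact_pair "list_chains ?T" chain_bd coeff_Nil r "op_top r (list_rot r \<sigma>)" "op_low r (list_rot r \<sigma>)"
    by (rule list_chains_op_pair[OF r \<sigma> simplicial_rainbow])
  have list_rot_closed: "list_rot r \<sigma> c \<in> list_chains ?T q" if "c \<in> list_chains ?T q" for c q
  proof -
    have "c - diff_op (list_rot r \<sigma>) c \<in> list_chains ?T q"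
      using that src.A_closed[OF that] src.B_closed[OF that] src.diff_closed[OF that]
      by (cases "r = 2") (auto simp: op_top_def op_low_def)
    then show ?thesis by (simp add: diff_op_def)
  qed
  have h_pow: "(list_rot r \<sigma> ^^ i) c \<in> list_chains ?T q \<and> h ((list_rot r \<sigma> ^^ i) c) = (alt_rot r \<sigma> ^^ i) (h c)"
    if "c \<in> list_chains ?T q" for c q i
    using that by (induction i) (auto simp: list_rot_closed h_rot)
  have h_add: "Modules.additive h" by (rule additiveI) (simp only: h_def lin_diff)
  have h_norm: "h (norm_op r (list_rot r \<sigma>) c) = norm_op r (alt_rot r \<sigma>) (h c)" if "c \<in> list_chains ?T q" for c q
    unfolding norm_op_def additive.sum[OF h_add] using h_pow[OF that] by simp
  have h_diff: "h (diff_op (list_rot r \<sigma>) c) = diff_op (alt_rot r \<sigma>) (h c)" if "c \<in> list_chains ?T q" for c q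
    unfolding diff_op_def additive.diff[OF h_add] using h_rot[OF that] by simp
  obtain M c where M: "M \<in> list_chains ?T (L * ?p)"
    "\<And>t v. t \<in> keys M \<Longrightarrow> v \<in> set t \<Longrightarrow> fst v < L * ?p" "chain_bd M = 0" "\<not> int r dvd c"
    "list_ladder ?T (op_top r (list_rot r \<sigma>)) (op_low r (list_rot r \<sigma>)) (L * ?p) M c"
    using rainbow_ladder[OF r order_refl[of L]] unfolding \<sigma>_def by metis
  have lad: "ladder (alt_chains r L) (alt_bd (labels r L)) (\<lambda>x. x []) (op_top r (alt_rot r \<sigma>))
      (op_low r (alt_rot r \<sigma>)) (L * ?p) (h M) c"
  proof (rule ladder_hom[OF M(5)])
    show "h x \<in> alt_chains r L q" if "x \<in> list_chains ?T q" for q x using h_closed[OF that] .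
    show "h (chain_bd x) = alt_bd (labels r L) (h x)" if "x \<in> list_chains ?T (Suc q)" for q x
      using h_bd[OF that] .
    show "h x [] = coeff_Nil x" if "x \<in> list_chains ?T 0" for x
    proof -
      have k: "keys x \<subseteq> {[]}" using that by (auto simp: list_chains_def)
      show ?thesis unfolding h_def lin_superset[OF _ k, simplified]
        by (simp add: combinatorial_def unit_fun_def)
    qed
    show "h (op_top r (list_rot r \<sigma>) x) = op_top r (alt_rot r \<sigma>) (h x)"
      "h (op_low r (list_rot r \<sigma>) x) = op_low r (alt_rot r \<sigma>) (h x)" if "x \<in> list_chains ?T q" for q x
      using h_norm[OF that] h_diff[OF that] by (cases "r = 2"; simp add: op_top_def op_low_def)+
  qed
  \<comment> \<open>The cone; any row would do for its apex.\<close>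
  define w where "w = cons_frag (L * ?p, 0) M"
  have wc: "w \<in> list_chains ?T (Suc (L * ?p))"
    unfolding list_chains_def
  proof (intro CollectI ballI)
    fix s assume "s \<in> keys w"
    then obtain t where t: "t \<in> keys M" "s = (L * ?p, 0) # t"
      using keys_cons_frag unfolding w_def by blast
    have tT: "t \<in> ?T" "length t = L * ?p" using M(1) t(1) by (auto simp: list_chains_def)
    have p0: "0 < ?p" using prime_gt_1_nat[OF r] by simp
    have col: "fst v < L * ?p" if "v \<in> set t" for v using M(2)[OF t(1) that] .
    have blk: "fst v div ?p < L" if "v \<in> set t" for v
      using col[OF that] p0 by (simp add: div_less_iff_less_mult)
    have new: "L * ?p div ?p = L" using p0 by simp
    have "L * ?p \<notin> fst ` set t" by (auto dest: col)
    then have "distinct (map fst s)" using tT(1) t(2) by (simp add: rainbow_def)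
    moreover have "\<forall>v\<in>set s. fst v \<le> L * ?p \<and> snd v < r"
      using tT(1) prime_gt_0_nat[OF r] unfolding t(2) by (simp add: rainbow_def)
    moreover have "v = u" if vu: "v \<in> set s" "u \<in> set s" "fst v div ?p = fst u div ?p" "snd v = snd u" for v u
    proof -
      have old: "v \<in> set t \<Longrightarrow> u \<in> set t \<Longrightarrow> v = u"
        using tT(1) vu(3,4) unfolding rainbow_def by blast
      consider "v = (L * ?p, 0)" "u = (L * ?p, 0)" | "v = (L * ?p, 0)" "u \<in> set t"
        | "v \<in> set t" "u = (L * ?p, 0)" | "v \<in> set t" "u \<in> set t"
        using vu(1,2) unfolding t(2) set_simps by blast
      then show ?thesis
      proof cases
        case 2
        then show ?thesis using vu(3) blk[of u] new by (metis fst_conv less_irrefl)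
      next
        case 3
        then show ?thesis using vu(3) blk[of v] new by (metis fst_conv less_irrefl)
      qed (use old in blast)+
    qed
    ultimately have "s \<in> ?T" unfolding rainbow_def by blast
    then show "s \<in> ?T \<and> length s = Suc (L * ?p)" using t(2) tT(2) by simp
  qed
  have "h w = 0" by (rule alt_chains_top[OF h_closed[OF wc]]) simp
  moreover have "h (chain_bd w) = alt_bd (labels r L) (h w)" by (rule h_bd[OF wc])
  moreover have "chain_bd w = M" unfolding w_def chain_bd_cons M(3) by simp
  ultimately have "h M = alt_bd (labels r L) 0" by simp
  then have hM: "h M = 0" by (simp add: alt_bd_def fun_eq_iff)
  have "alt_bd (labels r L) 0 = 0" by (simp add: alt_bd_def fun_eq_iff)
  moreover have "op_top r (alt_rot r \<sigma>) 0 = 0" using A_diff[of 0 0] by simp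
  ultimately have "h M = op_top r (alt_rot r \<sigma>) (alt_bd (labels r L) 0)" using hM by (simp only:)
  then have "int r dvd c" by (rule ladder_of_boundary[OF lad ep zero_closed])
  then show False using M(4) by blast
qed

end

text \<open>The topological core: balanced sums exist for arbitrary continuous summands that vanish together with the
coordinate of their column. The set \<open>R\<close> assigns rows to all columns with nonzero coordinate.\<close>

theorem balanced_rainbow_point:
  fixes r L :: nat and g :: "nat \<Rightarrow> nat \<Rightarrow> (nat \<Rightarrow> real) \<Rightarrow> real"
  assumes r: "prime r"
    and cont: "\<And>k c. k < L \<Longrightarrow> c \<le> L * (r - 1) \<Longrightarrow> continuous_on (standard_simplex (L * (r - 1))) (g k c)"
    and g_zero: "\<And>k c x. k < L \<Longrightarrow> c \<le> L * (r - 1) \<Longrightarrow> x \<in> standard_simplex (L * (r - 1)) \<Longrightarrow>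
      x c = 0 \<Longrightarrow> g k c x = 0"
  obtains x R where "x \<in> standard_simplex (L * (r - 1))" "R \<subseteq> {..L * (r - 1)} \<times> {..<r}" "inj_on fst R"
    "\<forall>v\<in>R. \<forall>w\<in>R. fst v div (r - 1) = fst w div (r - 1) \<and> snd v = snd w \<longrightarrow> v = w"
    "\<forall>c. x c \<noteq> 0 \<longrightarrow> c \<in> fst ` R"
    "\<forall>k<L. \<forall>s<r. \<forall>s'<r. (\<Sum>v | v \<in> R \<and> snd v = s. g k (fst v) x) = (\<Sum>v | v \<in> R \<and> snd v = s'. g k (fst v) x)"
proof -
  have "\<not> spread_facets r L g" using spread_facets.contradiction by blast
  then obtain t \<alpha> where t: "t \<in> rainbow r L" "t \<noteq> []" "\<alpha> \<in> standard_simplex (length t - 1)"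
    and flat: "row_sums L g t \<alpha> \<notin> spread r L"
    unfolding spread_facets_def using assms by blast
  let ?x = "point t \<alpha>" and ?R = "set t"
  have dist: "distinct (map fst t)" using t by (simp add: rainbow_def)
  have rs: "row_sums L g t \<alpha> (k, s) = (\<Sum>v | v \<in> ?R \<and> snd v = s. g k (fst v) ?x)" if "k < L" for k s
  proof -
    have "row_sums L g t \<alpha> (k, s) = (\<Sum>i<length t. (\<lambda>v. if snd v = s then g k (fst v) ?x else 0) (t ! i))"
      using that by (simp add: row_sums_def cong: if_cong)
    also have "\<dots> = (\<Sum>v\<in>?R. if snd v = s then g k (fst v) ?x else 0)"
      using dist by (intro sum.reindex_bij_betw bij_betw_nth) (auto simp: distinct_map)
    also have "\<dots> = (\<Sum>v | v \<in> ?R \<and> snd v = s. g k (fst v) ?x)"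
      by (simp add: sum.inter_filter)
    finally show ?thesis .
  qed
  have supp: "c \<in> fst ` ?R" if "?x c \<noteq> 0" for c
  proof (rule ccontr)
    assume "c \<notin> fst ` ?R"
    then have "fst (t ! i) \<noteq> c" if "i < length t" for i using that by (metis image_eqI nth_mem)
    then have "?x c = 0" unfolding point_def by (intro sum.neutral) simp
    then show False using that by blast
  qed
  show ?thesis
  proof (rule that[of ?x ?R]; (intro allI impI)?)
    show "?x \<in> standard_simplex (L * (r - 1))" by (rule point_in_simplex[OF t])
    show "?R \<subseteq> {..L * (r - 1)} \<times> {..<r}" using t(1) by (auto simp: rainbow_def)
    show "inj_on fst ?R" using dist by (simp add: distinct_map)
    show "\<forall>v\<in>?R. \<forall>w\<in>?R. fst v div (r - 1) = fst w div (r - 1) \<and> snd v = snd w \<longrightarrow> v = w"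
      using t(1) unfolding rainbow_def by blast
    show "c \<in> fst ` ?R" if "?x c \<noteq> 0" for c using supp that .
    fix k s s' assume "k < L" "s < r" "s' < r"
    then have "row_sums L g t \<alpha> (k, s) = row_sums L g t \<alpha> (k, s')"
      using flat unfolding spread_def labels_def by fastforce
    then show "(\<Sum>v | v \<in> ?R \<and> snd v = s. g k (fst v) ?x) = (\<Sum>v | v \<in> ?R \<and> snd v = s'. g k (fst v) ?x)"
      using rs[OF \<open>k < L\<close>] by simp
  qed
qed

section \<open>Classes of arbitrary size\<close>

lemma extend_injection:
  assumes "finite C" "finite Y" "card C \<le> card Y" "A \<subseteq> C" "inj_on \<phi> A" "\<phi> ` A \<subseteq> Y"
  shows "\<exists>\<psi>. inj_on \<psi> C \<and> \<psi> ` C \<subseteq> Y \<and> (\<forall>a\<in>A. \<psi> a = \<phi> a)"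
proof -
  have "finite A" using assms by (meson finite_subset)
  then have "card (C - A) \<le> card (Y - \<phi> ` A)"
    using assms by (simp add: card_Diff_subset card_image)
  then obtain h where h: "h ` (C - A) \<subseteq> Y - \<phi> ` A" "inj_on h (C - A)"
    using card_le_inj[of "C - A" "Y - \<phi> ` A"] assms by auto
  let ?\<psi> = "\<lambda>a. if a \<in> A then \<phi> a else h a"
  have "inj_on ?\<psi> C"
  proof (rule inj_onI)
    fix a b assume ab: "a \<in> C" "b \<in> C" "?\<psi> a = ?\<psi> b"
    have ne: "\<phi> u \<noteq> h v" if "u \<in> A" "v \<in> C - A" for u v using h(1) that by blast
    show "a = b"
    proof (cases "a \<in> A"; cases "b \<in> A")
      assume "a \<in> A" "b \<in> A"
      then show ?thesis using ab assms(5) by (simp add: inj_on_eq_iff)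
    next
      assume "a \<in> A" "b \<notin> A"
      then show ?thesis using ab ne[of a b] by simp
    next
      assume "a \<notin> A" "b \<in> A"
      then show ?thesis using ab ne[of b a] by simp
    next
      assume "a \<notin> A" "b \<notin> A"
      then show ?thesis using ab h(2) by (simp add: inj_on_eq_iff)
    qed
  qed
  moreover have "?\<psi> ` C \<subseteq> Y" using h(1) assms(6) by auto
  ultimately show ?thesis by (intro exI[of _ ?\<psi>]) simp
qed

text \<open>The columns of the enlarged problem. Column \<open>e j\<close> carries the piece \<open>j\<close>, and the block of \<open>e j\<close> is the class
of \<open>j\<close>. There are \<open>(l - m) * p\<close> further columns, and \<open>b\<close> numbers them so that they fall into \<open>l - m\<close>
groups of \<open>p\<close>.\<close>

lemma padding:
  assumes part: "partition_into l C {1..n+1}" and card: "\<And>i. i \<in> {1..l} \<Longrightarrow> card (C i) \<le> p"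
    and p: "0 < p" and n: "n = p * m"
  obtains e b cl where "m < l" "inj_on e {1..n+1}" "\<And>j. j \<in> {1..n+1} \<Longrightarrow> e j < l * p"
    "\<And>i j. i \<in> {1..l} \<Longrightarrow> j \<in> C i \<Longrightarrow> e j div p = i - 1"
    "bij_betw b ({..l * p} - e ` {1..n+1}) {..<(l - m) * p}"
    "\<And>j. j \<in> {1..n+1} \<Longrightarrow> cl j \<in> {1..l} \<and> j \<in> C (cl j)"
    "\<And>i j. i \<in> {1..l} \<Longrightarrow> j \<in> C i \<Longrightarrow> cl j = i"
proof -
  have disj: "disjoint_family_on C {1..l}" and un: "(\<Union>i\<in>{1..l}. C i) = {1..n+1}"
    using part by (auto simp: partition_into_def)
  have fin: "finite (C i)" if "i \<in> {1..l}" for i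
    using un that by (metis UN_upper finite_atLeastAtMost finite_subset)
  have "\<exists>h. h ` C i \<subseteq> {..<p} \<and> inj_on h (C i)" if "i \<in> {1..l}" for i
    using card_le_inj[OF fin[OF that], of "{..<p}"] card[OF that] by auto
  then obtain h where h: "\<And>i. i \<in> {1..l} \<Longrightarrow> h i ` C i \<subseteq> {..<p} \<and> inj_on (h i) (C i)" by metis
  have "\<forall>j\<in>{1..n+1}. \<exists>i\<in>{1..l}. j \<in> C i" using un by blast
  then obtain cl where cl: "\<And>j. j \<in> {1..n+1} \<Longrightarrow> cl j \<in> {1..l} \<and> j \<in> C (cl j)" by metis
  have cl_eq: "cl j = i" if "i \<in> {1..l}" "j \<in> C i" for i j
  proof (rule ccontr)
    assume "cl j \<noteq> i"
    have "j \<in> {1..n+1}" using un that by blast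
    then show False using cl[of j] that disj \<open>cl j \<noteq> i\<close> unfolding disjoint_family_on_def by blast
  qed
  define e where "e j = (cl j - 1) * p + h (cl j) j" for j
  have hb: "h (cl j) j < p" if "j \<in> {1..n+1}" for j using h[of "cl j"] cl[OF that] by blast
  have ed: "e j div p = cl j - 1" if "j \<in> {1..n+1}" for j
    using hb[OF that] p by (simp add: e_def)
  have em: "e j mod p = h (cl j) j" if "j \<in> {1..n+1}" for j
    using hb[OF that] p by (simp add: e_def)
  have inj: "inj_on e {1..n+1}"
  proof (rule inj_onI)
    fix j j' assume j: "j \<in> {1..n+1}" "j' \<in> {1..n+1}" "e j = e j'"
    then have "cl j - 1 = cl j' - 1" using ed by metis
    moreover have "1 \<le> cl j" "1 \<le> cl j'" using cl j by (meson atLeastAtMost_iff)+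
    ultimately have c: "cl j = cl j'" by linarith
    then have "h (cl j) j = h (cl j) j'" using em j by metis
    then show "j = j'" using h[of "cl j"] cl[OF j(1)] cl[OF j(2)] c by (metis inj_onD)
  qed
  have lt: "e j < l * p" if j: "j \<in> {1..n+1}" for j
  proof -
    have "e j div p < l" using ed[OF j] cl[OF j] by auto
    then show ?thesis using p by (simp add: div_less_iff_less_mult)
  qed
  have "e ` {1..n+1} \<subseteq> {..<l * p}" using lt by auto
  then have "card (e ` {1..n+1}) \<le> card {..<l * p}" by (intro card_mono) auto
  moreover have ce: "card (e ` {1..n+1}) = n + 1" using inj by (simp add: card_image)
  ultimately have "n + 1 \<le> l * p" by simp
  then have "p * m < l * p" using n by linarith
  then have ml: "m < l" using p by (simp add: mult.commute)
  have "card ({..l * p} - e ` {1..n+1}) = Suc (l * p) - (n + 1)"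
    using lt ce by (subst card_Diff_subset) (auto intro: less_imp_le)
  also have "\<dots> = card {..<(l - m) * p}" using n by (simp add: diff_mult_distrib mult.commute[of p])
  finally have "\<exists>b. bij_betw b ({..l * p} - e ` {1..n+1}) {..<(l - m) * p}"
    by (intro finite_same_card_bij) auto
  then obtain b where b: "bij_betw b ({..l * p} - e ` {1..n+1}) {..<(l - m) * p}" by blast
  show thesis
  proof (rule that[OF ml inj lt _ b cl cl_eq])
    fix i j assume "i \<in> {1..l}" "j \<in> C i"
    moreover from this have "j \<in> {1..n+1}" using un by blast
    ultimately show "e j div p = i - 1" using ed cl_eq by metis
  qed
qed

theorem theorem4p1:
  fixes f :: "nat \<Rightarrow> real \<Rightarrow> real"
    and m r n l :: nat
    and C :: "nat \<Rightarrow> nat set"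
  assumes "\<And>k. k \<in> {1..m} \<Longrightarrow> continuous_on {0..1} (f k)"
    and "prime r"
    and "n = (r - 1) * m"
    and "partition_into l C {1..n+1}"
    and "\<And>i. i \<in> {1..l} \<Longrightarrow> card (C i) \<le> r - 1"
  shows "\<exists>(t :: nat \<Rightarrow> real) (T :: nat \<Rightarrow> nat set).
           t 0 = 0 \<and> t (n+1) = 1 \<and> (\<forall>j\<in>{1..n+1}. t (j - 1) \<le> t j) \<and>
           partition_into r T {1..n+1} \<and>
           (\<forall>i\<in>{1..l}. \<forall>j\<in>{1..r}. card (C i \<inter> T j) \<le> 1) \<and>
           (\<forall>k\<in>{1..m}. \<forall>a\<in>{1..r}. \<forall>b\<in>{1..r}.
              (\<Sum>j\<in>T a. f k (t j) - f k (t (j - 1))) = (\<Sum>j\<in>T b. f k (t j) - f k (t (j - 1))))"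
proof -
  let ?p = "r - 1"
  let ?S = "standard_simplex (l * ?p)"
  have p0: "0 < ?p" using prime_gt_1_nat[OF assms(2)] by simp
  obtain e b cl where ml: "m < l" and e_inj: "inj_on e {1..n+1}"
    and e_less: "\<And>j. j \<in> {1..n+1} \<Longrightarrow> e j < l * ?p"
    and e_div: "\<And>i j. i \<in> {1..l} \<Longrightarrow> j \<in> C i \<Longrightarrow> e j div ?p = i - 1"
    and b: "bij_betw b ({..l * ?p} - e ` {1..n+1}) {..<(l - m) * ?p}"
    and cl: "\<And>j. j \<in> {1..n+1} \<Longrightarrow> cl j \<in> {1..l} \<and> j \<in> C (cl j)"
    and cl_eq: "\<And>i j. i \<in> {1..l} \<Longrightarrow> j \<in> C i \<Longrightarrow> cl j = i"
    using padding[OF assms(4,5) p0 assms(3)] by blast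
  define X where "X = {..l * ?p} - e ` {1..n+1}"
  define \<tau> where "\<tau> x j = (\<Sum>i\<in>{1..j}. x (e i))" for x :: "nat \<Rightarrow> real" and j
  define inv_e where "inv_e = the_inv_into {1..n+1} e"
  have inv_e: "inv_e (e j) = j" if "j \<in> {1..n+1}" for j
    unfolding inv_e_def using the_inv_into_f_f[OF e_inj that] .
  \<comment> \<open>The families below \<open>m\<close> are the given functions; family \<open>m + i\<close> consists of the coordinates of the
    \<open>i\<close>-th group of added columns.\<close>
  define g where "g k c x = (if k < m then
      (if c \<in> e ` {1..n+1} then f (k+1) (\<tau> x (inv_e c)) - f (k+1) (\<tau> x (inv_e c - 1)) else 0)
      else (if c \<in> X \<and> b c div ?p = k - m then x c else 0))" for k c x
  have simplex: "0 \<le> x c" "(\<Sum>c\<le>l * ?p. x c) = 1" if "x \<in> ?S" for x c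
    using that by (auto simp: standard_simplex_def)
  have e_le: "(\<Sum>j\<in>J. x (e j)) \<le> 1" if x: "x \<in> ?S" and J: "J \<subseteq> {1..n+1}" for x J
  proof -
    have "(\<Sum>j\<in>J. x (e j)) = sum x (e ` J)"
      using inj_on_subset[OF e_inj J] by (simp add: sum.reindex)
    also have "\<dots> \<le> (\<Sum>c\<le>l * ?p. x c)"
    proof (rule sum_mono2)
      have "e j < l * ?p" if "j \<in> J" for j using e_less[of j] J that by blast
      then show "e ` J \<subseteq> {..l * ?p}" by (simp add: image_subset_iff less_imp_le)
    qed (use simplex(1)[OF x] in auto)
    finally show ?thesis using simplex(2)[OF x] by simp
  qed
  have \<tau>_range: "\<tau> x j \<in> {0..1}" if x: "x \<in> ?S" and j: "j \<le> n + 1" for x j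
    using e_le[OF x, of "{1..j}"] simplex(1)[OF x] j by (auto simp: \<tau>_def intro: sum_nonneg)
  have \<tau>_step: "\<tau> x j = \<tau> x (j - 1) + x (e j)" if "1 \<le> j" for x j
    using that by (cases j) (simp_all add: \<tau>_def)
  have \<tau>_cont: "continuous_on A (\<lambda>x. \<tau> x j)" for A j
    unfolding \<tau>_def by (intro continuous_on_sum continuous_on_fun_apply)
  have g_cont: "continuous_on ?S (g k c)" if "k < l" "c \<le> l * ?p" for k c
  proof (cases "k < m \<and> c \<in> e ` {1..n+1}")
    case True
    then obtain j where j: "j \<in> {1..n+1}" "c = e j" by blast
    have fk: "continuous_on {0..1} (f (k+1))" using True assms(1)[of "k+1"] by simp
    have "continuous_on ?S (\<lambda>x. f (k+1) (\<tau> x j) - f (k+1) (\<tau> x (j - 1)))"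
      using \<tau>_range j by (intro continuous_on_diff continuous_on_compose2[OF fk \<tau>_cont]) auto
    then show ?thesis using True j inv_e by (simp add: g_def[abs_def])
  next
    case False
    have "continuous_on ?S (\<lambda>x. if c \<in> X \<and> b c div ?p = k - m then x c else 0)"
      by (cases "c \<in> X \<and> b c div ?p = k - m")
        (simp_all only: if_True if_False simp_thms continuous_on_fun_apply continuous_on_const)
    then show ?thesis using False by (cases "k < m") (simp_all add: g_def[abs_def])
  qed
  have g_zero: "g k c x = 0" if "x c = 0" for k c x
  proof -
    have "\<tau> x (inv_e c) = \<tau> x (inv_e c - 1)" if "c \<in> e ` {1..n+1}"
      using that inv_e \<tau>_step[of _ x] \<open>x c = 0\<close> by auto
    then show ?thesis using that by (simp add: g_def)
  qed
  obtain x R where x: "x \<in> ?S" and R: "R \<subseteq> {..l * ?p} \<times> {..<r}" "inj_on fst R"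
    "\<forall>v\<in>R. \<forall>w\<in>R. fst v div ?p = fst w div ?p \<and> snd v = snd w \<longrightarrow> v = w"
    "\<forall>c. x c \<noteq> 0 \<longrightarrow> c \<in> fst ` R"
    and bal: "\<forall>k<l. \<forall>s<r. \<forall>s'<r. (\<Sum>v | v \<in> R \<and> snd v = s. g k (fst v) x) = (\<Sum>v | v \<in> R \<and> snd v = s'. g k (fst v) x)"
    by (rule balanced_rainbow_point[OF assms(2) g_cont g_zero])
  have finR: "finite R" using R(1) by (rule finite_subset) simp
  \<comment> \<open>A group of added columns has at most \<open>r - 1\<close> elements, so some row \<open>s\<close> meets none of them.\<close>
  have X_zero: "x c = 0" if c: "c \<in> X" for c
  proof (rule ccontr)
    assume nz: "x c \<noteq> 0"
    define k where "k = m + b c div ?p"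
    define G where "G = {c \<in> X. b c div ?p = k - m}"
    have bX: "inj_on b X" "b ` X = {..<(l - m) * ?p}" using b by (auto simp: bij_betw_def X_def)
    have "b c < (l - m) * ?p" using bX(2) c by blast
    then have "b c div ?p < l - m" using p0 by (simp add: div_less_iff_less_mult)
    then have kl: "k < l" unfolding k_def by linarith
    have gk: "g k c' x = (if c' \<in> G then x c' else 0)" for c'
      by (simp add: g_def k_def G_def)
    have "b ` G \<subseteq> {(k - m) * ?p..<(k - m) * ?p + ?p}"
    proof
      fix y assume "y \<in> b ` G"
      then have "y div ?p = k - m" by (auto simp: G_def)
      then have "y = (k - m) * ?p + y mod ?p" using div_mult_mod_eq[of y ?p] by simp
      moreover have "y mod ?p < ?p" using p0 by simp
      ultimately show "y \<in> {(k - m) * ?p..<(k - m) * ?p + ?p}" by (metis atLeastLessThan_iff le_add1 nat_add_left_cancel_less)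
    qed
    then have "card (b ` G) \<le> ?p" using card_mono[of "{(k - m) * ?p..<(k - m) * ?p + ?p}" "b ` G"] by simp
    moreover have "inj_on b G" using bX(1) by (rule inj_on_subset) (auto simp: G_def)
    ultimately have cG: "card G \<le> ?p" by (simp add: card_image)
    have finG: "finite G" by (auto simp: G_def X_def)
    define RG where "RG = {v \<in> R. fst v \<in> G}"
    have "card (snd ` RG) \<le> card RG" using finR by (intro card_image_le) (simp add: RG_def)
    also have "card RG = card (fst ` RG)" using R(2) by (intro card_image[symmetric]) (auto simp: RG_def inj_on_def)
    also have "\<dots> \<le> card G" using finG by (intro card_mono) (auto simp: RG_def)
    finally have "card (snd ` RG) < card {..<r}" using cG p0 by simp
    then obtain s where s: "s < r" "s \<notin> snd ` RG"
      using card_mono[of "snd ` RG" "{..<r}"] finR by (fastforce simp: RG_def)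
    have at_s: "(\<Sum>v | v \<in> R \<and> snd v = s. g k (fst v) x) = 0"
    proof (intro sum.neutral ballI)
      fix v assume v: "v \<in> {v. v \<in> R \<and> snd v = s}"
      have "fst v \<notin> G"
      proof
        assume "fst v \<in> G"
        then have "v \<in> RG" using v by (simp add: RG_def)
        then show False using s(2) v by blast
      qed
      then show "g k (fst v) x = 0" by (simp add: gk)
    qed
    have zero: "(\<Sum>v | v \<in> R \<and> snd v = s'. g k (fst v) x) = 0" if "s' < r" for s'
      by (rule trans[OF bal[rule_format, OF kl that s(1)] at_s])
    have "c \<in> fst ` R" using R(4) nz by blast
    then obtain v where v: "v \<in> R" "fst v = c" by blast
    have "snd v < r" using R(1) v(1) by auto
    then have "\<forall>w\<in>{w. w \<in> R \<and> snd w = snd v}. g k (fst w) x = 0"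
      using zero[of "snd v"] finR simplex(1)[OF x]
      by (subst (asm) sum_nonneg_eq_0_iff) (auto simp: gk)
    then have "g k c x = 0" using v by auto
    moreover have "c \<in> G" using c by (simp add: G_def k_def)
    ultimately show False using nz gk[of c] by simp
  qed
  have fine: "finite (C i)" if "i \<in> {1..l}" for i
    using assms(4) that unfolding partition_into_def by (metis UN_upper finite_atLeastAtMost finite_subset)
  have CI: "C i \<subseteq> {1..n+1}" if "i \<in> {1..l}" for i
    using assms(4) that unfolding partition_into_def by blast
  define rw where "rw j = (SOME s. (e j, s) \<in> R)" for j
  have rw: "(e j, rw j) \<in> R" if ej: "e j \<in> fst ` R" for j
  proof -
    obtain v where "v \<in> R" "fst v = e j" using ej by (metis imageE)
    then have "(e j, snd v) \<in> R" by (metis prod.collapse)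
    then show ?thesis unfolding rw_def by (rule someI)
  qed
  have rw_eq: "rw j = s" if "(e j, s) \<in> R" for j s
  proof -
    have "(e j, rw j) \<in> R" using rw that by force
    then show ?thesis using inj_onD[OF R(2) _ _ that] by auto
  qed
  have "\<exists>\<psi>. inj_on \<psi> (C i) \<and> \<psi> ` C i \<subseteq> {..<r} \<and> (\<forall>j\<in>{j \<in> C i. e j \<in> fst ` R}. \<psi> j = rw j)"
    if i: "i \<in> {1..l}" for i
  proof (rule extend_injection[OF fine[OF i]])
    show "card (C i) \<le> card {..<r}" using assms(5)[OF i] by simp
    show "rw ` {j \<in> C i. e j \<in> fst ` R} \<subseteq> {..<r}" using rw R(1) by fastforce
    show "inj_on rw {j \<in> C i. e j \<in> fst ` R}"
    proof (rule inj_onI)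
      fix j j' assume j: "j \<in> {j \<in> C i. e j \<in> fst ` R}" "j' \<in> {j \<in> C i. e j \<in> fst ` R}" "rw j = rw j'"
      have "(e j, rw j) = (e j', rw j')"
      proof (rule R(3)[rule_format])
        show "(e j, rw j) \<in> R" "(e j', rw j') \<in> R" using rw j by blast+
        show "fst (e j, rw j) div ?p = fst (e j', rw j') div ?p \<and> snd (e j, rw j) = snd (e j', rw j')"
          using j e_div[OF i, of j] e_div[OF i, of j'] by simp
      qed
      moreover have "j \<in> {1..n+1}" "j' \<in> {1..n+1}" using j CI[OF i] by auto
      ultimately show "j = j'" using e_inj by (auto dest: inj_onD)
    qed
  qed auto
  then obtain \<psi> where \<psi>: "\<And>i. i \<in> {1..l} \<Longrightarrow> inj_on (\<psi> i) (C i) \<and> \<psi> i ` C i \<subseteq> {..<r} \<and>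
      (\<forall>j\<in>{j \<in> C i. e j \<in> fst ` R}. \<psi> i j = rw j)"
    by metis
  \<comment> \<open>Pieces of length 0 need not occur in \<open>R\<close>; they are distributed within their class.\<close>
  define part where "part j = \<psi> (cl j) j" for j
  have part_less: "part j < r" if "j \<in> {1..n+1}" for j
    using \<psi>[of "cl j"] cl[OF that] unfolding part_def by blast
  have part_rw: "part j = rw j" if "j \<in> {1..n+1}" "e j \<in> fst ` R" for j
    using \<psi>[of "cl j"] cl[OF that(1)] that(2) unfolding part_def by blast
  define T where "T a = {j \<in> {1..n+1}. part j = a - 1}" for a
  have sums: "(\<Sum>j\<in>T a. f k (\<tau> x j) - f k (\<tau> x (j - 1))) = (\<Sum>v | v \<in> R \<and> snd v = a - 1. g (k - 1) (fst v) x)"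
    if k: "k \<in> {1..m}" and a: "a \<in> {1..r}" for k a
  proof -
    let ?D = "\<lambda>j. f k (\<tau> x j) - f k (\<tau> x (j - 1))"
    have "(\<Sum>j\<in>T a. ?D j) = (\<Sum>j\<in>{j \<in> T a. e j \<in> fst ` R}. ?D j)"
    proof (rule sum.mono_neutral_right)
      show "\<forall>j\<in>T a - {j \<in> T a. e j \<in> fst ` R}. ?D j = 0"
      proof
        fix j assume j: "j \<in> T a - {j \<in> T a. e j \<in> fst ` R}"
        then have "x (e j) = 0" using R(4) by blast
        moreover have "1 \<le> j" using j by (auto simp: T_def)
        ultimately show "?D j = 0" using \<tau>_step[of j x] by simp
      qed
    qed (auto simp: T_def)
    also have "\<dots> = (\<Sum>v\<in>{v. v \<in> R \<and> snd v = a - 1 \<and> fst v \<in> e ` {1..n+1}}. g (k - 1) (fst v) x)"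
    proof (rule sum.reindex_bij_witness[where i = "\<lambda>v. inv_e (fst v)" and j = "\<lambda>j. (e j, a - 1)"])
      fix j assume j: "j \<in> {j \<in> T a. e j \<in> fst ` R}"
      then have jn: "j \<in> {1..n+1}" and "part j = a - 1" by (auto simp: T_def)
      then have "(e j, a - 1) \<in> R" using rw[of j] part_rw[OF jn] j by simp
      then show "(e j, a - 1) \<in> {v. v \<in> R \<and> snd v = a - 1 \<and> fst v \<in> e ` {1..n+1}}" using jn by simp
      show "inv_e (fst (e j, a - 1)) = j" using inv_e[OF jn] by simp
      show "g (k - 1) (fst (e j, a - 1)) x = ?D j" using k jn inv_e[OF jn] by (auto simp: g_def)
    next
      fix v assume v: "v \<in> {v. v \<in> R \<and> snd v = a - 1 \<and> fst v \<in> e ` {1..n+1}}"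
      then obtain j where j: "j \<in> {1..n+1}" "fst v = e j" by blast
      then have vj: "v = (e j, a - 1)" using v by (simp add: prod_eq_iff)
      then have "part j = a - 1" using v part_rw[OF j(1)] rw_eq[of j "a - 1"] by force
      then show "inv_e (fst v) \<in> {j \<in> T a. e j \<in> fst ` R}"
        using j v inv_e[OF j(1)] by (auto simp: T_def image_iff intro: bexI[of _ v])
      show "(e (inv_e (fst v)), a - 1) = v" using vj inv_e[OF j(1)] by simp
    qed
    also have "\<dots> = (\<Sum>v | v \<in> R \<and> snd v = a - 1. g (k - 1) (fst v) x)"
    proof (rule sum.mono_neutral_left)
      show "finite {v. v \<in> R \<and> snd v = a - 1}" using finR by simp
      have km: "k - 1 < m" using k by auto
      have "g (k - 1) c x = 0" if "c \<notin> e ` {1..n+1}" for c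
        unfolding g_def using km that by (simp only: if_True if_False simp_thms)
      then show "\<forall>v\<in>{v. v \<in> R \<and> snd v = a - 1} - {v. v \<in> R \<and> snd v = a - 1 \<and> fst v \<in> e ` {1..n+1}}.
          g (k - 1) (fst v) x = 0" by blast
    qed blast
    finally show ?thesis .
  qed
  show ?thesis
  proof (intro exI[of _ "\<tau> x"] exI[of _ T] conjI ballI)
    show "\<tau> x 0 = 0" by (simp add: \<tau>_def)
    have "\<tau> x (n+1) = sum x (e ` {1..n+1})" by (simp only: \<tau>_def sum.reindex[OF e_inj] comp_def)
    also have "\<dots> = (\<Sum>c\<le>l * ?p. x c)"
    proof (rule sum.mono_neutral_left)
      show "e ` {1..n+1} \<subseteq> {..l * ?p}" using e_less by (simp add: image_subset_iff less_imp_le)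
      show "\<forall>c\<in>{..l * ?p} - e ` {1..n+1}. x c = 0" using X_zero unfolding X_def by blast
    qed simp
    finally show "\<tau> x (n+1) = 1" using simplex(2)[OF x] by simp
    show "\<tau> x (j - 1) \<le> \<tau> x j" if "j \<in> {1..n+1}" for j
      using \<tau>_step[of j x] simplex(1)[OF x, of "e j"] that by simp
    show "partition_into r T {1..n+1}"
      unfolding partition_into_def
    proof
      show "disjoint_family_on T {1..r}" by (auto simp: disjoint_family_on_def T_def)
      show "(\<Union>i\<in>{1..r}. T i) = {1..n+1}"
      proof (intro equalityI subsetI)
        fix j assume j: "j \<in> {1..n+1}"
        then have "j \<in> T (part j + 1)" by (simp add: T_def)
        moreover have "part j + 1 \<in> {1..r}" using part_less[OF j] by simp
        ultimately show "j \<in> (\<Union>i\<in>{1..r}. T i)" by blast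
      qed (auto simp: T_def)
    qed
    show "card (C i \<inter> T a) \<le> 1" if i: "i \<in> {1..l}" for i a
    proof -
      have "j = j'" if "j \<in> C i \<inter> T a" "j' \<in> C i \<inter> T a" for j j'
      proof -
        have "cl j = i" "cl j' = i" using cl_eq[OF i] that by blast+
        moreover have "part j = part j'" using that by (simp add: T_def)
        ultimately have "\<psi> i j = \<psi> i j'" by (simp add: part_def)
        then show ?thesis using that \<psi>[OF i] by (auto dest: inj_onD)
      qed
      then show ?thesis using fine[OF i] by (simp add: card_le_Suc0_iff_eq)
    qed
    show "(\<Sum>j\<in>T a. f k (\<tau> x j) - f k (\<tau> x (j - 1))) = (\<Sum>j\<in>T b. f k (\<tau> x j) - f k (\<tau> x (j - 1)))"
      if "k \<in> {1..m}" "a \<in> {1..r}" "b \<in> {1..r}" for k a b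
    proof -
      have "k - 1 < l" "a - 1 < r" "b - 1 < r" using that ml by auto
      then show ?thesis
        unfolding sums[OF that(1,2)] sums[OF that(1,3)] by (rule bal[rule_format])
    qed
  qed
qed

end
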